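(* Consider the sequential discontinuous Galerkin scheme for two-phase flow in a deformable porous medium described in the context (initialization at $t_0$, modified first step at $t_1$, and Steps 1–3 for $n\ge 1$), under the standing assumptions listed there. Assume that the functions $\lambda_w$ and $\lambda_o$ (the phase mobilities) are bounded below by positive constants. Then for any $n\ge 0$, the solutions $(P_w^n,P_o^n,\boldsymbol U^n)\in Q_h\times Q_h\times\boldsymbol V_h$ of the scheme exist and are unique.
   Context: **Domain, mesh, spaces.** $\Omega\subset\mathbb R^3$ is the porous medium, with boundary decomposed into Dirichlet and Neumann parts for the pressures and for the displacement: $\partial\Omega=\Gamma_{pD}\cup\Gamma_{pN}=\Gamma_{\boldsymbol uD}\cup\Gamma_{\boldsymbol uN}$. $\mathcal E_h$ is a partition of $\Omega$ into tetrahedra of maximum diameter $h$; $\Gamma_h$ is the set of interior faces; a sum over $e\in\Gamma_{pD}$ (etc.) is over the faces contained in that part of the boundary. $h_e$ is the size of the face $e$. For an interior face $e=\partial E_e^1\cap\partial E_e^2$, a unit normal $\boldsymbol n_e$ pointing from $E_e^1$ into $E_e^2$ is fixed, and $[q]=q|_{E_e^1}-q|_{E_e^2}$, $\{q\}=\frac12(q|_{E_e^1}+q|_{E_e^2})$. On a boundary face, $[q]=\{q\}=q|_e$ and $\boldsymbol n_e$ is the outward unit normal. $(\cdot,\cdot)_\Omega,(\cdot,\cdot)_E,(\cdot,\cdot)_e$ are $L^2$ inner products. The spaces are $Q_h=\{q\in L^2(\Omega): q|_E\in\mathbb P_1(E)\ \forall E\in\mathcal E_h\}$ and $\boldsymbol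 V_h=Q_h\times Q_h\times Q_h$. The DG norms are $$\|q_h\|_{DG}=\Big(\sum_{E\in\mathcal E_h}\|\nabla q_h\|_{L^2(E)}^2+\sum_{e\in\Gamma_h\cup\Gamma_{pD}}h_e^{-1}\|[q_h]\|_{L^2(e)}^2\Big)^{1/2}\quad (q_h\in Q_h),$$ and the same expression with $\Gamma_{\boldsymbol uD}$ in place of $\Gamma_{pD}$ for $\boldsymbol v_h\in\boldsymbol V_h$. **Physical data.** $\alpha$ (Biot–Willis constant), $K_s,K_w,K_o$ (bulk moduli of the solid and of the two fluid phases), $\lambda,\mu$ (Lamé parameters), $\mu_w,\mu_o$ (phase viscosities) are known constants, and $p_d>0$ is a constant entry pressure. The porosity $\phi$ and the permeability $K$ are given positive scalar functions on $\Omega$ ($K$ may be discontinuous). The capillary pressure is $p_c=p_c(s_w)=p_o-p_w$, with $s_w=(p_d/p_c)^2$. The mobilities $\lambda_w,\lambda_o$ are given functions of the saturation $s_w$, namely the ratios of relative permeability to viscosity (the model takes relative permeabilities $s_w^4$ and $(1-s_w)^2(1-s_w^2)$ for the wetting and non-wetting phase). Define $$\mathcal C_1(p_o,p_w)=\tfrac{\alpha-\phi}{K_s}s_w^2+\tfrac{\phi s_w}{K_w}+\Big(\tfrac{\alpha-\phi}{K_s}s_wp_c-\phi\Big)\tfrac{ds_w}{dp_c},$$ $$\mathcal C_2(p_o,p_w)=\tfrac{\alpha-\phi}{K_s}s_w(1-s_w)-\Big(\tfrac{\alpha-\phi}{K_s}s_wp_c-\phi\Big)\tfrac{ds_w}{dp_c},$$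 $$\mathcal C_3(p_o,p_w)=\tfrac{\alpha-\phi}{K_s}(1-s_w)^2+\tfrac{\phi(1-s_w)}{K_o}-\Big(\tfrac{\alpha-\phi}{K_s}(1-s_w)p_c+\phi\Big)\tfrac{ds_w}{dp_c},$$ $$\mathcal C_4(p_o,p_w)=\tfrac{\alpha-\phi}{K_s}s_w(1-s_w)+\Big(\tfrac{\alpha-\phi}{K_s}(1-s_w)p_c+\phi\Big)\tfrac{ds_w}{dp_c}.$$ The sources $f_w,f_o,\boldsymbol f_{\boldsymbol u}$, boundary data $p_{wD},p_{oD},g_w,g_o,\boldsymbol u_D,\boldsymbol g_{\boldsymbol u}$ and initial data $p_w^0,p_o^0,\boldsymbol u^0$ are given. **Standing assumptions.** (i) $\alpha-\phi\ge0$, and $p_c/K_s\ll1$ so that $\frac{\alpha-\phi}{K_s}s_wp_c-\phi\le0$; since $ds_w/dp_c<0$, one has $\mathcal C_1(p_o,p_w)\ge0$ and $\mathcal C_3(p_o,p_w)\ge0$. (ii) The penalty parameter $\sigma_{\boldsymbol u}$ is sufficiently large and, if $\epsilon_p=-1$, the penalty parameter $\sigma_p$ is sufficiently large, in the usual sense that the forms $a(\chi;\cdot,\cdot)$ (for the coefficients $\chi=\lambda_w^nK,\lambda_o^nK$) and $c(\cdot,\cdot)$ below are coercive on $Q_h$ and $\boldsymbol V_h$ with respect to the DG norms. How large $\sigma_p$ must be depends on trace constants and on the lower and upper bounds of $\chi$; how large $\sigma_{\boldsymbol u}$ must be depends on trace constants and the Lamé parameters. **Truncation and time levels.** For a fixed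 small $\epsilon>0$, $\Pi(q)=1-\epsilon$ where $q>1-\epsilon$, $\Pi(q)=q$ where $\epsilon\le q\le1-\epsilon$, and $\Pi(q)=\epsilon$ where $q<\epsilon$. $S_w^n=\Pi(p_c^{-1}(P_o^n-P_w^n))$, $\lambda_w^n=\lambda_w(S_w^n)$, $\lambda_o^n=\lambda_o(S_w^n)$. For time steps $\tau_0,\tau>0$: $t_0=0$, $t_1=\tau_0$, $t_n=t_1+(n-1)\tau$ for $n\ge2$. $\gamma>0$ is a user-specified stabilization constant. $\epsilon_p,\epsilon_{\boldsymbol u}\in\{-1,+1\}$; $\sigma_p,\sigma_{\boldsymbol u}>0$ are the penalty parameters. **Forms.** $$b_{\boldsymbol u}(\chi;\boldsymbol u,q)=-\sum_{E\in\mathcal E_h}(\boldsymbol u,\nabla(\chi q))_E+\sum_{e\in\Gamma_h\cup\partial\Omega}(\{\boldsymbol u\cdot\boldsymbol n_e\},[\chi q])_e,$$ $$b_p(q,\boldsymbol v)=\sum_{E\in\mathcal E_h}(\nabla q,\boldsymbol v)_E-\sum_{e\in\Gamma_h}([q],\{\boldsymbol v\cdot\boldsymbol n_e\})_e,$$ $$a(\chi;p,q)=\sum_{E\in\mathcal E_h}(\chi\nabla p,\nabla q)_E+\sum_{e\in\Gamma_h\cup\Gamma_{pD}}\sigma_ph_e^{-1}([p],[q])_e-\sum_{e\in\Gamma_h\cup\Gamma_{pD}}(\{\chi\nabla p\}\cdot\boldsymbol n_e,[q])_e+\epsilon_p\sum_{e\in\Gamma_h\cup\Gamma_{pD}}(\{\chi\nabla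 q\}\cdot\boldsymbol n_e,[p])_e,$$ $$c(\boldsymbol u,\boldsymbol v)=\mu\sum_{E\in\mathcal E_h}(\nabla\boldsymbol u,\nabla\boldsymbol v)_E+\mu\sum_{e\in\Gamma_h\cup\Gamma_{\boldsymbol uD}}\sigma_{\boldsymbol u}h_e^{-1}([\boldsymbol u],[\boldsymbol v])_e-\mu\sum_{e\in\Gamma_h\cup\Gamma_{\boldsymbol uD}}(\{\nabla\boldsymbol u\}\boldsymbol n_e,[\boldsymbol v])_e+\epsilon_{\boldsymbol u}\mu\sum_{e\in\Gamma_h\cup\Gamma_{\boldsymbol uD}}(\{\nabla\boldsymbol v\}\boldsymbol n_e,[\boldsymbol u])_e$$ $$\qquad+(\lambda+\mu)\sum_{E\in\mathcal E_h}(\nabla\cdot\boldsymbol u,\nabla\cdot\boldsymbol v)_E-(\lambda+\mu)\sum_{e\in\Gamma_h\cup\Gamma_{\boldsymbol uD}}(\{\nabla\cdot\boldsymbol u\},[\boldsymbol v\cdot\boldsymbol n_e])_e.$$ For $i\in\{w,o\}$ and $m\ge0$, $$\ell_i(t_{m+1};q_h)=(f_i(t_{m+1}),q_h)_\Omega+\epsilon_p\sum_{e\in\Gamma_{pD}}(\lambda_i^mK\nabla q_h\cdot\boldsymbol n_e,p_{iD}(t_{m+1}))_e+\sum_{e\in\Gamma_{pN}}(g_i(t_{m+1}),q_h)_e+\sum_{e\in\Gamma_{pD}}\sigma_ph_e^{-1}(p_{iD}(t_{m+1}),q_h)_e,$$ $$\ell_{\boldsymbol u}(t_{m+1};\boldsymbol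 v_h)=(\boldsymbol f_{\boldsymbol u}(t_{m+1}),\boldsymbol v_h)_\Omega+\epsilon_{\boldsymbol u}\mu\sum_{e\in\Gamma_{\boldsymbol uD}}(\nabla\boldsymbol v_h\,\boldsymbol n_e,\boldsymbol u_D(t_{m+1}))_e+\sum_{e\in\Gamma_{\boldsymbol uN}}(\boldsymbol g_{\boldsymbol u}(t_{m+1}),\boldsymbol v_h)_e+\sum_{e\in\Gamma_{\boldsymbol uD}}\sigma_{\boldsymbol u}h_e^{-1}(\boldsymbol u_D(t_{m+1}),\boldsymbol v_h)_e.$$ **Scheme.** All equations hold for all $q_h\in Q_h$, $\boldsymbol v_h\in\boldsymbol V_h$. *Level 0:* $P_w^0,P_o^0\in Q_h$, $\boldsymbol U^0\in\boldsymbol V_h$ are the $L^2(\Omega)$ projections of $p_w^0,p_o^0,\boldsymbol u^0$. *Level 1:* find successively $P_w^1,P_o^1\in Q_h$, $\boldsymbol U^1\in\boldsymbol V_h$ with $$\big(\mathcal C_1(P_o^0,P_w^0)\tfrac{P_w^1-P_w^0}{\tau_0},q_h\big)_\Omega+a(\lambda_w^0K;P_w^1,q_h)=\ell_w(t_1;q_h),$$ $$\big(\mathcal C_3(P_o^0,P_w^0)\tfrac{P_o^1-P_o^0}{\tau_0},q_h\big)_\Omega+a(\lambda_o^0K;P_o^1,q_h)=\ell_o(t_1;q_h)-\big(\mathcal C_4(P_o^0,P_w^0)\tfrac{P_w^1-P_w^0}{\tau_0},q_h\big)_\Omega,$$ $$c(\boldsymbol U^1,\boldsymbol v_h)=\ell_{\boldsymbol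 u}(t_1;\boldsymbol v_h)-b_p(S_w^1P_w^1+(1-S_w^1)P_o^1,\boldsymbol v_h).$$ *Levels $n+1$, $n\ge1$:* find successively $P_w^{n+1}\in Q_h$ (Step 1), $P_o^{n+1}\in Q_h$ (Step 2), $\boldsymbol U^{n+1}\in\boldsymbol V_h$ (Step 3) with $$\Big(\mathcal C_1(P_o^n,P_w^n)\tfrac{P_w^{n+1}-P_w^n}{\tau}+\mathcal C_2(P_o^n,P_w^n)\tfrac{P_o^n-P_o^{n-1}}{\tau},q_h\Big)_\Omega+a(\lambda_w^nK;P_w^{n+1},q_h)+\alpha\,b_{\boldsymbol u}\big(S_w^n;\tfrac{\boldsymbol U^n-\boldsymbol U^{n-1}}{\tau},q_h\big)=\ell_w(t_{n+1};q_h),$$ $$\Big(\mathcal C_3(P_o^n,P_w^n)\tfrac{P_o^{n+1}-P_o^n}{\tau}+\mathcal C_4(P_o^n,P_w^n)\tfrac{P_w^{n+1}-P_w^n}{\tau},q_h\Big)_\Omega+a(\lambda_o^nK;P_o^{n+1},q_h)+\alpha\,b_{\boldsymbol u}\big(1-S_w^n;\tfrac{\boldsymbol U^n-\boldsymbol U^{n-1}}{\tau},q_h\big)=\ell_o(t_{n+1};q_h),$$ $$c(\boldsymbol U^{n+1},\boldsymbol v_h)+b_p(S_w^{n+1}P_w^{n+1}+(1-S_w^{n+1})P_o^{n+1},\boldsymbol v_h)+\gamma\Big(\tfrac{\boldsymbol U^{n+1}-\boldsymbol U^n}{\tau},\boldsymbol v_h\Big)_\Omega-\gamma\Big(\tfrac{\boldsymbol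 U^n-\boldsymbol U^{n-1}}{\tau},\boldsymbol v_h\Big)_\Omega=\ell_{\boldsymbol u}(t_{n+1};\boldsymbol v_h).$$ *)

theory Defs
  imports "HOL-Analysis.Analysis"
begin

type_synonym point = "real^3"

text \<open>
  A function that is only piecewise regular on a mesh is represented by the family of its
  restrictions: for an element \<^term>\<open>E\<close>, the value \<^term>\<open>f E x\<close> is the value at \<^term>\<open>x\<close> of the
  restriction of \<^term>\<open>f\<close> to \<^term>\<open>E\<close>; for \<^term>\<open>x\<close> on the boundary of \<^term>\<open>E\<close> it is the trace
  taken from inside \<^term>\<open>E\<close>.  An ordinary function \<^term>\<open>g\<close> on the domain is the family
  \<^term>\<open>\<lambda>E. g\<close>.
\<close>

type_synonym 'b broken = "point set \<Rightarrow> point \<Rightarrow> 'b"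

definition grad :: "(point \<Rightarrow> real) \<Rightarrow> point \<Rightarrow> point" where
  "grad f x = (THE g. GDERIV f x :> g)"

text \<open>
  The functions differentiated below are smooth on an element except possibly on finitely many
  planes (the kinks of the truncation), so the pointwise gradient is the weak gradient almost
  everywhere.
\<close>

definition bgrad :: "real broken \<Rightarrow> point broken" where
  "bgrad q E x = grad (q E) x"

definition bjac :: "point broken \<Rightarrow> (real^3^3) broken" where
  "bjac v E x = (\<chi> i. grad (\<lambda>y. v E y $ i) x)"

definition bdiv :: "point broken \<Rightarrow> real broken" where
  "bdiv v E x = trace (bjac v E x)"

text \<open>
  On \<^typ>\<open>real^3^3\<close> the inner product is the Frobenius product, as needed for products of
  displacement gradients.
\<close>

definition ip_elem :: "point set \<Rightarrow> (point \<Rightarrow> 'b::real_inner) \<Rightarrow> (point \<Rightarrow> 'b) \<Rightarrow> real" where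
  "ip_elem E f g = (LINT x|lebesgue_on E. f x \<bullet> g x)"

text \<open>
  Surface integrals over a planar set \<^term>\<open>e\<close> are integrals with respect to two-dimensional Lebesgue
  measure in an isometric parametrization of the plane spanned by \<^term>\<open>e\<close>; Lebesgue measure being
  invariant under isometries, the choice of the parametrization is irrelevant.
\<close>

definition plane_chart :: "point set \<Rightarrow> real^2 \<Rightarrow> point" where
  "plane_chart e = (SOME r. (\<forall>z z'. dist (r z) (r z') = dist z z') \<and> range r = affine hull e)"

definition face_space :: "point set \<Rightarrow> (real^2) measure" where
  "face_space e = lebesgue_on (plane_chart e -` e)"

definition ip_face :: "point set \<Rightarrow> (point \<Rightarrow> 'b::real_inner) \<Rightarrow> (point \<Rightarrow> 'b) \<Rightarrow> real" where
  "ip_face e f g = (LINT z|face_space e. f (plane_chart e z) \<bullet> g (plane_chart e z))"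

definition sq_integrable :: "'c measure \<Rightarrow> ('c \<Rightarrow> 'b::euclidean_space) \<Rightarrow> bool" where
  "sq_integrable M f \<longleftrightarrow> f \<in> borel_measurable M \<and> integrable M (\<lambda>x. (norm (f x))\<^sup>2)"

abbreviation L2_vol :: "point set \<Rightarrow> (point \<Rightarrow> 'b::euclidean_space) \<Rightarrow> bool" where
  "L2_vol S f \<equiv> sq_integrable (lebesgue_on S) f"

abbreviation L2_faces :: "point set set \<Rightarrow> (point \<Rightarrow> 'b::euclidean_space) \<Rightarrow> bool" where
  "L2_faces F f \<equiv> (\<forall>e\<in>F. sq_integrable (face_space e) (\<lambda>z. f (plane_chart e z)))"

lemma plane_chart_exists:
  fixes e :: "point set"
  assumes "aff_dim e = 2"
  shows "\<exists>r :: real^2 \<Rightarrow> point. (\<forall>z z'. dist (r z) (r z') = dist z z') \<and> range r = affine hull e"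
proof -
  from assms obtain a where a: "a \<in> e"
    by fastforce
  define S where "S = (\<lambda>x. -a + x) ` (affine hull e)"
  have sub: "subspace S"
    unfolding S_def using a affine_diffs_subspace[of "affine hull e" a]
    by (simp add: hull_inc)
  have "int (dim S) = aff_dim (affine hull e)"
    unfolding S_def using a aff_dim_eq_dim[of a "affine hull e"] by (simp add: hull_inc)
  hence "dim (UNIV :: (real^2) set) = dim S"
    using assms by simp
  then obtain f :: "real^2 \<Rightarrow> point" where f: "linear f" "f ` UNIV = S" "\<And>x. norm (f x) = norm x"
    using isometries_subspaces[OF subspace_UNIV sub] by (metis UNIV_I)
  have "dist (a + f z) (a + f z') = dist z z'" for z z'
    using f by (simp add: dist_norm linear_diff[OF f(1), symmetric])
  moreover have "range (\<lambda>z. a + f z) = affine hull e"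
  proof -
    have "range (\<lambda>z. a + f z) = (\<lambda>x. a + x) ` S"
      using f(2) by auto
    thus ?thesis
      by (simp add: S_def image_image)
  qed
  ultimately show ?thesis
    by (intro exI[of _ "\<lambda>z. a + f z"]) blast
qed

text \<open>
  The permeability is a broken function because its one-sided values on faces enter the scheme.
  \<^term>\<open>lame\<close> and \<^term>\<open>mu\<close> are the two Lame parameters, \<^term>\<open>eps\<close> is the truncation parameter,
  \<^term>\<open>gam\<close> the stabilization constant, and \<^term>\<open>side1 e\<close>, \<^term>\<open>side2 e\<close> are the two elements
  adjacent to an interior face \<^term>\<open>e\<close> (for a boundary face, \<^term>\<open>side1 e\<close> is its only neighbour).
  Boundary parts are sets of points.
\<close>

record biot =
  Om :: "point set"
  mesh :: "point set set"
  side1 :: "point set \<Rightarrow> point set"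
  side2 :: "point set \<Rightarrow> point set"
  Gam_pD :: "point set"
  Gam_pN :: "point set"
  Gam_uD :: "point set"
  Gam_uN :: "point set"
  alpha :: real
  K_s :: real
  K_w :: real
  K_o :: real
  lame :: real
  mu :: real
  visc_w :: real
  visc_o :: real
  p_d :: real
  poro :: "point \<Rightarrow> real"
  perm :: "real broken"
  kr_w :: "real \<Rightarrow> real"
  kr_o :: "real \<Rightarrow> real"
  f_w :: "real \<Rightarrow> point \<Rightarrow> real"
  f_o :: "real \<Rightarrow> point \<Rightarrow> real"
  f_u :: "real \<Rightarrow> point \<Rightarrow> point"
  p_wD :: "real \<Rightarrow> point \<Rightarrow> real"
  p_oD :: "real \<Rightarrow> point \<Rightarrow> real"
  u_D :: "real \<Rightarrow> point \<Rightarrow> point"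
  g_w :: "real \<Rightarrow> point \<Rightarrow> real"
  g_o :: "real \<Rightarrow> point \<Rightarrow> real"
  g_u :: "real \<Rightarrow> point \<Rightarrow> point"
  p_w0 :: "point \<Rightarrow> real"
  p_o0 :: "point \<Rightarrow> real"
  u_0 :: "point \<Rightarrow> point"
  tau0 :: real
  tau :: real
  eps :: real
  gam :: real
  eps_p :: real
  eps_u :: real
  sigma_p :: real
  sigma_u :: real

definition int_faces :: "biot \<Rightarrow> point set set" where
  "int_faces D = {e. \<exists>E\<in>mesh D. \<exists>E'\<in>mesh D.
     E \<noteq> E' \<and> e = frontier E \<inter> frontier E' \<and> aff_dim e = 2}"

definition bd_faces :: "biot \<Rightarrow> point set set" where
  "bd_faces D = {e. e \<subseteq> frontier (Om D) \<and> (\<exists>E\<in>mesh D. e facet_of E)}"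

definition part_faces :: "biot \<Rightarrow> point set \<Rightarrow> point set set" where
  "part_faces D G = {e \<in> bd_faces D. e \<subseteq> G}"

definition splits_boundary :: "biot \<Rightarrow> point set \<Rightarrow> point set \<Rightarrow> bool" where
  "splits_boundary D GD GN \<longleftrightarrow>
     GD \<union> GN = frontier (Om D) \<and> (\<forall>e\<in>bd_faces D. e \<subseteq> GD \<longleftrightarrow> \<not> e \<subseteq> GN)"

text \<open>
  Hanging nodes are allowed; what is required is that the boundary of the domain is made up of
  whole faces of elements, which is automatic for a conforming mesh.
\<close>

definition valid_mesh :: "biot \<Rightarrow> bool" where
  "valid_mesh D \<longleftrightarrow>
     finite (mesh D) \<and> mesh D \<noteq> {} \<and>
     (\<forall>E\<in>mesh D. 3 simplex E) \<and>
     (\<forall>E\<in>mesh D. \<forall>E'\<in>mesh D. E \<noteq> E' \<longrightarrow> interior E \<inter> interior E' = {}) \<and>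
     Om D = interior (\<Union> (mesh D)) \<and>
     frontier (Om D) = \<Union> (bd_faces D) \<and>
     (\<forall>e\<in>int_faces D. side1 D e \<in> mesh D \<and> side2 D e \<in> mesh D \<and> side1 D e \<noteq> side2 D e \<and>
        e = frontier (side1 D e) \<inter> frontier (side2 D e)) \<and>
     (\<forall>e\<in>bd_faces D. side1 D e \<in> mesh D \<and> e facet_of side1 D e) \<and>
     splits_boundary D (Gam_pD D) (Gam_pN D) \<and>
     splits_boundary D (Gam_uD D) (Gam_uN D)"

definition faces_p :: "biot \<Rightarrow> point set set" where
  "faces_p D = int_faces D \<union> part_faces D (Gam_pD D)"

definition faces_u :: "biot \<Rightarrow> point set set" where
  "faces_u D = int_faces D \<union> part_faces D (Gam_uD D)"

text \<open>
  The unit normal points out of \<^term>\<open>side1 D e\<close>: into \<^term>\<open>side2 D e\<close> for an interior face, out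
  of the domain for a boundary face.
\<close>

definition nrml :: "biot \<Rightarrow> point set \<Rightarrow> point" where
  "nrml D e = (THE n. norm n = 1 \<and> (\<forall>x\<in>side1 D e. \<forall>y\<in>e. n \<bullet> (x - y) \<le> 0))"

definition jump :: "biot \<Rightarrow> point set \<Rightarrow> 'b::real_vector broken \<Rightarrow> point \<Rightarrow> 'b" where
  "jump D e q x = (if e \<in> int_faces D then q (side1 D e) x - q (side2 D e) x else q (side1 D e) x)"

definition avg :: "biot \<Rightarrow> point set \<Rightarrow> 'b::real_vector broken \<Rightarrow> point \<Rightarrow> 'b" where
  "avg D e q x =
     (if e \<in> int_faces D then (1/2) *\<^sub>R (q (side1 D e) x + q (side2 D e) x) else q (side1 D e) x)"

definition h_face :: "point set \<Rightarrow> real" where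
  "h_face e = diameter e"

text \<open>
  The inner product of \<open>L\<^sup>2(\<Omega>)\<close>, split into elements.
\<close>

definition ip_Om :: "biot \<Rightarrow> 'b::real_inner broken \<Rightarrow> 'b broken \<Rightarrow> real" where
  "ip_Om D f g = (\<Sum>E\<in>mesh D. ip_elem E (f E) (g E))"

text \<open>
  An element of the discrete space is the family of its first-degree polynomials on the elements;
  the value outside the mesh is fixed so that equality of families is equality in \<open>L\<^sup>2(\<Omega>)\<close>.
\<close>

definition Q_h :: "biot \<Rightarrow> real broken set" where
  "Q_h D = {q. (\<forall>E\<in>mesh D. \<exists>a b. q E = (\<lambda>x. a + b \<bullet> x)) \<and> (\<forall>E. E \<notin> mesh D \<longrightarrow> q E = (\<lambda>x. 0))}"

definition V_h :: "biot \<Rightarrow> point broken set" where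
  "V_h D = {v. \<forall>i. (\<lambda>E x. v E x $ i) \<in> Q_h D}"

definition dg_norm_p :: "biot \<Rightarrow> real broken \<Rightarrow> real" where
  "dg_norm_p D q = sqrt (ip_Om D (bgrad q) (bgrad q)
     + (\<Sum>e\<in>faces_p D. 1 / h_face e * ip_face e (jump D e q) (jump D e q)))"

definition dg_norm_u :: "biot \<Rightarrow> point broken \<Rightarrow> real" where
  "dg_norm_u D v = sqrt (ip_Om D (bjac v) (bjac v)
     + (\<Sum>e\<in>faces_u D. 1 / h_face e * ip_face e (jump D e v) (jump D e v)))"

definition coercive :: "'v set \<Rightarrow> ('v \<Rightarrow> real) \<Rightarrow> ('v \<Rightarrow> 'v \<Rightarrow> real) \<Rightarrow> bool" where
  "coercive V N B \<longleftrightarrow> (\<exists>\<kappa>>0. \<forall>v\<in>V. \<kappa> * (N v)\<^sup>2 \<le> B v v)"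

definition sat :: "biot \<Rightarrow> real \<Rightarrow> real" where
  "sat D p = (p_d D / p)\<^sup>2"

definition mob_w :: "biot \<Rightarrow> real \<Rightarrow> real" where
  "mob_w D s = kr_w D s / visc_w D"

definition mob_o :: "biot \<Rightarrow> real \<Rightarrow> real" where
  "mob_o D s = kr_o D s / visc_o D"

definition trunc :: "biot \<Rightarrow> real \<Rightarrow> real" where
  "trunc D q = (if q > 1 - eps D then 1 - eps D else if q < eps D then eps D else q)"

definition S_w :: "biot \<Rightarrow> real broken \<Rightarrow> real broken \<Rightarrow> real broken" where
  "S_w D Po Pw E x = trunc D (sat D (Po E x - Pw E x))"

definition chi_w :: "biot \<Rightarrow> real broken \<Rightarrow> real broken" where
  "chi_w D S E x = mob_w D (S E x) * perm D E x"

definition chi_o :: "biot \<Rightarrow> real broken \<Rightarrow> real broken" where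
  "chi_o D S E x = mob_o D (S E x) * perm D E x"

definition C1 :: "biot \<Rightarrow> real broken \<Rightarrow> real broken \<Rightarrow> real broken" where
  "C1 D Po Pw E x = (let \<phi> = poro D x; pc = Po E x - Pw E x; s = sat D pc; ds = deriv (sat D) pc in
     (alpha D - \<phi>) / K_s D * s\<^sup>2 + \<phi> * s / K_w D + ((alpha D - \<phi>) / K_s D * s * pc - \<phi>) * ds)"

definition C2 :: "biot \<Rightarrow> real broken \<Rightarrow> real broken \<Rightarrow> real broken" where
  "C2 D Po Pw E x = (let \<phi> = poro D x; pc = Po E x - Pw E x; s = sat D pc; ds = deriv (sat D) pc in
     (alpha D - \<phi>) / K_s D * s * (1 - s) - ((alpha D - \<phi>) / K_s D * s * pc - \<phi>) * ds)"

definition C3 :: "biot \<Rightarrow> real broken \<Rightarrow> real broken \<Rightarrow> real broken" where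
  "C3 D Po Pw E x = (let \<phi> = poro D x; pc = Po E x - Pw E x; s = sat D pc; ds = deriv (sat D) pc in
     (alpha D - \<phi>) / K_s D * (1 - s)\<^sup>2 + \<phi> * (1 - s) / K_o D
       - ((alpha D - \<phi>) / K_s D * (1 - s) * pc + \<phi>) * ds)"

definition C4 :: "biot \<Rightarrow> real broken \<Rightarrow> real broken \<Rightarrow> real broken" where
  "C4 D Po Pw E x = (let \<phi> = poro D x; pc = Po E x - Pw E x; s = sat D pc; ds = deriv (sat D) pc in
     (alpha D - \<phi>) / K_s D * s * (1 - s) + ((alpha D - \<phi>) / K_s D * (1 - s) * pc + \<phi>) * ds)"

lemma deriv_sat:
  assumes "p \<noteq> 0"
  shows "deriv (sat D) p = - 2 * (p_d D)\<^sup>2 / p ^ 3"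
proof (rule DERIV_imp_deriv)
  have "((\<lambda>p. (p_d D / p)\<^sup>2) has_field_derivative - 2 * (p_d D)\<^sup>2 / p ^ 3) (at p)"
    using assms by (auto intro!: derivative_eq_intros simp: power2_eq_square power3_eq_cube mult_ac)
  thus "(sat D has_field_derivative - 2 * (p_d D)\<^sup>2 / p ^ 3) (at p)"
    by (simp add: sat_def[abs_def])
qed

definition b_u :: "biot \<Rightarrow> real broken \<Rightarrow> point broken \<Rightarrow> real broken \<Rightarrow> real" where
  "b_u D \<kappa> u q =
     - ip_Om D u (bgrad (\<lambda>E x. \<kappa> E x * q E x))
     + (\<Sum>e\<in>int_faces D \<union> bd_faces D.
          ip_face e (avg D e (\<lambda>E x. u E x \<bullet> nrml D e)) (jump D e (\<lambda>E x. \<kappa> E x * q E x)))"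

definition b_p :: "biot \<Rightarrow> real broken \<Rightarrow> point broken \<Rightarrow> real" where
  "b_p D q v =
     ip_Om D (bgrad q) v
     - (\<Sum>e\<in>int_faces D. ip_face e (jump D e q) (avg D e (\<lambda>E x. v E x \<bullet> nrml D e)))"

definition a_form :: "biot \<Rightarrow> real broken \<Rightarrow> real broken \<Rightarrow> real broken \<Rightarrow> real" where
  "a_form D \<kappa> p q =
     ip_Om D (\<lambda>E x. \<kappa> E x *\<^sub>R bgrad p E x) (bgrad q)
     + (\<Sum>e\<in>faces_p D. sigma_p D / h_face e * ip_face e (jump D e p) (jump D e q))
     - (\<Sum>e\<in>faces_p D.
          ip_face e (\<lambda>x. avg D e (\<lambda>E x. \<kappa> E x *\<^sub>R bgrad p E x) x \<bullet> nrml D e) (jump D e q))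
     + eps_p D * (\<Sum>e\<in>faces_p D.
          ip_face e (\<lambda>x. avg D e (\<lambda>E x. \<kappa> E x *\<^sub>R bgrad q E x) x \<bullet> nrml D e) (jump D e p))"

definition c_form :: "biot \<Rightarrow> point broken \<Rightarrow> point broken \<Rightarrow> real" where
  "c_form D u v =
     mu D * ip_Om D (bjac u) (bjac v)
     + mu D * (\<Sum>e\<in>faces_u D. sigma_u D / h_face e * ip_face e (jump D e u) (jump D e v))
     - mu D * (\<Sum>e\<in>faces_u D. ip_face e (\<lambda>x. avg D e (bjac u) x *v nrml D e) (jump D e v))
     + eps_u D * mu D *
         (\<Sum>e\<in>faces_u D. ip_face e (\<lambda>x. avg D e (bjac v) x *v nrml D e) (jump D e u))
     + (lame D + mu D) * ip_Om D (bdiv u) (bdiv v)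
     - (lame D + mu D) *
         (\<Sum>e\<in>faces_u D. ip_face e (avg D e (bdiv u)) (jump D e (\<lambda>E x. v E x \<bullet> nrml D e)))"

text \<open>
  On boundary faces \<^const>\<open>avg\<close> is the one-sided trace.
\<close>

definition ell_p :: "biot \<Rightarrow> real broken \<Rightarrow> (point \<Rightarrow> real) \<Rightarrow> (point \<Rightarrow> real) \<Rightarrow> (point \<Rightarrow> real)
    \<Rightarrow> real broken \<Rightarrow> real" where
  "ell_p D \<kappa> f pD g q =
     ip_Om D (\<lambda>E. f) q
     + eps_p D * (\<Sum>e\<in>part_faces D (Gam_pD D).
          ip_face e (\<lambda>x. avg D e (\<lambda>E x. \<kappa> E x *\<^sub>R bgrad q E x) x \<bullet> nrml D e) pD)
     + (\<Sum>e\<in>part_faces D (Gam_pN D). ip_face e g (avg D e q))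
     + (\<Sum>e\<in>part_faces D (Gam_pD D). sigma_p D / h_face e * ip_face e pD (avg D e q))"

definition ell_w :: "biot \<Rightarrow> real \<Rightarrow> real broken \<Rightarrow> real broken \<Rightarrow> real" where
  "ell_w D t S q = ell_p D (chi_w D S) (f_w D t) (p_wD D t) (g_w D t) q"

definition ell_o :: "biot \<Rightarrow> real \<Rightarrow> real broken \<Rightarrow> real broken \<Rightarrow> real" where
  "ell_o D t S q = ell_p D (chi_o D S) (f_o D t) (p_oD D t) (g_o D t) q"

definition ell_u :: "biot \<Rightarrow> real \<Rightarrow> point broken \<Rightarrow> real" where
  "ell_u D t v =
     ip_Om D (\<lambda>E. f_u D t) v
     + eps_u D * mu D * (\<Sum>e\<in>part_faces D (Gam_uD D).
          ip_face e (\<lambda>x. avg D e (bjac v) x *v nrml D e) (u_D D t))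
     + (\<Sum>e\<in>part_faces D (Gam_uN D). ip_face e (g_u D t) (avg D e v))
     + (\<Sum>e\<in>part_faces D (Gam_uD D). sigma_u D / h_face e * ip_face e (u_D D t) (avg D e v))"

definition time :: "biot \<Rightarrow> nat \<Rightarrow> real" where
  "time D n = (if n = 0 then 0 else tau0 D + (real n - 1) * tau D)"

text \<open>
  A state consists of the wetting pressure, the non-wetting pressure and the displacement.
\<close>

type_synonym state = "real broken \<times> real broken \<times> point broken"

definition diffq :: "real \<Rightarrow> 'b::real_vector broken \<Rightarrow> 'b broken \<Rightarrow> 'b broken" where
  "diffq dt f g E x = (1 / dt) *\<^sub>R (f E x - g E x)"

definition p_tot :: "biot \<Rightarrow> real broken \<Rightarrow> real broken \<Rightarrow> real broken" where
  "p_tot D Po Pw E x = S_w D Po Pw E x * Pw E x + (1 - S_w D Po Pw E x) * Po E x"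

definition states :: "biot \<Rightarrow> state set" where
  "states D = Q_h D \<times> Q_h D \<times> V_h D"

fun level0 :: "biot \<Rightarrow> state \<Rightarrow> bool" where
  "level0 D (Pw, Po, U) \<longleftrightarrow>
     (\<forall>q\<in>Q_h D. ip_Om D Pw q = ip_Om D (\<lambda>E. p_w0 D) q) \<and>
     (\<forall>q\<in>Q_h D. ip_Om D Po q = ip_Om D (\<lambda>E. p_o0 D) q) \<and>
     (\<forall>v\<in>V_h D. ip_Om D U v = ip_Om D (\<lambda>E. u_0 D) v)"

fun level1 :: "biot \<Rightarrow> state \<Rightarrow> state \<Rightarrow> bool" where
  "level1 D (Pw0, Po0, U0) (Pw1, Po1, U1) \<longleftrightarrow>
     (let S0 = S_w D Po0 Pw0; t1 = time D 1 in
     (\<forall>q\<in>Q_h D.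
        ip_Om D (\<lambda>E x. C1 D Po0 Pw0 E x * diffq (tau0 D) Pw1 Pw0 E x) q
        + a_form D (chi_w D S0) Pw1 q
        = ell_w D t1 S0 q) \<and>
     (\<forall>q\<in>Q_h D.
        ip_Om D (\<lambda>E x. C3 D Po0 Pw0 E x * diffq (tau0 D) Po1 Po0 E x) q
        + a_form D (chi_o D S0) Po1 q
        = ell_o D t1 S0 q
          - ip_Om D (\<lambda>E x. C4 D Po0 Pw0 E x * diffq (tau0 D) Pw1 Pw0 E x) q) \<and>
     (\<forall>v\<in>V_h D.
        c_form D U1 v = ell_u D t1 v - b_p D (p_tot D Po1 Pw1) v))"

text \<open>
  \<open>level_step D n X Y Z\<close>: from the states \<open>X\<close> and \<open>Y\<close> at levels \<open>n - 1\<close> and \<open>n\<close>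
  to the state \<open>Z\<close> at level \<open>n + 1\<close>.
\<close>

fun level_step :: "biot \<Rightarrow> nat \<Rightarrow> state \<Rightarrow> state \<Rightarrow> state \<Rightarrow> bool" where
  "level_step D n (Pw0, Po0, U0) (Pw1, Po1, U1) (Pw2, Po2, U2) \<longleftrightarrow>
     (let S1 = S_w D Po1 Pw1; t = time D (n + 1) in
     (\<forall>q\<in>Q_h D.
        ip_Om D (\<lambda>E x. C1 D Po1 Pw1 E x * diffq (tau D) Pw2 Pw1 E x
                      + C2 D Po1 Pw1 E x * diffq (tau D) Po1 Po0 E x) q
        + a_form D (chi_w D S1) Pw2 q
        + alpha D * b_u D S1 (diffq (tau D) U1 U0) q
        = ell_w D t S1 q) \<and>
     (\<forall>q\<in>Q_h D.
        ip_Om D (\<lambda>E x. C3 D Po1 Pw1 E x * diffq (tau D) Po2 Po1 E x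
                      + C4 D Po1 Pw1 E x * diffq (tau D) Pw2 Pw1 E x) q
        + a_form D (chi_o D S1) Po2 q
        + alpha D * b_u D (\<lambda>E x. 1 - S1 E x) (diffq (tau D) U1 U0) q
        = ell_o D t S1 q) \<and>
     (\<forall>v\<in>V_h D.
        c_form D U2 v + b_p D (p_tot D Po2 Pw2) v
        + gam D * ip_Om D (diffq (tau D) U2 U1) v
        - gam D * ip_Om D (diffq (tau D) U1 U0) v
        = ell_u D t v))"

definition solves_upto :: "biot \<Rightarrow> nat \<Rightarrow> (nat \<Rightarrow> state) \<Rightarrow> bool" where
  "solves_upto D n Z \<longleftrightarrow>
     (\<forall>m\<le>n. Z m \<in> states D) \<and>
     level0 D (Z 0) \<and>
     (1 \<le> n \<longrightarrow> level1 D (Z 0) (Z 1)) \<and>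
     (\<forall>m. 1 \<le> m \<and> m < n \<longrightarrow> level_step D m (Z (m - 1)) (Z m) (Z (m + 1)))"

definition dg_solution :: "biot \<Rightarrow> nat \<Rightarrow> state \<Rightarrow> bool" where
  "dg_solution D n z \<longleftrightarrow> (\<exists>Z. solves_upto D n Z \<and> Z n = z)"

definition valid_data :: "biot \<Rightarrow> bool" where
  "valid_data D \<longleftrightarrow>
     0 < K_s D \<and> 0 < K_w D \<and> 0 < K_o D \<and> 0 < mu D \<and> 0 < visc_w D \<and> 0 < visc_o D \<and> 0 < p_d D \<and>
     0 < tau0 D \<and> 0 < tau D \<and> 0 < eps D \<and> eps D < 1/2 \<and> 0 < gam D \<and>
     eps_p D \<in> {-1, 1} \<and> eps_u D \<in> {-1, 1} \<and> 0 < sigma_p D \<and> 0 < sigma_u D \<and>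
     poro D \<in> borel_measurable (lebesgue_on (Om D)) \<and> (\<forall>x\<in>Om D. 0 < poro D x) \<and>
     (\<forall>E\<in>mesh D. perm D E \<in> borel_measurable (restrict_space borel E) \<and>
        (\<forall>x\<in>E. 0 < perm D E x) \<and> bdd_above (perm D E ` E)) \<and>
     (\<forall>\<kappa>\<in>{mob_w D, mob_o D}. \<kappa> \<in> borel_measurable (restrict_space borel {eps D..1 - eps D}) \<and>
        bdd_above (\<kappa> ` {eps D..1 - eps D})) \<and>
     L2_vol (Om D) (p_w0 D) \<and> L2_vol (Om D) (p_o0 D) \<and> L2_vol (Om D) (u_0 D) \<and>
     (\<forall>m. let t = time D (m + 1) in
        L2_vol (Om D) (f_w D t) \<and> L2_vol (Om D) (f_o D t) \<and> L2_vol (Om D) (f_u D t) \<and>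
        L2_faces (part_faces D (Gam_pD D)) (p_wD D t) \<and>
        L2_faces (part_faces D (Gam_pD D)) (p_oD D t) \<and>
        L2_faces (part_faces D (Gam_pN D)) (g_w D t) \<and>
        L2_faces (part_faces D (Gam_pN D)) (g_o D t) \<and>
        L2_faces (part_faces D (Gam_uD D)) (u_D D t) \<and>
        L2_faces (part_faces D (Gam_uN D)) (g_u D t))"

text \<open>
  The sign conditions at a pair of discrete pressures.  Positivity of the capillary pressure is
  what makes the coefficients well defined (integrable) and the derivative of the saturation
  negative.  Nonnegativity of \<^const>\<open>C1\<close> follows.  Nonnegativity of \<^const>\<open>C3\<close>
  follows as well wherever the saturation is at most 1 (lemmas below); it has to be listed because a
  discrete capillary pressure below the entry pressure, which the truncation allows for, yields
  a value of \<^const>\<open>sat\<close> above 1.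
\<close>

definition sign_conditions :: "biot \<Rightarrow> real broken \<Rightarrow> real broken \<Rightarrow> bool" where
  "sign_conditions D Po Pw \<longleftrightarrow> (\<forall>E\<in>mesh D.
     (\<forall>x\<in>E. 0 < Po E x - Pw E x) \<and>
     (\<forall>x\<in>E \<inter> Om D. (alpha D - poro D x) / K_s D * sat D (Po E x - Pw E x) * (Po E x - Pw E x)
        - poro D x \<le> 0) \<and>
     (\<forall>x\<in>E \<inter> Om D. 0 \<le> C3 D Po Pw E x))"

definition standing_i :: "biot \<Rightarrow> bool" where
  "standing_i D \<longleftrightarrow>
     (\<forall>x\<in>Om D. 0 \<le> alpha D - poro D x) \<and>
     (\<forall>n Pw Po U. dg_solution D n (Pw, Po, U) \<longrightarrow> sign_conditions D Po Pw)"

definition standing_ii :: "biot \<Rightarrow> bool" where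
  "standing_ii D \<longleftrightarrow>
     coercive (V_h D) (dg_norm_u D) (c_form D) \<and>
     (eps_p D = -1 \<longrightarrow> (\<forall>n Pw Po U. dg_solution D n (Pw, Po, U) \<longrightarrow>
        coercive (Q_h D) (dg_norm_p D) (a_form D (chi_w D (S_w D Po Pw))) \<and>
        coercive (Q_h D) (dg_norm_p D) (a_form D (chi_o D (S_w D Po Pw)))))"

text \<open>
  The DG norms are norms, that is, definite; this expresses that the Dirichlet parts are large
  enough (one Dirichlet face on each connected component of the domain).
\<close>

definition dg_norms_definite :: "biot \<Rightarrow> bool" where
  "dg_norms_definite D \<longleftrightarrow>
     (\<forall>q\<in>Q_h D. dg_norm_p D q = 0 \<longrightarrow> q = (\<lambda>E x. 0)) \<and>
     (\<forall>v\<in>V_h D. dg_norm_u D v = 0 \<longrightarrow> v = (\<lambda>E x. 0))"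

lemma C1_nonneg:
  assumes "valid_data D" "x \<in> Om D" "0 \<le> alpha D - poro D x" "0 < Po E x - Pw E x"
    and "(alpha D - poro D x) / K_s D * sat D (Po E x - Pw E x) * (Po E x - Pw E x) - poro D x \<le> 0"
  shows "0 \<le> C1 D Po Pw E x"
proof -
  define p where "p = Po E x - Pw E x"
  have p: "0 < p" and pos: "0 < K_s D" "0 < K_w D" "0 < poro D x"
    using assms by (auto simp: valid_data_def p_def)
  have "0 \<le> sat D p"
    by (simp add: sat_def)
  moreover have "deriv (sat D) p \<le> 0"
    using p by (simp add: deriv_sat)
  ultimately show ?thesis
    unfolding C1_def Let_def p_def[symmetric] using pos assms(3) assms(5)[folded p_def]
    by (intro add_nonneg_nonneg mult_nonneg_nonneg divide_nonneg_nonneg mult_nonpos_nonpos) auto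
qed

lemma C3_nonneg:
  assumes "valid_data D" "x \<in> Om D" "0 \<le> alpha D - poro D x" "0 < Po E x - Pw E x"
    and "sat D (Po E x - Pw E x) \<le> 1"
  shows "0 \<le> C3 D Po Pw E x"
proof -
  define p where "p = Po E x - Pw E x"
  have p: "0 < p" and pos: "0 < K_s D" "0 < K_o D" "0 < poro D x"
    using assms by (auto simp: valid_data_def p_def)
  have "deriv (sat D) p \<le> 0"
    using p by (simp add: deriv_sat)
  moreover have "0 \<le> (alpha D - poro D x) / K_s D * (1 - sat D p) * p + poro D x"
    using pos p assms(3) assms(5)[folded p_def]
    by (intro add_nonneg_nonneg mult_nonneg_nonneg divide_nonneg_nonneg) auto
  ultimately have "((alpha D - poro D x) / K_s D * (1 - sat D p) * p + poro D x) * deriv (sat D) p \<le> 0"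
    by (rule mult_nonneg_nonpos[rotated])
  moreover have "0 \<le> (alpha D - poro D x) / K_s D * (1 - sat D p)\<^sup>2 + poro D x * (1 - sat D p) / K_o D"
    using pos assms(3) assms(5)[folded p_def]
    by (intro add_nonneg_nonneg mult_nonneg_nonneg divide_nonneg_nonneg) auto
  ultimately show ?thesis
    unfolding C3_def Let_def p_def[symmetric] by linarith
qed

end

theory Submission
  imports Defs "HOL-Library.Function_Algebras"
begin

text \<open>
  Given the earlier levels, each of the three substeps of a time level asks for \<open>u\<close> in a
  finite-dimensional space with \<open>B(u, v) = L(v)\<close> for all \<open>v\<close>, where \<open>B\<close> is bilinear and
  \<open>B(u, u) = 0\<close> forces \<open>u = 0\<close>; such problems are uniquely solvable. Definiteness of the pressure
  forms comes from \<open>C\<^sub>1, C\<^sub>3 \<ge> 0\<close> and from coercivity of \<open>a\<close> (or, for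
  \<open>\<epsilon>\<^sub>p = 1\<close>, from the cancellation of the consistency terms and positivity of the
  mobilities), that of the displacement form from coercivity of \<open>c\<close>.

  Since the integral of a nonintegrable function is 0, (bi)linearity is not automatic: it
  rests on integrability of all integrands, which is obtained by showing that every
  discrete quantity is essentially bounded.
\<close>

section \<open>Linear problems with definite forms\<close>

text \<open>The delicate terms are those that differentiate the truncated saturation:
  \<open>b_u\<close> contains the gradient of saturation times test function, \<open>b_p\<close> the
  gradient of \<open>p_tot\<close>. The saturation is only piecewise smooth, and where a derivative
  is missing \<open>grad\<close> is an unspecified value. Hence linearity and boundedness hold only
  almost everywhere, and measurability is recovered from completeness of Lebesgue measure. Faces are
  null sets, so such statements on an element say nothing about traces; faces are treated
  separately.

  Sign and coercivity assumptions speak only of states that the scheme reaches, so each level is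
  solved from a history that certifies the preceding one. The displacement substep precedes the
  certification of the new pressures, so \<open>b_p\<close> must be handled for arbitrary discrete
  pressures, even with vanishing or negative capillary pressure.

  The pointwise vector space structure on function types makes \<open>subspace\<close> and
  \<open>span\<close> applicable to the discrete spaces.\<close>

instantiation "fun" :: (type, real_vector) real_vector
begin

definition scaleR_fun where "c *\<^sub>R f = (\<lambda>x. c *\<^sub>R f x)"

instance
  by standard (simp_all add: scaleR_fun_def fun_eq_iff scaleR_add_left scaleR_add_right)

end

lemma scaleR_fun_apply [simp]: "(c *\<^sub>R f) x = c *\<^sub>R f x"
  by (simp add: scaleR_fun_def)

lemma sum_fun_apply [simp]: "(\<Sum>i\<in>I. f i) x = (\<Sum>i\<in>I. f i x)"
  by (induction I rule: infinite_finite_induct) simp_all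

text \<open>Linearity is relative to \<open>V\<close>: outside the discrete space an integrand may
  fail to be integrable, and its integral is then 0 whatever the formula.\<close>

definition linear_functional_on :: "'v::real_vector set \<Rightarrow> ('v \<Rightarrow> real) \<Rightarrow> bool" where
  "linear_functional_on V L \<longleftrightarrow>
     (\<forall>u\<in>V. \<forall>v\<in>V. L (u + v) = L u + L v) \<and> (\<forall>c. \<forall>u\<in>V. L (c *\<^sub>R u) = c * L u)"

lemma linear_functional_onD:
  assumes "linear_functional_on V L" "u \<in> V"
  shows "v \<in> V \<Longrightarrow> L (u + v) = L u + L v" "L (c *\<^sub>R u) = c * L u"
  using assms by (auto simp: linear_functional_on_def)

lemma linear_functional_on_diff:
  assumes "subspace V" "linear_functional_on V L" "u \<in> V" "v \<in> V"
  shows "L (u - v) = L u - L v"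
proof -
  have "L (u + (-1) *\<^sub>R v) = L u + L ((-1) *\<^sub>R v)"
    using assms by (intro linear_functional_onD(1)) (auto intro: subspace_scale subspace_neg)
  then show ?thesis
    using linear_functional_onD(2)[OF assms(2,4), of "-1"] by simp
qed

lemma linear_functional_on_add:
  "linear_functional_on V L \<Longrightarrow> linear_functional_on V L' \<Longrightarrow> linear_functional_on V (\<lambda>u. L u + L' u)"
  by (simp add: linear_functional_on_def algebra_simps)

lemma linear_functional_on_minus:
  "linear_functional_on V L \<Longrightarrow> linear_functional_on V L' \<Longrightarrow> linear_functional_on V (\<lambda>u. L u - L' u)"
  by (simp add: linear_functional_on_def algebra_simps)

lemma linear_functional_on_uminus:
  "linear_functional_on V L \<Longrightarrow> linear_functional_on V (\<lambda>u. - L u)"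
  by (simp add: linear_functional_on_def algebra_simps)

lemma linear_functional_on_cmult:
  "linear_functional_on V L \<Longrightarrow> linear_functional_on V (\<lambda>u. c * L u)"
  by (simp add: linear_functional_on_def algebra_simps)

lemma linear_functional_on_sum:
  "(\<And>i. i \<in> I \<Longrightarrow> linear_functional_on V (L i)) \<Longrightarrow> linear_functional_on V (\<lambda>u. \<Sum>i\<in>I. L i u)"
  by (simp add: linear_functional_on_def sum.distrib sum_distrib_left)

lemmas linear_functional_on_intros =
  linear_functional_on_add linear_functional_on_minus linear_functional_on_uminus
  linear_functional_on_cmult linear_functional_on_sum

text \<open>Gram-Schmidt for a form that need not be symmetric, by induction on the spanning set.
  From the new vector \<open>e\<close> one subtracts a \<open>w\<close> in the old span such that
  \<open>d = e - w\<close> is invisible to all old test vectors. Adding a multiple of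
  \<open>d\<close> to the old solution keeps the old equations and leaves one scalar equation.
  Dependent vectors are allowed; they give \<open>d = 0\<close>.\<close>

lemma linear_problem_solvable:
  fixes B :: "'v::real_vector \<Rightarrow> 'v \<Rightarrow> real"
  assumes V: "subspace V" and S: "finite S" "S \<subseteq> V"
    and left: "\<And>v. v \<in> V \<Longrightarrow> linear_functional_on V (\<lambda>u. B u v)"
    and right: "\<And>u. u \<in> V \<Longrightarrow> linear_functional_on V (B u)"
    and definite: "\<And>u. u \<in> V \<Longrightarrow> B u u = 0 \<Longrightarrow> u = 0"
    and L: "linear_functional_on V L"
  shows "\<exists>u\<in>span S. \<forall>v\<in>span S. B u v = L v"
  using S L
proof (induction S arbitrary: L rule: finite_induct)
  case empty
  have "B 0 0 = 0" "L 0 = 0"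
    using linear_functional_onD(2)[OF left, of 0 0 0] linear_functional_onD(2)[OF empty(2), of 0 0]
      subspace_0[OF V] by simp_all
  then show ?case by simp
next
  case (insert e S)
  have sub: "span S \<subseteq> V" and e: "e \<in> V"
    using insert V by (auto simp: span_minimal)
  \<comment> \<open>The induction hypothesis is applied to the functional \<open>B e\<close> in
    place of \<open>L\<close>.\<close>
  obtain w where w: "w \<in> span S" "\<And>v. v \<in> span S \<Longrightarrow> B w v = B e v"
    using insert.IH[OF _ right[OF e]] insert.prems by auto
  define d where "d = e - w"
  have dV: "d \<in> V"
    using w sub e V by (auto simp: d_def subspace_diff)
  have orth: "B d v = 0" if "v \<in> span S" for v
    using linear_functional_on_diff[OF V left e, of v w] w that sub by (auto simp: d_def)
  obtain u where u: "u \<in> span S" "\<And>v. v \<in> span S \<Longrightarrow> B u v = L v"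
    using insert by (meson insert_subset)
  \<comment> \<open>Solves \<open>B u d + t * B d d = L d\<close>. Definiteness makes
    \<open>B d d\<close> nonzero unless \<open>d = 0\<close>, in which case both sides of the
    equation tested with \<open>d\<close> vanish.\<close>
  define t where "t = (L d - B u d) / B d d"
  define u' where "u' = u + t *\<^sub>R d"
  have Bu': "B u' v = B u v + t * B d v" if "v \<in> V" for v
    unfolding u'_def using left[OF that] u(1) sub dV V
    by (subst linear_functional_onD(1)[of V "\<lambda>u. B u v"])
      (auto simp: subspace_scale linear_functional_onD(2)[of V "\<lambda>u. B u v"])
  have Bd: "B u' d = L d"
  proof (cases "d = 0")
    case True
    have "B u' 0 = 0" "L 0 = 0"
      using linear_functional_onD(2)[OF right, of u' 0 0] linear_functional_onD(2)[OF insert.prems(2), of 0 0]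
        subspace_0[OF V] u(1) sub dV V by (auto simp: u'_def subspace_add subspace_scale)
    with True show ?thesis by simp
  next
    case False
    then have "B d d \<noteq> 0" using definite dV by blast
    then show ?thesis by (simp add: Bu' dV t_def)
  qed
  \<comment> \<open>Since \<open>e = d + w\<close>, the multiple of \<open>w\<close> is absorbed
    into \<open>y\<close>.\<close>
  have span: "\<exists>k. \<exists>y\<in>span S. x = y + k *\<^sub>R d" if x: "x \<in> span (insert e S)" for x
  proof -
    from x obtain k where "x - k *\<^sub>R e \<in> span S" by (auto simp: span_breakdown_eq)
    then have "x - k *\<^sub>R e + k *\<^sub>R w \<in> span S"
      using w(1) by (intro span_add span_scale)
    then show ?thesis
      by (intro exI[of _ k] bexI[of _ "x - k *\<^sub>R e + k *\<^sub>R w"]) (simp_all add: d_def algebra_simps)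
  qed
  have u'V: "u' \<in> V"
    using u(1) sub dV V by (auto simp: u'_def subspace_add subspace_scale)
  have "B u' x = L x" if x: "x \<in> span (insert e S)" for x
  proof -
    obtain k y where y: "y \<in> span S" "x = y + k *\<^sub>R d" using span[OF x] by blast
    have yV: "y \<in> V" "k *\<^sub>R d \<in> V" using y(1) sub dV V by (auto simp: subspace_scale)
    have "B u' x = B u' y + k * B u' d"
      using linear_functional_onD[OF right[OF u'V]] yV dV y(2) by simp
    also have "\<dots> = L y + k * L d"
      using Bu'[OF yV(1)] orth[OF y(1)] u(2)[OF y(1)] Bd by simp
    also have "\<dots> = L x"
      using linear_functional_onD[OF insert.prems(2)] yV dV y(2) by simp
    finally show ?thesis .
  qed
  moreover have "u' \<in> span (insert e S)"
  proof -
    have "span S \<subseteq> span (insert e S)" by (rule span_mono) blast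
    then show ?thesis
      unfolding u'_def d_def using u(1) w(1)
      by (intro span_add span_scale span_diff) (auto simp: span_base)
  qed
  ultimately show ?case by blast
qed

text \<open>The family \<open>S\<close> may leave \<open>V\<close>; it serves to bound the size of a
  basis \<open>T\<close> chosen inside \<open>V\<close>, where the form is known to be definite.
  Uniqueness: the difference of two solutions, tested with itself, gives 0.\<close>

theorem linear_problem_ex1:
  fixes B :: "'v::real_vector \<Rightarrow> 'v \<Rightarrow> real"
  assumes V: "subspace V" and S: "finite S" "V \<subseteq> span S"
    and left: "\<And>v. v \<in> V \<Longrightarrow> linear_functional_on V (\<lambda>u. B u v)"
    and right: "\<And>u. u \<in> V \<Longrightarrow> linear_functional_on V (B u)"
    and definite: "\<And>u. u \<in> V \<Longrightarrow> B u u = 0 \<Longrightarrow> u = 0"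
    and L: "linear_functional_on V L"
  shows "\<exists>!u. u \<in> V \<and> (\<forall>v\<in>V. B u v = L v)"
proof -
  obtain T where T: "T \<subseteq> V" "independent T" "V \<subseteq> span T"
    by (rule basis_exists)
  have "finite T"
    using independent_span_bound[OF S(1) T(2)] T(1) S(2) by blast
  then have "\<exists>u\<in>span T. \<forall>v\<in>span T. B u v = L v"
    by (intro linear_problem_solvable[OF V] T(1) left right definite L)
  then obtain u where u: "u \<in> span T" "\<forall>v\<in>span T. B u v = L v"
    by blast
  show ?thesis
  proof (rule ex1I[of _ u])
    show "u \<in> V \<and> (\<forall>v\<in>V. B u v = L v)"
      using u T V span_minimal[OF T(1) V] by blast
    fix u' assume u': "u' \<in> V \<and> (\<forall>v\<in>V. B u' v = L v)"
    have uV: "u \<in> V" using u(1) span_minimal[OF T(1) V] by blast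
    have dV: "u' - u \<in> V" using u' uV V by (simp add: subspace_diff)
    have "B (u' - u) (u' - u) = B u' (u' - u) - B u (u' - u)"
      using linear_functional_on_diff[OF V left[OF dV]] u' uV by blast
    also have "\<dots> = 0"
      using u' u T(3) dV by auto
    finally show "u' = u" using definite[OF dV] by simp
  qed
qed

section \<open>Essentially bounded functions and linear families of functions\<close>

text \<open>Unlike square integrability, this notion is stable under products, as the products of
  coefficient, trial and test function require; on a space of finite measure it yields
  integrability.\<close>

definition ess_bounded :: "'a measure \<Rightarrow> ('a \<Rightarrow> 'b::euclidean_space) \<Rightarrow> bool" where
  "ess_bounded M f \<longleftrightarrow> f \<in> borel_measurable M \<and> (\<exists>c. AE x in M. norm (f x) \<le> c)"

lemma ess_boundedI:
  "f \<in> borel_measurable M \<Longrightarrow> (AE x in M. norm (f x) \<le> c) \<Longrightarrow> ess_bounded M f"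
  by (auto simp: ess_bounded_def)

lemma ess_bounded_measurable [measurable_dest]: "ess_bounded M f \<Longrightarrow> f \<in> borel_measurable M"
  by (simp add: ess_bounded_def)

lemma ess_bounded_const: "ess_bounded M (\<lambda>x. c)"
  by (rule ess_boundedI[of _ _ "norm c"]) auto

lemma ess_bounded_add:
  assumes "ess_bounded M f" "ess_bounded M g"
  shows "ess_bounded M (\<lambda>x. f x + g x)"
proof -
  obtain c d where "AE x in M. norm (f x) \<le> c" "AE x in M. norm (g x) \<le> d"
    using assms by (auto simp: ess_bounded_def)
  then have "AE x in M. norm (f x + g x) \<le> c + d"
    by eventually_elim (rule norm_add_rule_thm)
  with assms show ?thesis
    by (intro ess_boundedI) auto
qed

lemma ess_bounded_bounded_linear:
  assumes "bounded_linear h" "ess_bounded M f"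
  shows "ess_bounded M (\<lambda>x. h (f x))"
proof -
  obtain c where c: "AE x in M. norm (f x) \<le> c"
    using assms by (auto simp: ess_bounded_def)
  obtain K where K: "\<And>x. norm (h x) \<le> norm x * K" "0 \<le> K"
    using bounded_linear.nonneg_bounded[OF assms(1)] by blast
  from c have "AE x in M. norm (h (f x)) \<le> c * K"
    by eventually_elim (meson K mult_right_mono order_trans)
  with assms show ?thesis
    by (intro ess_boundedI)
      (auto intro: measurable_compose[OF _ borel_measurable_continuous_onI]
        linear_continuous_on simp: ess_bounded_measurable)
qed

lemma ess_bounded_bounded_bilinear:
  fixes h :: "'a::euclidean_space \<Rightarrow> 'b::euclidean_space \<Rightarrow> 'c::euclidean_space"
  assumes "bounded_bilinear h" "ess_bounded M f" "ess_bounded M g"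
  shows "ess_bounded M (\<lambda>x. h (f x) (g x))"
proof -
  obtain c d where cd: "AE x in M. norm (f x) \<le> c" "AE x in M. norm (g x) \<le> d"
    using assms by (auto simp: ess_bounded_def)
  obtain K where K: "\<And>x y. norm (h x y) \<le> norm x * norm y * K" "0 \<le> K"
    using bounded_bilinear.nonneg_bounded[OF assms(1)] by blast
  from cd have "AE x in M. norm (h (f x) (g x)) \<le> c * d * K"
  proof eventually_elim
    case (elim x)
    then have "norm (f x) * norm (g x) * K \<le> c * d * K"
      using K(2) by (intro mult_right_mono mult_mono) (auto intro: order_trans[OF norm_ge_zero])
    with K(1)[of "f x" "g x"] show ?case by simp
  qed
  moreover have "(\<lambda>x. h (f x) (g x)) \<in> borel_measurable M"
  proof -
    have "continuous_on UNIV (\<lambda>p. h (fst p) (snd p))"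
      by (intro bounded_bilinear.continuous_on[OF assms(1)] continuous_intros)
    from borel_measurable_continuous_Pair[OF _ _ this, of f M g] assms show ?thesis
      by (auto simp: ess_bounded_measurable)
  qed
  ultimately show ?thesis
    by (rule ess_boundedI[rotated])
qed

lemmas ess_bounded_scaleR = ess_bounded_bounded_bilinear[OF bounded_bilinear_scaleR]

lemma ess_bounded_mult:
  fixes f g :: "'a \<Rightarrow> real"
  assumes "ess_bounded M f" "ess_bounded M g"
  shows "ess_bounded M (\<lambda>x. f x * g x)"
  using ess_bounded_bounded_bilinear[OF bounded_bilinear_mult assms] .

lemma ess_bounded_diff:
  assumes "ess_bounded M f" "ess_bounded M g"
  shows "ess_bounded M (\<lambda>x. f x - g x)"
  using ess_bounded_add[OF assms(1)
      ess_bounded_bounded_linear[OF bounded_linear_minus[OF bounded_linear_ident] assms(2)]]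
  by simp

lemma ess_bounded_power:
  fixes f :: "'a \<Rightarrow> real"
  assumes "ess_bounded M f"
  shows "ess_bounded M (\<lambda>x. f x ^ n)"
  by (induction n) (simp_all add: ess_bounded_const ess_bounded_mult assms)

lemma ess_bounded_divide_const:
  fixes f :: "'a \<Rightarrow> real"
  assumes "ess_bounded M f"
  shows "ess_bounded M (\<lambda>x. f x / c)"
  using ess_bounded_mult[OF assms ess_bounded_const[of M "inverse c"]]
  by (simp add: divide_inverse)

lemma ess_bounded_vec:
  fixes f :: "'a \<Rightarrow> 'b::euclidean_space ^ 'n"
  assumes "\<And>i. ess_bounded M (\<lambda>x. f x $ i)"
  shows "ess_bounded M f"
proof -
  obtain c where c: "\<And>i. AE x in M. norm (f x $ i) \<le> c i"
    using assms unfolding ess_bounded_def by metis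
  have "AE x in M. \<forall>i\<in>UNIV. norm (f x $ i) \<le> c i"
    using c by (intro AE_finite_allI) auto
  then have "AE x in M. norm (f x) \<le> sum c UNIV"
  proof eventually_elim
    case (elim x)
    have "norm (f x) \<le> (\<Sum>i\<in>UNIV. norm (f x $ i))"
      by (simp add: norm_vec_def L2_set_le_sum)
    also have "\<dots> \<le> sum c UNIV"
      using elim by (intro sum_mono) simp
    finally show ?case .
  qed
  moreover have "f \<in> borel_measurable M"
  proof (subst borel_measurable_euclidean_space, intro ballI)
    fix b :: "'b ^ 'n" assume "b \<in> Basis"
    then obtain i k where b: "b = axis i k" by (auto simp: Basis_vec_def)
    have "(\<lambda>x. f x $ i \<bullet> k) \<in> borel_measurable M"
      using ess_bounded_measurable[OF assms, of i] by measurable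
    then show "(\<lambda>x. f x \<bullet> b) \<in> borel_measurable M"
      by (simp add: b inner_axis)
  qed
  ultimately show ?thesis
    by (rule ess_boundedI[rotated])
qed

lemma ess_bounded_integrable:
  "finite_measure M \<Longrightarrow> ess_bounded M f \<Longrightarrow> integrable M f"
  by (auto simp: ess_bounded_def intro: finite_measure.integrable_const_bound)

text \<open>The domination is \<open>2 * norm (f x) <= 1 + (norm (f x))^2\<close>, and constants are
  integrable for a finite measure.\<close>

lemma sq_integrable_integrable:
  assumes "finite_measure M" "sq_integrable M f"
  shows "integrable M f"
proof (rule Bochner_Integration.integrable_bound)
  interpret finite_measure M by fact
  show "integrable M (\<lambda>x. 1 + (norm (f x))\<^sup>2)"
    using assms(2) by (auto simp: sq_integrable_def)
  show "f \<in> borel_measurable M"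
    using assms(2) by (simp add: sq_integrable_def)
  have "norm (f x) \<le> norm (1 + (norm (f x))\<^sup>2)" for x
  proof -
    have "0 \<le> (norm (f x) - 1)\<^sup>2" "0 \<le> norm (f x)" by simp_all
    then show ?thesis unfolding power2_diff by (simp, linarith)
  qed
  then show "AE x in M. norm (f x) \<le> norm (1 + (norm (f x))\<^sup>2)"
    by simp
qed

text \<open>Pairing of an integrable with an essentially bounded function: the data of the problem
  are the first factor, discrete functions the second.\<close>

lemma integrable_inner_ess_bounded:
  assumes "integrable M f" "ess_bounded M g"
  shows "integrable M (\<lambda>x. f x \<bullet> g x)"
proof -
  obtain c where "AE x in M. norm (g x) \<le> c"
    using assms by (auto simp: ess_bounded_def)
  then have "AE x in M. norm (f x \<bullet> g x) \<le> norm (c *\<^sub>R f x)"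
  proof eventually_elim
    case (elim x)
    have "norm (f x \<bullet> g x) \<le> norm (f x) * norm (g x)"
      by (simp add: Cauchy_Schwarz_ineq2)
    also have "\<dots> \<le> norm (f x) * \<bar>c\<bar>"
      using elim by (intro mult_left_mono) auto
    finally show ?case by (simp add: mult.commute)
  qed
  moreover have "(\<lambda>x. f x \<bullet> g x) \<in> borel_measurable M"
    by (rule borel_measurable_inner[OF borel_measurable_integrable[OF assms(1)]
          ess_bounded_measurable[OF assms(2)]])
  ultimately show ?thesis
    using Bochner_Integration.integrable_bound[OF integrable_scaleR_right[OF assms(1), of c]] by blast
qed

text \<open>\<open>T\<close> maps a discrete function to what is integrated: its trace, gradient,
  jump and so on. Additivity and homogeneity are asked only almost everywhere because the gradient
  of a product with the saturation obeys the product rule only away from the kinks.\<close>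

definition linear_family ::
  "'v::real_vector set \<Rightarrow> 'a measure \<Rightarrow> ('v \<Rightarrow> 'a \<Rightarrow> 'b::euclidean_space) \<Rightarrow> bool" where
  "linear_family V M T \<longleftrightarrow>
     (\<forall>u\<in>V. ess_bounded M (T u)) \<and>
     (\<forall>u\<in>V. \<forall>v\<in>V. AE x in M. T (u + v) x = T u x + T v x) \<and>
     (\<forall>c. \<forall>u\<in>V. AE x in M. T (c *\<^sub>R u) x = c *\<^sub>R T u x)"

lemma linear_familyI:
  assumes "\<And>u. u \<in> V \<Longrightarrow> ess_bounded M (T u)"
    and "\<And>u v x. u \<in> V \<Longrightarrow> v \<in> V \<Longrightarrow> T (u + v) x = T u x + T v x"
    and "\<And>c u x. u \<in> V \<Longrightarrow> T (c *\<^sub>R u) x = c *\<^sub>R T u x"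
  shows "linear_family V M T"
  using assms by (simp add: linear_family_def)

lemma linear_familyD:
  assumes "linear_family V M T" "u \<in> V"
  shows "ess_bounded M (T u)"
    and "v \<in> V \<Longrightarrow> AE x in M. T (u + v) x = T u x + T v x"
    and "AE x in M. T (c *\<^sub>R u) x = c *\<^sub>R T u x"
  using assms by (simp_all add: linear_family_def)

lemma linear_family_bounded_linear:
  assumes h: "bounded_linear h" and T: "linear_family V M T"
  shows "linear_family V M (\<lambda>u x. h (T u x))"
  unfolding linear_family_def
proof (intro conjI ballI allI)
  interpret h: bounded_linear h by fact
  fix u assume u: "u \<in> V"
  show "ess_bounded M (\<lambda>x. h (T u x))"
    by (rule ess_bounded_bounded_linear[OF h linear_familyD(1)[OF T u]])
  show "AE x in M. h (T (c *\<^sub>R u) x) = c *\<^sub>R h (T u x)" for c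
    using linear_familyD(3)[OF T u, of c] by eventually_elim (simp add: h.scaleR)
  show "AE x in M. h (T (u + v) x) = h (T u x) + h (T v x)" if "v \<in> V" for v
    using linear_familyD(2)[OF T u that] by eventually_elim (simp add: h.add)
qed

lemma linear_family_scaleR:
  assumes k: "ess_bounded M k" and T: "linear_family V M T"
  shows "linear_family V M (\<lambda>u x. k x *\<^sub>R T u x)"
  unfolding linear_family_def
proof (intro conjI ballI allI)
  fix u assume u: "u \<in> V"
  show "ess_bounded M (\<lambda>x. k x *\<^sub>R T u x)"
    by (rule ess_bounded_scaleR[OF k linear_familyD(1)[OF T u]])
  show "AE x in M. k x *\<^sub>R T (c *\<^sub>R u) x = c *\<^sub>R k x *\<^sub>R T u x" for c
    using linear_familyD(3)[OF T u, of c] by eventually_elim simp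
  show "AE x in M. k x *\<^sub>R T (u + v) x = k x *\<^sub>R T u x + k x *\<^sub>R T v x" if "v \<in> V" for v
    using linear_familyD(2)[OF T u that] by eventually_elim (simp add: scaleR_add_right)
qed

lemma linear_family_mult:
  fixes T :: "'v::real_vector \<Rightarrow> 'a \<Rightarrow> real"
  assumes "ess_bounded M k" "linear_family V M T"
  shows "linear_family V M (\<lambda>u x. k x * T u x)"
  using linear_family_scaleR[OF assms] by simp

lemma linear_family_add:
  assumes T: "linear_family V M T" and T': "linear_family V M T'"
  shows "linear_family V M (\<lambda>u x. T u x + T' u x)"
  unfolding linear_family_def
proof (intro conjI ballI allI)
  fix u assume u: "u \<in> V"
  show "ess_bounded M (\<lambda>x. T u x + T' u x)"
    by (rule ess_bounded_add[OF linear_familyD(1)[OF T u] linear_familyD(1)[OF T' u]])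
  show "AE x in M. T (c *\<^sub>R u) x + T' (c *\<^sub>R u) x = c *\<^sub>R (T u x + T' u x)" for c
    using linear_familyD(3)[OF T u, of c] linear_familyD(3)[OF T' u, of c]
    by eventually_elim (simp add: scaleR_add_right)
  show "AE x in M. T (u + v) x + T' (u + v) x = T u x + T' u x + (T v x + T' v x)" if "v \<in> V" for v
    using linear_familyD(2)[OF T u that] linear_familyD(2)[OF T' u that]
    by eventually_elim simp
qed

lemma linear_family_diff:
  assumes "linear_family V M T" "linear_family V M T'"
  shows "linear_family V M (\<lambda>u x. T u x - T' u x)"
  using linear_family_add[OF assms(1)
      linear_family_bounded_linear[OF bounded_linear_minus[OF bounded_linear_ident] assms(2)]]
  by simp

text \<open>All linearity of integrals is drawn from here: one factor is fixed and integrable, the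
  other depends linearly on the vector and is essentially bounded. The identities almost everywhere
  pass through \<open>integral_cong_AE\<close>, which asks for measurability of both sides.\<close>

lemma linear_functional_on_integral_inner:
  assumes V: "subspace V" and f: "integrable M f" and T: "linear_family V M T"
  shows "linear_functional_on V (\<lambda>u. \<integral>x. f x \<bullet> T u x \<partial>M)"
  unfolding linear_functional_on_def
proof (intro conjI ballI allI)
  have int: "integrable M (\<lambda>x. f x \<bullet> T u x)" if "u \<in> V" for u
    by (rule integrable_inner_ess_bounded[OF f linear_familyD(1)[OF T that]])
  fix u assume u: "u \<in> V"
  show "(\<integral>x. f x \<bullet> T (u + v) x \<partial>M) = (\<integral>x. f x \<bullet> T u x \<partial>M) + (\<integral>x. f x \<bullet> T v x \<partial>M)" if v: "v \<in> V" for v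
  proof -
    have "(\<integral>x. f x \<bullet> T (u + v) x \<partial>M) = (\<integral>x. f x \<bullet> T u x + f x \<bullet> T v x \<partial>M)"
    proof (rule integral_cong_AE)
      show "AE x in M. f x \<bullet> T (u + v) x = f x \<bullet> T u x + f x \<bullet> T v x"
        using linear_familyD(2)[OF T u v] by eventually_elim (simp add: inner_add_right)
    qed (use int u v V in \<open>auto intro!: borel_measurable_integrable subspace_add\<close>)
    with int u v show ?thesis by simp
  qed
  show "(\<integral>x. f x \<bullet> T (c *\<^sub>R u) x \<partial>M) = c * (\<integral>x. f x \<bullet> T u x \<partial>M)" for c
  proof -
    have "(\<integral>x. f x \<bullet> T (c *\<^sub>R u) x \<partial>M) = (\<integral>x. c * (f x \<bullet> T u x) \<partial>M)"
    proof (rule integral_cong_AE)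
      show "AE x in M. f x \<bullet> T (c *\<^sub>R u) x = c * (f x \<bullet> T u x)"
        using linear_familyD(3)[OF T u, of c] by eventually_elim simp
    qed (use int u V in \<open>auto intro!: borel_measurable_integrable subspace_scale\<close>)
    then show ?thesis by simp
  qed
qed

text \<open>In a complete space a set that differs from a measurable one by a null set is
  measurable. This gives measurability of gradients that are known by a formula only off the
  kinks.\<close>

lemma (in complete_measure) borel_measurable_AE_cong:
  assumes f: "f \<in> borel_measurable M" and ae: "AE x in M. f x = g x"
  shows "g \<in> borel_measurable M"
proof (rule measurableI)
  fix A :: "'b set" assume A: "A \<in> sets borel"
  have "AE x in M. x \<in> f -` A \<inter> space M \<longleftrightarrow> x \<in> g -` A \<inter> space M"
    using ae by eventually_elim auto
  then show "g -` A \<inter> space M \<in> sets M"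
    by (rule in_sets_AE) (use f A in \<open>auto simp: measurable_sets\<close>)
qed auto

lemma (in complete_measure) ess_bounded_AE_cong:
  assumes "ess_bounded M f" "AE x in M. f x = g x"
  shows "ess_bounded M g"
proof -
  obtain c where "AE x in M. norm (f x) \<le> c"
    using assms by (auto simp: ess_bounded_def)
  with assms(2) have "AE x in M. norm (g x) \<le> c"
    by eventually_elim simp
  with borel_measurable_AE_cong[OF ess_bounded_measurable[OF assms(1)] assms(2)] show ?thesis
    by (rule ess_boundedI)
qed

lemma complete_measure_lebesgue_on:
  assumes "S \<in> sets lebesgue"
  shows "complete_measure (lebesgue_on S)"
proof
  fix A B :: "'a set" assume "B \<subseteq> A" "A \<in> null_sets (lebesgue_on S)"
  with assms have "B \<subseteq> S" "B \<in> null_sets lebesgue"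
    by (auto simp: null_sets_restrict_space intro: completion.complete2)
  with assms show "B \<in> sets (lebesgue_on S)"
    by (simp add: sets_restrict_space_iff null_setsD2)
qed

lemma AE_lebesgue_on_negligible:
  assumes "S \<in> sets lebesgue" "negligible N" "\<And>x. x \<in> S \<Longrightarrow> x \<notin> N \<Longrightarrow> P x"
  shows "AE x in lebesgue_on S. P x"
proof -
  have "AE x in lebesgue. x \<notin> N"
    using assms(2) by (simp add: negligible_iff_null_sets AE_not_in)
  then have "AE x in lebesgue. x \<in> S \<longrightarrow> P x"
    by eventually_elim (use assms(3) in blast)
  then show ?thesis
    using assms(1) by (simp add: AE_restrict_space_iff)
qed

text \<open>\<open>r\<close> is the inclusion of an element or the chart of a face, so one lemma
  serves both kinds of integral. \<open>f\<close> is taken Borel on \<open>E\<close>: a Lebesgue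
  measurable function can be altered arbitrarily on a face, a null set of space, so its trace need
  not be measurable.\<close>

lemma ess_bounded_compose_borel:
  assumes r: "r \<in> M \<rightarrow>\<^sub>M restrict_space borel E" and f: "f \<in> borel_measurable (restrict_space borel E)"
    and b: "bounded (f ` E)"
  shows "ess_bounded M (\<lambda>z. f (r z))"
proof -
  obtain c where c: "\<And>x. x \<in> E \<Longrightarrow> norm (f x) \<le> c"
    using b by (auto simp: bounded_iff)
  have "r z \<in> E" if "z \<in> space M" for z
    using measurable_space[OF r that] by (simp add: space_restrict_space)
  with c have "AE z in M. norm (f (r z)) \<le> c"
    by auto
  moreover have "(\<lambda>z. f (r z)) \<in> borel_measurable M"
    using r f by (rule measurable_compose)
  ultimately show ?thesis
    by (rule ess_boundedI[rotated])
qed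

lemma ess_bounded_compose_continuous:
  assumes "r \<in> M \<rightarrow>\<^sub>M restrict_space borel E" "compact E" "continuous_on E f"
  shows "ess_bounded M (\<lambda>z. f (r z))"
  by (rule ess_bounded_compose_borel[OF assms(1) borel_measurable_continuous_on_restrict[OF assms(3)]])
    (use assms in \<open>auto intro: compact_imp_bounded compact_continuous_image\<close>)

lemma measurable_id_lebesgue_on: "(\<lambda>x. x) \<in> lebesgue_on E \<rightarrow>\<^sub>M restrict_space borel E"
  by (rule measurable_restrict_space3) (auto intro: measurable_completion)

lemma finite_measure_lebesgue_on_compact: "compact E \<Longrightarrow> finite_measure (lebesgue_on E)"
  by (simp add: finite_measure_lebesgue_on lmeasurable_compact)

section \<open>Isometric charts and the measure of faces\<close>

lemma plane_chart:
  assumes "aff_dim e = 2"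
  shows "dist (plane_chart e z) (plane_chart e z') = dist z z'"
    and "range (plane_chart e) = affine hull e"
proof -
  have "(\<forall>z z'. dist (plane_chart e z) (plane_chart e z') = dist z z') \<and> range (plane_chart e) = affine hull e"
    unfolding plane_chart_def by (rule someI_ex[OF plane_chart_exists[OF assms]])
  then show "dist (plane_chart e z) (plane_chart e z') = dist z z'"
    and "range (plane_chart e) = affine hull e" by auto
qed

lemma continuous_plane_chart:
  assumes "aff_dim e = 2"
  shows "continuous_on UNIV (plane_chart e)"
  unfolding continuous_on_iff plane_chart(1)[OF assms] by auto

text \<open>Closedness comes from continuity; boundedness holds because an isometry preserves the
  distance to a fixed center, here the image of 0.\<close>

lemma compact_vimage_plane_chart:
  assumes "aff_dim e = 2" "compact e"
  shows "compact (plane_chart e -` e)"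
proof -
  have "closed (plane_chart e -` e)"
    using assms by (intro closed_vimage continuous_plane_chart compact_imp_closed)
  moreover have "bounded (plane_chart e -` e)"
  proof -
    obtain b where "\<And>x. x \<in> e \<Longrightarrow> dist (plane_chart e 0) x \<le> b"
      using compact_imp_bounded[OF assms(2)] bounded_any_center by metis
    then have "dist 0 z \<le> b" if "z \<in> plane_chart e -` e" for z
      using that plane_chart(1)[OF assms(1), of 0 z] by force
    then show ?thesis
      unfolding bounded_def by blast
  qed
  ultimately show ?thesis
    by (simp add: compact_eq_bounded_closed)
qed

lemma finite_measure_face_space:
  "aff_dim e = 2 \<Longrightarrow> compact e \<Longrightarrow> finite_measure (face_space e)"
  unfolding face_space_def by (intro finite_measure_lebesgue_on_compact compact_vimage_plane_chart)

lemma measurable_plane_chart: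
  assumes "aff_dim e = 2" "e \<subseteq> E"
  shows "plane_chart e \<in> face_space e \<rightarrow>\<^sub>M restrict_space borel E"
  unfolding face_space_def
  by (rule measurable_restrict_space3)
    (use assms in \<open>auto intro!: measurable_completion borel_measurable_continuous_onI continuous_plane_chart\<close>)

section \<open>The mesh and the discrete spaces\<close>

text \<open>A 3-simplex has full affine dimension in space, so its interior is its relative
  interior, which is nonempty by convexity.\<close>

lemma simplex3_interior_nonempty:
  fixes E :: "point set"
  assumes "3 simplex E"
  shows "interior E \<noteq> {}"
proof -
  have "aff_dim E = int DIM(point)" "E \<noteq> {}"
    using aff_dim_simplex[OF assms] by auto
  then show ?thesis
    using convex_simplex[OF assms] by (simp add: interior_rel_interior_gen rel_interior_eq_empty)
qed

text \<open>What is prescribed on the open set \<open>Om D\<close> holds on a closed element up to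
  its frontier, which is negligible by convexity.\<close>

lemma valid_mesh_elem:
  assumes "valid_mesh D" "E \<in> mesh D"
  shows "compact E" "convex E" "E \<in> sets lebesgue" "\<not> negligible E"
    and "finite_measure (lebesgue_on E)" "complete_measure (lebesgue_on E)"
    and "interior E \<subseteq> Om D" "negligible (E - Om D)"
proof -
  have E: "3 simplex E" and Om: "Om D = interior (\<Union> (mesh D))"
    using assms by (auto simp: valid_mesh_def)
  show c: "compact E" and cv: "convex E"
    using E by (auto intro: compact_simplex convex_simplex)
  show s: "E \<in> sets lebesgue"
    using c by (simp add: borel_closed compact_imp_closed)
  show "\<not> negligible E"
    using simplex3_interior_nonempty[OF E] interior_subset negligible_subset open_not_negligible
    by (metis open_interior)
  show "finite_measure (lebesgue_on E)" "complete_measure (lebesgue_on E)"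
    using c s by (auto intro: finite_measure_lebesgue_on_compact complete_measure_lebesgue_on)
  show i: "interior E \<subseteq> Om D"
    unfolding Om using assms(2) by (intro interior_mono) auto
  have "negligible (frontier E)"
    by (rule negligible_convex_frontier[OF cv])
  moreover have "E - Om D \<subseteq> frontier E"
    using i compact_imp_closed[OF c] by (auto simp: frontier_def)
  ultimately show "negligible (E - Om D)"
    by (rule negligible_subset)
qed

lemma finite_mesh: "valid_mesh D \<Longrightarrow> finite (mesh D)"
  by (simp add: valid_mesh_def)

lemma open_Om: "valid_mesh D \<Longrightarrow> open (Om D)"
  by (simp add: valid_mesh_def)

lemma AE_elem_in_Om: "valid_mesh D \<Longrightarrow> E \<in> mesh D \<Longrightarrow> AE x in lebesgue_on E. x \<in> Om D"
  using valid_mesh_elem(3,8)[of D E] by (intro AE_lebesgue_on_negligible[of _ "E - Om D"]) auto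

text \<open>Elements have positive measure, so a property valid almost everywhere has a witness. For
  quantities that are constant on an element this turns integral identities into pointwise
  ones.\<close>

lemma AE_elem_ex:
  assumes "valid_mesh D" "E \<in> mesh D" "AE x in lebesgue_on E. P x"
  shows "\<exists>x\<in>E. P x"
proof (rule ccontr)
  assume "\<not> (\<exists>x\<in>E. P x)"
  then have "AE x in lebesgue. x \<notin> E"
    using assms(3) valid_mesh_elem(3)[OF assms(1,2)] by (auto simp: AE_restrict_space_iff)
  then have "negligible E"
    by (simp add: negligible_iff_null_sets completion.null_sets_iff_AE)
  then show False
    using valid_mesh_elem(4)[OF assms(1,2)] by blast
qed

text \<open>\<open>Om D\<close> is covered by finitely many compact elements, hence bounded, so
  square integrable data are integrable on it; the part of \<open>E\<close> outside
  \<open>Om D\<close> is negligible.\<close>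

lemma integrable_elem_data:
  assumes "valid_mesh D" "E \<in> mesh D" "L2_vol (Om D) f"
  shows "integrable (lebesgue_on E) f"
proof -
  have Om: "Om D \<in> lmeasurable"
  proof -
    have "bounded (\<Union> (mesh D))"
      using finite_mesh[OF assms(1)] valid_mesh_elem(1)[OF assms(1)]
      by (intro bounded_Union) (auto intro: compact_imp_bounded)
    then have "bounded (Om D)"
      using assms(1) interior_subset by (auto simp: valid_mesh_def intro: bounded_subset)
    with open_Om[OF assms(1)] show ?thesis
      by (simp add: lmeasurable_open)
  qed
  then have "integrable (lebesgue_on (Om D)) f"
    using assms(3) by (intro sq_integrable_integrable finite_measure_lebesgue_on)
  then have "f absolutely_integrable_on Om D"
    using Om by (simp add: set_integrable_def integrable_restrict_space fmeasurableD)
  then have "f absolutely_integrable_on (Om D \<inter> E)"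
    by (rule set_integrable_subset)
      (use Om valid_mesh_elem(3)[OF assms(1,2)] in \<open>simp_all add: fmeasurableD sets.Int\<close>)
  moreover have "negligible (E - Om D \<inter> E)"
    using valid_mesh_elem(8)[OF assms(1,2)] by (rule negligible_subset) auto
  ultimately have "f absolutely_integrable_on E"
    by (subst (asm) absolutely_integrable_spike_set_eq[where T = E])
      (auto intro: negligible_subset)
  then show ?thesis
    using valid_mesh_elem(3)[OF assms(1,2)] by (simp add: set_integrable_def integrable_restrict_space)
qed

text \<open>Extended by 0 outside \<open>Om D\<close>, the function is measurable on
  \<open>E\<close>; completeness carries this over to \<open>f\<close>, which agrees with the
  extension almost everywhere on \<open>E\<close>.\<close>

lemma ess_bounded_elem_data:
  fixes f :: "point \<Rightarrow> real"
  assumes D: "valid_mesh D" "E \<in> mesh D"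
    and f: "f \<in> borel_measurable (lebesgue_on (Om D))" "\<And>x. x \<in> Om D \<Longrightarrow> \<bar>f x\<bar> \<le> c"
  shows "ess_bounded (lebesgue_on E) f"
proof -
  interpret complete_measure "lebesgue_on E" by (rule valid_mesh_elem(6)[OF D])
  have "Om D \<in> sets lebesgue"
    using open_Om[OF D(1)] by simp
  then have "(\<lambda>x. if x \<in> Om D then f x else 0) \<in> borel_measurable (lebesgue_on E)"
    using f(1) by (intro measurable_restrict_space1) (simp add: borel_measurable_if)
  moreover have "AE x in lebesgue_on E. (if x \<in> Om D then f x else 0) = f x"
    using AE_elem_in_Om[OF D] by eventually_elim simp
  ultimately have "f \<in> borel_measurable (lebesgue_on E)"
    by (rule borel_measurable_AE_cong)
  moreover have "AE x in lebesgue_on E. norm (f x) \<le> c"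
    using AE_elem_in_Om[OF D] by eventually_elim (simp add: f(2))
  ultimately show ?thesis
    by (rule ess_boundedI)
qed

text \<open>An interior face is the intersection of the frontiers of its two sides, which are
  closed. A boundary face is a facet of a 3-simplex, hence compact and of dimension 2.\<close>

lemma face_geometry:
  assumes "valid_mesh D" "e \<in> int_faces D \<union> bd_faces D"
  shows "aff_dim e = 2" "compact e" "finite_measure (face_space e)"
    and "side1 D e \<in> mesh D" "e \<subseteq> side1 D e"
    and "e \<in> int_faces D \<Longrightarrow> side2 D e \<in> mesh D" "e \<in> int_faces D \<Longrightarrow> e \<subseteq> side2 D e"
proof -
  have fr: "compact (frontier E)" "frontier E \<subseteq> E" if "E \<in> mesh D" for E
    using valid_mesh_elem(1)[OF assms(1) that]
    by (auto simp: compact_frontier frontier_subset_closed compact_imp_closed)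
  have int: "aff_dim e = 2 \<and> compact e \<and> side1 D e \<in> mesh D \<and> e \<subseteq> side1 D e \<and>
      side2 D e \<in> mesh D \<and> e \<subseteq> side2 D e" if e: "e \<in> int_faces D"
  proof -
    obtain E E' where E: "E \<in> mesh D" "E' \<in> mesh D" "e = frontier E \<inter> frontier E'" "aff_dim e = 2"
      using e unfolding int_faces_def by blast
    have s: "side1 D e \<in> mesh D" "side2 D e \<in> mesh D"
        "e = frontier (side1 D e) \<inter> frontier (side2 D e)"
      using assms(1) e by (auto simp: valid_mesh_def)
    have "e \<subseteq> side1 D e" "e \<subseteq> side2 D e"
      using s fr(2)[OF s(1)] fr(2)[OF s(2)] by blast+
    moreover have "compact e"
      unfolding E(3) using E fr by (intro compact_Int) auto
    ultimately show ?thesis using s E by blast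
  qed
  have bd: "aff_dim e = 2 \<and> compact e \<and> side1 D e \<in> mesh D \<and> e \<subseteq> side1 D e" if "e \<in> bd_faces D"
  proof -
    have s: "side1 D e \<in> mesh D" "e facet_of side1 D e"
      using assms(1) that by (auto simp: valid_mesh_def)
    have "3 simplex side1 D e"
      using assms(1) s(1) by (simp add: valid_mesh_def)
    then have "aff_dim e = 2"
      using s(2) by (auto simp: facet_of_def dest: aff_dim_simplex)
    moreover have "compact e"
      using s valid_mesh_elem(1,2)[OF assms(1) s(1)]
      by (meson face_of_imp_compact facet_of_imp_face_of)
    ultimately show ?thesis
      using s facet_of_imp_subset by blast
  qed
  show g: "aff_dim e = 2" "compact e" "side1 D e \<in> mesh D" "e \<subseteq> side1 D e"
    using assms(2) int bd by blast+
  show "e \<in> int_faces D \<Longrightarrow> side2 D e \<in> mesh D" "e \<in> int_faces D \<Longrightarrow> e \<subseteq> side2 D e"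
    using int by blast+
  show "finite_measure (face_space e)"
    using g by (simp add: finite_measure_face_space)
qed

section \<open>Jumps and averages across faces\<close>

lemma linear_family_jump:
  assumes "valid_mesh D" "e \<in> int_faces D \<union> bd_faces D"
    and T: "\<And>E. E \<in> mesh D \<Longrightarrow> e \<subseteq> E \<Longrightarrow> linear_family V M (\<lambda>v z. T v E (r z))"
  shows "linear_family V M (\<lambda>v z. jump D e (T v) (r z))"
proof -
  note geo = face_geometry[OF assms(1,2)]
  show ?thesis
    unfolding jump_def using T geo(4-7) by (cases "e \<in> int_faces D") (auto intro: linear_family_diff)
qed

lemma linear_family_avg:
  assumes "valid_mesh D" "e \<in> int_faces D \<union> bd_faces D"
    and T: "\<And>E. E \<in> mesh D \<Longrightarrow> e \<subseteq> E \<Longrightarrow> linear_family V M (\<lambda>v z. T v E (r z))"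
  shows "linear_family V M (\<lambda>v z. avg D e (T v) (r z))"
proof -
  note geo = face_geometry[OF assms(1,2)]
  show ?thesis
    unfolding avg_def using T geo(4-7)
    by (cases "e \<in> int_faces D")
      (auto intro!: linear_family_scaleR ess_bounded_const linear_family_add simp del: scaleR_half_double)
qed

lemma ess_bounded_jump:
  assumes "valid_mesh D" "e \<in> int_faces D \<union> bd_faces D"
    and f: "\<And>E. E \<in> mesh D \<Longrightarrow> e \<subseteq> E \<Longrightarrow> ess_bounded M (\<lambda>z. f E (r z))"
  shows "ess_bounded M (\<lambda>z. jump D e f (r z))"
proof -
  note geo = face_geometry[OF assms(1,2)]
  show ?thesis
    unfolding jump_def using f geo(4-7) by (cases "e \<in> int_faces D") (auto intro: ess_bounded_diff)
qed

lemma ess_bounded_avg: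
  assumes "valid_mesh D" "e \<in> int_faces D \<union> bd_faces D"
    and f: "\<And>E. E \<in> mesh D \<Longrightarrow> e \<subseteq> E \<Longrightarrow> ess_bounded M (\<lambda>z. f E (r z))"
  shows "ess_bounded M (\<lambda>z. avg D e f (r z))"
proof -
  note geo = face_geometry[OF assms(1,2)]
  show ?thesis
    unfolding avg_def using f geo(4-7)
    by (cases "e \<in> int_faces D") (auto intro!: ess_bounded_scaleR ess_bounded_const ess_bounded_add)
qed

text \<open>Uniqueness of the derivative makes the definite description in \<open>grad\<close>
  denote.\<close>

lemma GDERIV_imp_grad:
  assumes "GDERIV f x :> g"
  shows "grad f x = g"
  unfolding grad_def
proof (rule the_equality[where P = "\<lambda>g. GDERIV f x :> g", OF assms])
  fix g' assume "GDERIV f x :> g'"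
  then have "(\<lambda>h. h \<bullet> g') = (\<lambda>h. h \<bullet> g)"
    using assms has_derivative_unique unfolding gderiv_def by blast
  then show "g' = g"
    by (metis vector_eq_ldot)
qed

lemma GDERIV_affine: "GDERIV (\<lambda>x. a + b \<bullet> x) x :> b"
  unfolding gderiv_def by (auto intro!: derivative_eq_intros simp: inner_commute)

lemma grad_affine [simp]: "grad (\<lambda>x. a + b \<bullet> x) x = b"
  by (rule GDERIV_imp_grad[OF GDERIV_affine])

section \<open>The discrete spaces as finite-dimensional vector spaces\<close>

lemma Q_h_affine:
  assumes "q \<in> Q_h D" "E \<in> mesh D"
  obtains a b where "q E = (\<lambda>x. a + b \<bullet> x)"
  using assms by (auto simp: Q_h_def)

lemma V_hD: "v \<in> V_h D \<Longrightarrow> (\<lambda>E x. v E x $ i) \<in> Q_h D"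
  by (simp add: V_h_def)

lemma V_h_affine:
  assumes v: "v \<in> V_h D" and E: "E \<in> mesh D"
  obtains a b where "\<forall>i. (\<lambda>x. v E x $ i) = (\<lambda>x. a i + b i \<bullet> x)"
proof -
  have "\<forall>i. \<exists>p. (\<lambda>x. v E x $ i) = (\<lambda>x. fst p + snd p \<bullet> x)"
  proof
    fix i
    obtain a b where "(\<lambda>x. v E x $ i) = (\<lambda>x. a + b \<bullet> x)"
      by (rule Q_h_affine[OF V_hD[OF v] E])
    then show "\<exists>p. (\<lambda>x. v E x $ i) = (\<lambda>x. fst p + snd p \<bullet> x)"
      by (intro exI[of _ "(a, b)"]) simp
  qed
  from choice[OF this] obtain p where "\<forall>i. (\<lambda>x. v E x $ i) = (\<lambda>x. fst (p i) + snd (p i) \<bullet> x)" ..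
  then show ?thesis by (rule that)
qed

lemma subspace_Q_h: "subspace (Q_h D)"
proof (rule subspaceI)
  show "0 \<in> Q_h D"
    by (auto simp: Q_h_def zero_fun_def intro!: exI[of _ 0])
  show "u + v \<in> Q_h D" if u: "u \<in> Q_h D" and v: "v \<in> Q_h D" for u v
    unfolding Q_h_def
  proof (intro CollectI conjI ballI allI impI)
    fix E assume "E \<in> mesh D"
    then obtain a b a' b' where "u E = (\<lambda>x. a + b \<bullet> x)" "v E = (\<lambda>x. a' + b' \<bullet> x)"
      using u v by (metis Q_h_affine)
    then have "(u + v) E = (\<lambda>x. (a + a') + (b + b') \<bullet> x)"
      by (auto simp: inner_add_left)
    then show "\<exists>a b. (u + v) E = (\<lambda>x. a + b \<bullet> x)" by blast
  qed (use u v in \<open>auto simp: Q_h_def\<close>)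
  show "c *\<^sub>R u \<in> Q_h D" if u: "u \<in> Q_h D" for c u
    unfolding Q_h_def
  proof (intro CollectI conjI ballI allI impI)
    fix E assume "E \<in> mesh D"
    then obtain a b where "u E = (\<lambda>x. a + b \<bullet> x)"
      using u by (metis Q_h_affine)
    then have "(c *\<^sub>R u) E = (\<lambda>x. (c * a) + (c *\<^sub>R b) \<bullet> x)"
      by (auto simp: algebra_simps)
    then show "\<exists>a b. (c *\<^sub>R u) E = (\<lambda>x. a + b \<bullet> x)" by blast
  qed (use u in \<open>auto simp: Q_h_def\<close>)
qed

lemma subspace_V_h: "subspace (V_h D)"
proof (rule subspaceI)
  show "0 \<in> V_h D"
    using subspace_0[OF subspace_Q_h] by (simp add: V_h_def zero_fun_def)
  show "u + v \<in> V_h D" if u: "u \<in> V_h D" and v: "v \<in> V_h D" for u v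
    using subspace_add[OF subspace_Q_h V_hD[OF u] V_hD[OF v]] by (simp add: V_h_def plus_fun_def)
  show "c *\<^sub>R u \<in> V_h D" if u: "u \<in> V_h D" for c u
    using subspace_scale[OF subspace_Q_h V_hD[OF u]] by (simp add: V_h_def scaleR_fun_def)
qed

lemma Q_h_finite_span:
  assumes "finite (mesh D)"
  obtains S where "finite S" "Q_h D \<subseteq> span S"
proof
  \<comment> \<open>Four local functions per element, extended by 0: \<open>None\<close> is the
    constant 1, \<open>Some i\<close> the \<open>i\<close>-th coordinate.\<close>
  define \<phi> :: "point set \<Rightarrow> 3 option \<Rightarrow> real broken" where
    "\<phi> E k = (\<lambda>E' x. if E' = E then (case k of None \<Rightarrow> 1 | Some i \<Rightarrow> x $ i) else 0)" for E k
  let ?S = "(\<lambda>(E, k). \<phi> E k) ` (mesh D \<times> UNIV)"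
  show "finite ?S" using assms by simp
  show "Q_h D \<subseteq> span ?S"
  proof
    fix q assume q: "q \<in> Q_h D"
    then obtain a b where ab: "\<And>E. E \<in> mesh D \<Longrightarrow> q E = (\<lambda>x. a E + b E \<bullet> x)"
      unfolding Q_h_def by (auto simp: Ball_def) metis
    have "q = (\<Sum>E\<in>mesh D. a E *\<^sub>R \<phi> E None + (\<Sum>i\<in>UNIV. (b E $ i) *\<^sub>R \<phi> E (Some i)))"
    proof (intro ext)
      fix E x
      have "(\<Sum>E'\<in>mesh D. a E' *\<^sub>R \<phi> E' None + (\<Sum>i\<in>UNIV. (b E' $ i) *\<^sub>R \<phi> E' (Some i))) E x
          = (\<Sum>E'\<in>mesh D. if E' = E then a E + b E \<bullet> x else 0)"
        unfolding sum_fun_apply by (rule sum.cong) (auto simp: \<phi>_def inner_vec_def)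
      also have "\<dots> = q E x"
        using assms ab q by (auto simp: Q_h_def)
      finally show "q E x = (\<Sum>E'\<in>mesh D. a E' *\<^sub>R \<phi> E' None + (\<Sum>i\<in>UNIV. (b E' $ i) *\<^sub>R \<phi> E' (Some i))) E x"
        by simp
    qed
    also have "\<dots> \<in> span ?S"
      by (intro span_sum span_add span_scale) (auto intro!: span_base)
    finally show "q \<in> span ?S" .
  qed
qed

text \<open>The embeddings along the three coordinate axes carry a finite family spanning
  \<open>Q_h D\<close> to one whose span contains \<open>V_h D\<close>.\<close>

lemma V_h_finite_span:
  assumes "finite (mesh D)"
  obtains S where "finite S" "V_h D \<subseteq> span S"
proof -
  obtain S where S: "finite S" "Q_h D \<subseteq> span S"
    using Q_h_finite_span[OF assms] .
  define \<iota> :: "3 \<Rightarrow> real broken \<Rightarrow> point broken" where "\<iota> i q = (\<lambda>E x. axis i (q E x))" for i q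
  have lin: "linear (\<iota> i)" for i
    by (rule linearI) (auto simp: \<iota>_def fun_eq_iff vec_eq_iff axis_def)
  have "v \<in> span (\<Union>i. \<iota> i ` S)" if v: "v \<in> V_h D" for v
  proof -
    have "v = (\<Sum>i\<in>UNIV. \<iota> i (\<lambda>E x. v E x $ i))"
      by (auto simp: fun_eq_iff vec_eq_iff \<iota>_def axis_def if_distrib sum.delta cong: if_cong)
    also have "\<dots> \<in> span (\<Union>i. \<iota> i ` S)"
    proof (rule span_sum)
      fix i :: 3
      have "\<iota> i (\<lambda>E x. v E x $ i) \<in> \<iota> i ` span S"
        using V_hD[OF v] S by blast
      also have "\<dots> = span (\<iota> i ` S)"
        by (rule linear_span_image[OF lin, symmetric])
      also have "\<dots> \<subseteq> span (\<Union>i. \<iota> i ` S)"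
        by (rule span_mono) blast
      finally show "\<iota> i (\<lambda>E x. v E x $ i) \<in> span (\<Union>i. \<iota> i ` S)" .
    qed
    finally show ?thesis .
  qed
  with that[of "\<Union>i. \<iota> i ` S"] S show ?thesis by auto
qed

lemma bgrad_affine: "q E = (\<lambda>x. a + b \<bullet> x) \<Longrightarrow> bgrad q E x = b"
  by (simp add: bgrad_def)

section \<open>Discrete functions and their derivatives as linear families, on elements and faces
  alike\<close>

context
  fixes D :: biot and E :: "point set" and M :: "'a measure" and r :: "'a \<Rightarrow> point"
  assumes mesh: "valid_mesh D" "E \<in> mesh D" and r: "r \<in> M \<rightarrow>\<^sub>M restrict_space borel E"
begin

lemma linear_family_Q_h: "linear_family (Q_h D) M (\<lambda>q z. q E (r z))"
proof (rule linear_familyI)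
  fix u assume "u \<in> Q_h D"
  then obtain a b where "u E = (\<lambda>x. a + b \<bullet> x)"
    using mesh(2) by (metis Q_h_affine)
  then show "ess_bounded M (\<lambda>z. u E (r z))"
    by (intro ess_bounded_compose_continuous[OF r valid_mesh_elem(1)[OF mesh]])
      (auto intro!: continuous_intros)
qed simp_all

lemma linear_family_bgrad: "linear_family (Q_h D) M (\<lambda>q z. bgrad q E (r z))"
proof (rule linear_familyI)
  fix u z assume "u \<in> Q_h D"
  then obtain a b where u: "u E = (\<lambda>x. a + b \<bullet> x)"
    using mesh(2) by (metis Q_h_affine)
  then show "ess_bounded M (\<lambda>z. bgrad u E (r z))"
    by (simp add: bgrad_affine ess_bounded_const)
  have "(c *\<^sub>R u) E = (\<lambda>x. c * a + (c *\<^sub>R b) \<bullet> x)" for c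
    using u by (auto simp: algebra_simps)
  then show "bgrad (c *\<^sub>R u) E (r z) = c *\<^sub>R bgrad u E (r z)" for c
    using u by (simp add: bgrad_affine)
  fix v assume "v \<in> Q_h D"
  then obtain a' b' where v: "v E = (\<lambda>x. a' + b' \<bullet> x)"
    using mesh(2) by (metis Q_h_affine)
  have "(u + v) E = (\<lambda>x. (a + a') + (b + b') \<bullet> x)"
    using u v by (auto simp: inner_add_left)
  then show "bgrad (u + v) E (r z) = bgrad u E (r z) + bgrad v E (r z)"
    using u v by (simp add: bgrad_affine)
qed

lemma linear_family_V_h: "linear_family (V_h D) M (\<lambda>v z. v E (r z))"
proof (rule linear_familyI)
  show "ess_bounded M (\<lambda>z. u E (r z))" if "u \<in> V_h D" for u
    using linear_familyD(1)[OF linear_family_Q_h V_hD[OF that]] by (intro ess_bounded_vec)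
qed simp_all

lemma linear_family_bjac: "linear_family (V_h D) M (\<lambda>v z. bjac v E (r z))"
proof (rule linear_familyI)
  have bjac: "bjac v E x $ i = bgrad (\<lambda>E x. v E x $ i) E x" for v i x
    by (simp add: bjac_def bgrad_def)
  fix u z assume u: "u \<in> V_h D"
  show "ess_bounded M (\<lambda>z. bjac u E (r z))"
    by (rule ess_bounded_vec) (simp add: bjac linear_familyD(1)[OF linear_family_bgrad V_hD[OF u]])
  obtain a b where "\<forall>i. (\<lambda>x. u E x $ i) = (\<lambda>x. a i + b i \<bullet> x)"
    by (rule V_h_affine[OF u mesh(2)])
  then have ab: "(\<lambda>x. u E x $ i) = (\<lambda>x. a i + b i \<bullet> x)" for i ..
  have "(\<lambda>x. (c *\<^sub>R u) E x $ i) = (\<lambda>x. c * a i + (c *\<^sub>R b i) \<bullet> x)" for c i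
    using fun_cong[OF ab] by (auto simp: algebra_simps)
  then have "bjac (c *\<^sub>R u) E (r z) = (\<chi> i. c *\<^sub>R b i)" for c
    unfolding bjac_def by (simp only: grad_affine)
  then show "bjac (c *\<^sub>R u) E (r z) = c *\<^sub>R bjac u E (r z)" for c
    unfolding bjac_def ab by (simp add: vec_eq_iff)
  fix v assume v: "v \<in> V_h D"
  obtain a' b' where "\<forall>i. (\<lambda>x. v E x $ i) = (\<lambda>x. a' i + b' i \<bullet> x)"
    by (rule V_h_affine[OF v mesh(2)])
  then have ab': "(\<lambda>x. v E x $ i) = (\<lambda>x. a' i + b' i \<bullet> x)" for i ..
  have "(\<lambda>x. (u + v) E x $ i) = (\<lambda>x. (a i + a' i) + (b i + b' i) \<bullet> x)" for i
    using fun_cong[OF ab] fun_cong[OF ab'] by (auto simp: inner_add_left)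
  then show "bjac (u + v) E (r z) = bjac u E (r z) + bjac v E (r z)"
    unfolding bjac_def ab ab' by (simp add: vec_eq_iff)
qed

lemma linear_family_bdiv: "linear_family (V_h D) M (\<lambda>v z. bdiv v E (r z))"
proof -
  have "linear (trace :: real^3^3 \<Rightarrow> real)"
    by (rule linearI) (simp_all add: trace_def sum.distrib sum_distrib_left)
  then show ?thesis
    unfolding bdiv_def
    by (intro linear_family_bounded_linear[OF _ linear_family_bjac] linear_conv_bounded_linear[THEN iffD1])
qed

end

section \<open>The truncated saturation and the coefficients\<close>

lemma valid_dataD:
  assumes "valid_data D"
  shows "0 < p_d D" "0 < eps D" "eps D < 1/2" "0 < tau0 D" "0 < tau D" "0 < gam D"
    "eps_p D \<in> {-1, 1}" "0 < sigma_p D"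
  using assms by (auto simp: valid_data_def)

lemma sat_measurable [measurable]: "sat D \<in> borel_measurable borel"
  unfolding sat_def[abs_def] by measurable

lemma trunc_measurable [measurable]: "trunc D \<in> borel_measurable borel"
  unfolding trunc_def[abs_def] by measurable

lemma trunc_bounds: "eps D < 1/2 \<Longrightarrow> trunc D q \<in> {eps D..1 - eps D}"
  by (simp add: trunc_def)

lemma continuous_on_sat: "continuous_on (- {0}) (sat D)"
  unfolding sat_def[abs_def] by (auto intro!: continuous_intros)

lemma DERIV_sat: "t \<noteq> 0 \<Longrightarrow> (sat D has_real_derivative - 2 * (p_d D)\<^sup>2 / t ^ 3) (at t)"
  unfolding sat_def[abs_def]
  by (auto intro!: derivative_eq_intros simp: power2_eq_square power3_eq_cube mult_ac)

text \<open>The derivative of the truncated saturation off the kinks: that of \<open>sat\<close> on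
  the untruncated band, 0 on the two plateaus.\<close>

definition dsat_trunc :: "biot \<Rightarrow> real \<Rightarrow> real" where
  "dsat_trunc D t = (if sat D t \<in> {eps D<..<1 - eps D} then - 2 * (p_d D)\<^sup>2 / t ^ 3 else 0)"

text \<open>The point 0 is included because division by zero gives \<open>sat D 0 = 0\<close>,
  truncated to \<open>eps D\<close>, whereas nearby values of \<open>sat\<close> are large and
  truncated to \<open>1 - eps D\<close>.\<close>

definition kinks :: "biot \<Rightarrow> real set" where
  "kinks D = {t. t = 0 \<or> sat D t = eps D \<or> sat D t = 1 - eps D}"

text \<open>A positive level \<open>c\<close> of \<open>sat\<close> is attained only at the two
  square roots of \<open>(p_d D)^2 / c\<close>; both truncation levels are positive.\<close>

lemma finite_kinks:
  assumes "0 < p_d D" "0 < eps D" "eps D < 1/2"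
  shows "finite (kinks D)"
proof -
  have *: "finite {t. sat D t = c}" if "0 < c" for c
  proof (rule finite_subset)
    show "{t. sat D t = c} \<subseteq> {sqrt ((p_d D)\<^sup>2 / c), - sqrt ((p_d D)\<^sup>2 / c)}"
    proof
      fix t assume "t \<in> {t. sat D t = c}"
      then have "(p_d D)\<^sup>2 / c = t\<^sup>2"
        using that assms by (auto simp: sat_def power_divide field_simps split: if_splits)
      then have "sqrt ((p_d D)\<^sup>2 / c) = \<bar>t\<bar>" by simp
      then show "t \<in> {sqrt ((p_d D)\<^sup>2 / c), - sqrt ((p_d D)\<^sup>2 / c)}" by auto
    qed
  qed simp
  have "kinks D = {0} \<union> {t. sat D t = eps D} \<union> {t. sat D t = 1 - eps D}"
    by (auto simp: kinks_def)
  then show ?thesis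
    using *[of "eps D"] *[of "1 - eps D"] assms by simp
qed

text \<open>Off the kinks one of three strict inequalities holds, and by continuity of
  \<open>sat\<close> away from 0 it persists on an open set, where the truncation is constant or the
  identity.\<close>

lemma DERIV_trunc_sat:
  assumes "eps D < 1/2" "t \<notin> kinks D"
  shows "((\<lambda>p. trunc D (sat D p)) has_real_derivative dsat_trunc D t) (at t)"
proof -
  have t: "t \<noteq> 0" "sat D t \<noteq> eps D" "sat D t \<noteq> 1 - eps D"
    using assms by (auto simp: kinks_def)
  have op: "open (- {0} \<inter> sat D -` S)" if "open S" for S
    by (rule continuous_open_preimage[OF continuous_on_sat]) (use that in auto)
  consider "sat D t < eps D" | "sat D t \<in> {eps D<..<1 - eps D}" | "1 - eps D < sat D t"
    using t by force
  then show ?thesis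
  proof cases
    case 1
    show ?thesis
      by (rule has_field_derivative_transform_within_open[OF _ op[of "{..<eps D}"], of "\<lambda>_. eps D"])
        (use 1 t assms in \<open>auto simp: dsat_trunc_def trunc_def\<close>)
  next
    case 2
    show ?thesis
      by (rule has_field_derivative_transform_within_open[OF _ op[of "{eps D<..<1 - eps D}"], of "sat D"])
        (use 2 t assms DERIV_sat[of t D] in \<open>auto simp: dsat_trunc_def trunc_def\<close>)
  next
    case 3
    show ?thesis
      by (rule has_field_derivative_transform_within_open[OF _ op[of "{1 - eps D<..}"], of "\<lambda>_. 1 - eps D"])
        (use 3 t assms in \<open>auto simp: dsat_trunc_def trunc_def\<close>)
  qed
qed

lemma dsat_trunc_measurable [measurable]: "dsat_trunc D \<in> borel_measurable borel"
  unfolding dsat_trunc_def[abs_def] by measurable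

text \<open>On the untruncated band \<open>y = p_d D / t\<close> satisfies \<open>y^2 < 1\<close>,
  and the derivative of \<open>sat\<close> is \<open>- 2 * y^3 / p_d D\<close>. The upper truncation
  thus keeps the singularity at 0 away.\<close>

lemma dsat_trunc_bound:
  assumes "0 < p_d D" "0 < eps D"
  shows "\<bar>dsat_trunc D t\<bar> \<le> 2 / p_d D"
proof (cases "sat D t \<in> {eps D<..<1 - eps D}")
  case True
  define y where "y = p_d D / t"
  have "y\<^sup>2 < 1" and y: "dsat_trunc D t = - 2 * y ^ 3 / p_d D"
    using True assms by (auto simp: sat_def y_def dsat_trunc_def power2_eq_square power3_eq_cube)
  then have "\<bar>y\<bar> \<le> 1"
    using abs_square_less_1[of y] by simp
  then have "\<bar>y\<bar> ^ 3 \<le> 1"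
    by (simp add: power_le_one)
  then show ?thesis
    using assms by (simp add: y abs_mult power_abs divide_right_mono)
qed (use assms in \<open>auto simp: dsat_trunc_def\<close>)

lemma Q_h_diff_affine:
  assumes "Po \<in> Q_h D" "Pw \<in> Q_h D" "E \<in> mesh D"
  obtains a b where "\<forall>x. Po E x - Pw E x = a + b \<bullet> x"
proof -
  obtain a b a' b' where "Po E = (\<lambda>x. a + b \<bullet> x)" "Pw E = (\<lambda>x. a' + b' \<bullet> x)"
    using assms by (metis Q_h_affine)
  then have "\<forall>x. Po E x - Pw E x = (a - a') + (b - b') \<bullet> x"
    by (simp add: inner_diff_left)
  then show ?thesis by (rule that)
qed

text \<open>
  Where the discrete capillary pressure is not constant, the kinks of the truncated saturation (and
  its jump at capillary pressure 0) lie on finitely many planes.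
\<close>

lemma S_w_gradient:
  assumes D: "valid_mesh D" "valid_data D" and E: "E \<in> mesh D"
    and P: "Po \<in> Q_h D" "Pw \<in> Q_h D"
  obtains G where "ess_bounded (lebesgue_on E) G"
    "AE x in lebesgue_on E. GDERIV (S_w D Po Pw E) x :> G x"
proof -
  note d = valid_dataD[OF D(2)]
  obtain a b where ab: "\<forall>x. Po E x - Pw E x = a + b \<bullet> x"
    by (rule Q_h_diff_affine[OF P E])
  have S: "S_w D Po Pw E = (\<lambda>x. trunc D (sat D (a + b \<bullet> x)))"
    by (simp add: S_w_def ab fun_eq_iff)
  show ?thesis
  proof (cases "b = 0")
    \<comment> \<open>A constant capillary pressure may sit at a kink on the whole element; the
      saturation is then constant too and its gradient exists.\<close>
    case True
    then have "GDERIV (S_w D Po Pw E) x :> 0" for x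
      by (simp add: S GDERIV_const)
    then show ?thesis
      by (intro that[of "\<lambda>x. 0"] ess_bounded_const) simp
  next
    case False
    define G where "G x = dsat_trunc D (a + b \<bullet> x) *\<^sub>R b" for x
    have "ess_bounded (lebesgue_on E) (\<lambda>x. dsat_trunc D (a + b \<bullet> x))"
    proof (rule ess_bounded_compose_borel[OF measurable_id_lebesgue_on])
      show "(\<lambda>x. dsat_trunc D (a + b \<bullet> x)) \<in> borel_measurable (restrict_space borel E)"
        by (rule measurable_restrict_space1) measurable
      show "bounded ((\<lambda>x. dsat_trunc D (a + b \<bullet> x)) ` E)"
        using dsat_trunc_bound[OF d(1,2)] by (auto simp: bounded_iff)
    qed
    then have "ess_bounded (lebesgue_on E) G"
      unfolding G_def by (rule ess_bounded_scaleR[OF _ ess_bounded_const])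
    moreover have "AE x in lebesgue_on E. GDERIV (S_w D Po Pw E) x :> G x"
    proof (rule AE_lebesgue_on_negligible)
      show "negligible (\<Union>t\<in>kinks D. {x. b \<bullet> x = t - a})"
        using finite_kinks[OF d(1-3)] False by (intro negligible_Union) (auto intro: negligible_hyperplane)
      fix x assume "x \<notin> (\<Union>t\<in>kinks D. {x. b \<bullet> x = t - a})"
      then have "a + b \<bullet> x \<notin> kinks D" by force
      then show "GDERIV (S_w D Po Pw E) x :> G x"
        unfolding S G_def
        by (rule GDERIV_DERIV_compose[OF GDERIV_affine DERIV_trunc_sat[OF d(3)]])
    qed (rule valid_mesh_elem(3)[OF D(1) E])
    ultimately show ?thesis by (rule that)
  qed
qed

lemma S_w_measurable:
  assumes "Po \<in> Q_h D" "Pw \<in> Q_h D" "E \<in> mesh D"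
  shows "S_w D Po Pw E \<in> borel_measurable borel"
proof -
  obtain a b where "\<forall>x. Po E x - Pw E x = a + b \<bullet> x"
    by (rule Q_h_diff_affine[OF assms])
  then have "S_w D Po Pw E = (\<lambda>x. trunc D (sat D (a + b \<bullet> x)))"
    by (simp add: S_w_def fun_eq_iff)
  then show ?thesis by simp
qed

lemma S_w_bounds: "eps D < 1/2 \<Longrightarrow> S_w D Po Pw E x \<in> {eps D..1 - eps D}"
  unfolding S_w_def by (rule trunc_bounds)

lemma ess_bounded_S_w:
  assumes "valid_data D" "Po \<in> Q_h D" "Pw \<in> Q_h D" "E \<in> mesh D"
    and "r \<in> M \<rightarrow>\<^sub>M restrict_space borel E"
  shows "ess_bounded M (\<lambda>z. S_w D Po Pw E (r z))"
proof (rule ess_bounded_compose_borel[OF assms(5)])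
  show "S_w D Po Pw E \<in> borel_measurable (restrict_space borel E)"
    by (rule measurable_restrict_space1[OF S_w_measurable[OF assms(2-4)]])
  have "\<bar>S_w D Po Pw E x\<bar> \<le> 1" for x
    using S_w_bounds[of D Po Pw E x] valid_dataD(2,3)[OF assms(1)] by auto
  then show "bounded (S_w D Po Pw E ` E)"
    by (auto simp: bounded_iff)
qed

text \<open>The data only bound mobilities and permeability from above; positivity turns this into a
  bound of the absolute value. Mobilities are controlled on the truncated range only, which
  \<open>S_w\<close> never leaves.\<close>

lemma ess_bounded_mobility:
  assumes D: "valid_data D" and P: "Po \<in> Q_h D" "Pw \<in> Q_h D" and E: "E \<in> mesh D"
    and r: "r \<in> M \<rightarrow>\<^sub>M restrict_space borel E"
    and k: "k \<in> {mob_w D, mob_o D}" "\<exists>c>0. \<forall>s\<in>{eps D..1 - eps D}. c \<le> k s"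
  shows "ess_bounded M (\<lambda>z. k (S_w D Po Pw E (r z)) * perm D E (r z))"
proof -
  have *: "\<exists>c. \<forall>x\<in>A. \<bar>f x\<bar> \<le> c" if "bdd_above (f ` A)" "\<forall>x\<in>A. 0 < f x" for f :: "'b \<Rightarrow> real" and A
    using that by (force simp: bdd_above_def)
  have k': "k \<in> borel_measurable (restrict_space borel {eps D..1 - eps D})"
      "bdd_above (k ` {eps D..1 - eps D})"
    using D k(1) by (auto simp: valid_data_def)
  have S: "S_w D Po Pw E \<in> restrict_space borel E \<rightarrow>\<^sub>M restrict_space borel {eps D..1 - eps D}"
    using S_w_bounds[OF valid_dataD(3)[OF D]]
    by (intro measurable_restrict_space2 measurable_restrict_space1 S_w_measurable P E) auto
  have "\<forall>s\<in>{eps D..1 - eps D}. 0 < k s"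
    using k(2) by force
  from *[OF k'(2) this] obtain c where c: "\<forall>s\<in>{eps D..1 - eps D}. \<bar>k s\<bar> \<le> c" ..
  have "ess_bounded M (\<lambda>z. k (S_w D Po Pw E (r z)))"
  proof (rule ess_bounded_compose_borel[OF r measurable_compose[OF S k'(1)]])
    show "bounded ((\<lambda>x. k (S_w D Po Pw E x)) ` E)"
      unfolding bounded_iff real_norm_def using c S_w_bounds[OF valid_dataD(3)[OF D]] by blast
  qed
  moreover have "ess_bounded M (\<lambda>z. perm D E (r z))"
  proof (rule ess_bounded_compose_borel[OF r])
    have p: "perm D E \<in> borel_measurable (restrict_space borel E)" "\<forall>x\<in>E. 0 < perm D E x"
        "bdd_above (perm D E ` E)"
      using D E by (auto simp: valid_data_def)
    then show "perm D E \<in> borel_measurable (restrict_space borel E)" by blast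
    show "bounded (perm D E ` E)"
      using *[OF p(3,2)] by (auto simp: bounded_iff)
  qed
  ultimately show ?thesis by (rule ess_bounded_mult)
qed

text \<open>The sign conditions make the capillary pressure positive on the whole closed element, so
  \<open>sat\<close> and its derivative are continuous along it on a compact set, hence
  bounded.\<close>

lemma ess_bounded_C:
  assumes D: "valid_mesh D" "valid_data D" and E: "E \<in> mesh D"
    and P: "Po \<in> Q_h D" "Pw \<in> Q_h D"
    and a: "\<forall>x\<in>Om D. 0 \<le> alpha D - poro D x" and s: "sign_conditions D Po Pw"
  shows "ess_bounded (lebesgue_on E) (C1 D Po Pw E)" "ess_bounded (lebesgue_on E) (C2 D Po Pw E)"
    and "ess_bounded (lebesgue_on E) (C3 D Po Pw E)" "ess_bounded (lebesgue_on E) (C4 D Po Pw E)"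
proof -
  define p where "p x = Po E x - Pw E x" for x
  obtain b c where "\<forall>x. p x = b + c \<bullet> x"
    unfolding p_def by (rule Q_h_diff_affine[OF P E])
  then have "p = (\<lambda>x. b + c \<bullet> x)"
    by (simp add: fun_eq_iff)
  then have pc: "continuous_on E p"
    by (auto intro!: continuous_intros)
  have p0: "p x \<noteq> 0" if "x \<in> E" for x
    using s E that unfolding sign_conditions_def p_def by force
  note bdd = ess_bounded_compose_continuous[OF measurable_id_lebesgue_on valid_mesh_elem(1)[OF D(1) E]]
  have 1: "ess_bounded (lebesgue_on E) p"
    by (rule bdd[OF pc])
  have 2: "ess_bounded (lebesgue_on E) (\<lambda>x. sat D (p x))"
    by (rule bdd, rule continuous_on_compose2[OF continuous_on_sat pc]) (use p0 in auto)
  have 3: "ess_bounded (lebesgue_on E) (\<lambda>x. deriv (sat D) (p x))"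
  proof (rule bdd, rule continuous_on_eq)
    show "continuous_on E (\<lambda>x. - 2 * (p_d D)\<^sup>2 / p x ^ 3)"
      using pc p0 by (intro continuous_intros) auto
  qed (simp add: deriv_sat p0)
  have 4: "ess_bounded (lebesgue_on E) (poro D)"
  proof (rule ess_bounded_elem_data[OF D(1) E])
    show "poro D \<in> borel_measurable (lebesgue_on (Om D))"
      using D(2) by (simp add: valid_data_def)
    \<comment> \<open>The porosity is positive and, by the first standing assumption, at most
      \<open>alpha D\<close>.\<close>
    show "\<bar>poro D x\<bar> \<le> alpha D" if "x \<in> Om D" for x
      using D(2) a that by (force simp: valid_data_def)
  qed
  note intros = ess_bounded_add ess_bounded_diff ess_bounded_mult ess_bounded_divide_const
    ess_bounded_power ess_bounded_const 1 2 3 4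
  show "ess_bounded (lebesgue_on E) (C1 D Po Pw E)"
    unfolding C1_def[abs_def] Let_def p_def[symmetric] by (intro intros)
  show "ess_bounded (lebesgue_on E) (C2 D Po Pw E)"
    unfolding C2_def[abs_def] Let_def p_def[symmetric] by (intro intros)
  show "ess_bounded (lebesgue_on E) (C3 D Po Pw E)"
    unfolding C3_def[abs_def] Let_def p_def[symmetric] by (intro intros)
  show "ess_bounded (lebesgue_on E) (C4 D Po Pw E)"
    unfolding C4_def[abs_def] Let_def p_def[symmetric] by (intro intros)
qed

section \<open>Linearity of the forms\<close>

text \<open>Traces on faces are listed separately: faces are null sets, so a bound almost everywhere
  on an element does not control them.\<close>

definition ess_bounded_broken :: "biot \<Rightarrow> 'b::euclidean_space broken \<Rightarrow> bool" where
  "ess_bounded_broken D f \<longleftrightarrow> (\<forall>E\<in>mesh D. ess_bounded (lebesgue_on E) (f E) \<and>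
     (\<forall>e\<in>int_faces D \<union> bd_faces D. e \<subseteq> E \<longrightarrow> ess_bounded (face_space e) (\<lambda>z. f E (plane_chart e z))))"

definition linear_broken ::
  "biot \<Rightarrow> 'v::real_vector set \<Rightarrow> ('v \<Rightarrow> 'b::euclidean_space broken) \<Rightarrow> bool" where
  "linear_broken D V T \<longleftrightarrow> (\<forall>E\<in>mesh D. linear_family V (lebesgue_on E) (\<lambda>v. T v E) \<and>
     (\<forall>e\<in>int_faces D \<union> bd_faces D. e \<subseteq> E \<longrightarrow>
        linear_family V (face_space e) (\<lambda>v z. T v E (plane_chart e z))))"

lemma linear_brokenD: "linear_broken D V T \<Longrightarrow> v \<in> V \<Longrightarrow> ess_bounded_broken D (T v)"
  by (auto simp: linear_broken_def ess_bounded_broken_def dest: linear_familyD(1))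

lemma linear_broken_bounded_linear:
  assumes "bounded_linear h" "linear_broken D V T"
  shows "linear_broken D V (\<lambda>v E x. h (T v E x))"
  unfolding linear_broken_def
proof (intro ballI conjI impI)
  fix E assume E: "E \<in> mesh D"
  show "linear_family V (lebesgue_on E) (\<lambda>v x. h (T v E x))"
    using assms(2) E by (intro linear_family_bounded_linear[OF assms(1)]) (simp add: linear_broken_def)
  fix e assume "e \<in> int_faces D \<union> bd_faces D" "e \<subseteq> E"
  with assms(2) E have "linear_family V (face_space e) (\<lambda>v z. T v E (plane_chart e z))"
    by (simp add: linear_broken_def)
  from linear_family_bounded_linear[OF assms(1) this]
  show "linear_family V (face_space e) (\<lambda>v z. h (T v E (plane_chart e z)))" .
qed

lemma linear_broken_scaleR:
  "ess_bounded_broken D k \<Longrightarrow> linear_broken D V T \<Longrightarrow> linear_broken D V (\<lambda>v E x. k E x *\<^sub>R T v E x)"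
  by (simp add: linear_broken_def ess_bounded_broken_def linear_family_scaleR)

lemma ess_bounded_broken_mult:
  fixes f g :: "real broken"
  shows "ess_bounded_broken D f \<Longrightarrow> ess_bounded_broken D g \<Longrightarrow> ess_bounded_broken D (\<lambda>E x. f E x * g E x)"
  by (simp add: ess_bounded_broken_def ess_bounded_mult)

lemma ess_bounded_broken_add:
  "ess_bounded_broken D f \<Longrightarrow> ess_bounded_broken D g \<Longrightarrow> ess_bounded_broken D (\<lambda>E x. f E x + g E x)"
  by (simp add: ess_bounded_broken_def ess_bounded_add)

lemma ess_bounded_broken_diff:
  "ess_bounded_broken D f \<Longrightarrow> ess_bounded_broken D g \<Longrightarrow> ess_bounded_broken D (\<lambda>E x. f E x - g E x)"
  by (simp add: ess_bounded_broken_def ess_bounded_diff)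

lemma ess_bounded_broken_const: "ess_bounded_broken D (\<lambda>E x. c)"
  by (simp add: ess_bounded_broken_def ess_bounded_const)

context
  fixes D :: biot
  assumes mesh: "valid_mesh D"
begin

lemma linear_broken_Q_h: "linear_broken D (Q_h D) (\<lambda>q. q)"
  unfolding linear_broken_def
  using linear_family_Q_h[OF mesh _ measurable_id_lebesgue_on]
    linear_family_Q_h[OF mesh _ measurable_plane_chart] face_geometry(1)[OF mesh] by auto

lemma linear_broken_bgrad: "linear_broken D (Q_h D) bgrad"
  unfolding linear_broken_def
  using linear_family_bgrad[OF mesh _ measurable_id_lebesgue_on]
    linear_family_bgrad[OF mesh _ measurable_plane_chart] face_geometry(1)[OF mesh] by auto

lemma linear_broken_V_h: "linear_broken D (V_h D) (\<lambda>v. v)"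
  unfolding linear_broken_def
  using linear_family_V_h[OF mesh _ measurable_id_lebesgue_on]
    linear_family_V_h[OF mesh _ measurable_plane_chart] face_geometry(1)[OF mesh] by auto

lemma linear_broken_bjac: "linear_broken D (V_h D) bjac"
  unfolding linear_broken_def
  using linear_family_bjac[OF mesh _ measurable_id_lebesgue_on]
    linear_family_bjac[OF mesh _ measurable_plane_chart] face_geometry(1)[OF mesh] by auto

lemma linear_broken_bdiv: "linear_broken D (V_h D) bdiv"
  unfolding linear_broken_def
  using linear_family_bdiv[OF mesh _ measurable_id_lebesgue_on]
    linear_family_bdiv[OF mesh _ measurable_plane_chart] face_geometry(1)[OF mesh] by auto

lemma linear_face_jump:
  "e \<in> int_faces D \<union> bd_faces D \<Longrightarrow> linear_broken D V T \<Longrightarrow>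
    linear_family V (face_space e) (\<lambda>v z. jump D e (T v) (plane_chart e z))"
  by (rule linear_family_jump[OF mesh]) (auto simp: linear_broken_def)

lemma linear_face_avg:
  "e \<in> int_faces D \<union> bd_faces D \<Longrightarrow> linear_broken D V T \<Longrightarrow>
    linear_family V (face_space e) (\<lambda>v z. avg D e (T v) (plane_chart e z))"
  by (rule linear_family_avg[OF mesh]) (auto simp: linear_broken_def)

lemma ess_bounded_face_jump:
  "e \<in> int_faces D \<union> bd_faces D \<Longrightarrow> ess_bounded_broken D f \<Longrightarrow>
    ess_bounded (face_space e) (\<lambda>z. jump D e f (plane_chart e z))"
  by (rule ess_bounded_jump[OF mesh]) (auto simp: ess_bounded_broken_def)

lemma ess_bounded_face_avg:
  "e \<in> int_faces D \<union> bd_faces D \<Longrightarrow> ess_bounded_broken D f \<Longrightarrow>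
    ess_bounded (face_space e) (\<lambda>z. avg D e f (plane_chart e z))"
  by (rule ess_bounded_avg[OF mesh]) (auto simp: ess_bounded_broken_def)

section \<open>Inner products over elements and faces as linear functionals\<close>

lemma ip_Om_right_data:
  assumes "subspace V" "\<And>E. E \<in> mesh D \<Longrightarrow> integrable (lebesgue_on E) (f E)"
    and "\<And>E. E \<in> mesh D \<Longrightarrow> linear_family V (lebesgue_on E) (\<lambda>v. T v E)"
  shows "linear_functional_on V (\<lambda>v. ip_Om D f (T v))"
  unfolding ip_Om_def ip_elem_def
  by (intro linear_functional_on_sum linear_functional_on_integral_inner assms)

lemma ip_Om_right:
  assumes "subspace V" "ess_bounded_broken D f" "linear_broken D V T"
  shows "linear_functional_on V (\<lambda>v. ip_Om D f (T v))"
  using assms valid_mesh_elem(5)[OF mesh]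
  by (intro ip_Om_right_data)
    (auto simp: linear_broken_def ess_bounded_broken_def intro: ess_bounded_integrable)

lemma ip_Om_left:
  assumes "subspace V" "ess_bounded_broken D f" "linear_broken D V T"
  shows "linear_functional_on V (\<lambda>v. ip_Om D (T v) f)"
  using ip_Om_right[OF assms] by (simp add: ip_Om_def ip_elem_def inner_commute)

lemma ip_face_right_data:
  assumes "subspace V" "integrable (face_space e) (\<lambda>z. f (plane_chart e z))"
    and "linear_family V (face_space e) (\<lambda>v z. T v (plane_chart e z))"
  shows "linear_functional_on V (\<lambda>v. ip_face e f (T v))"
  unfolding ip_face_def by (intro linear_functional_on_integral_inner assms)

lemma ip_face_left_data:
  assumes "subspace V" "integrable (face_space e) (\<lambda>z. f (plane_chart e z))"
    and "linear_family V (face_space e) (\<lambda>v z. T v (plane_chart e z))"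
  shows "linear_functional_on V (\<lambda>v. ip_face e (T v) f)"
  using ip_face_right_data[OF assms] by (simp add: ip_face_def inner_commute)

lemma ip_face_right:
  assumes "subspace V" "e \<in> int_faces D \<union> bd_faces D"
    and "ess_bounded (face_space e) (\<lambda>z. f (plane_chart e z))"
    and "linear_family V (face_space e) (\<lambda>v z. T v (plane_chart e z))"
  shows "linear_functional_on V (\<lambda>v. ip_face e f (T v))"
  by (intro ip_face_right_data ess_bounded_integrable assms face_geometry[OF mesh])

lemma ip_face_left:
  assumes "subspace V" "e \<in> int_faces D \<union> bd_faces D"
    and "ess_bounded (face_space e) (\<lambda>z. f (plane_chart e z))"
    and "linear_family V (face_space e) (\<lambda>v z. T v (plane_chart e z))"
  shows "linear_functional_on V (\<lambda>v. ip_face e (T v) f)"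
  using ip_face_right[OF assms] by (simp add: ip_face_def inner_commute)

lemma faces_subset:
  "faces_p D \<subseteq> int_faces D \<union> bd_faces D" "faces_u D \<subseteq> int_faces D \<union> bd_faces D"
  "part_faces D G \<subseteq> int_faces D \<union> bd_faces D"
  by (auto simp: faces_p_def faces_u_def part_faces_def)

lemma linear_face_flux:
  assumes "e \<in> int_faces D \<union> bd_faces D" "ess_bounded_broken D k"
  shows "linear_family (Q_h D) (face_space e)
    (\<lambda>q z. avg D e (\<lambda>E x. k E x *\<^sub>R bgrad q E x) (plane_chart e z) \<bullet> n)"
  by (rule linear_family_bounded_linear[OF bounded_linear_inner_left])
    (rule linear_face_avg[OF assms(1) linear_broken_scaleR[OF assms(2) linear_broken_bgrad]])

lemma linear_face_traction:
  assumes "e \<in> int_faces D \<union> bd_faces D"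
  shows "linear_family (V_h D) (face_space e) (\<lambda>v z. avg D e (bjac v) (plane_chart e z) *v n)"
proof -
  have "bounded_linear (\<lambda>A :: real^3^3. A *v n)"
    unfolding linear_conv_bounded_linear[symmetric]
    by (rule linearI) (simp_all add: matrix_vector_mult_add_rdistrib scaleR_matrix_vector_assoc)
  from linear_family_bounded_linear[OF this linear_face_avg[OF assms linear_broken_bjac]]
  show ?thesis .
qed

lemma a_form_linear:
  assumes k: "ess_bounded_broken D k" and p: "p \<in> Q_h D"
  shows "linear_functional_on (Q_h D) (\<lambda>q. a_form D k p q)"
    and "linear_functional_on (Q_h D) (\<lambda>q. a_form D k q p)"
proof -
  note lin = linear_broken_bgrad linear_broken_scaleR[OF k linear_broken_bgrad]
    linear_broken_Q_h
  note bdd = lin[THEN linear_brokenD, OF p]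
  have flux: "linear_family (Q_h D) (face_space e)
      (\<lambda>q z. avg D e (\<lambda>E x. k E x *\<^sub>R bgrad q E x) (plane_chart e z) \<bullet> n)" if "e \<in> faces_p D" for e n
    using that faces_subset linear_face_flux k by blast
  have jump: "linear_family (Q_h D) (face_space e) (\<lambda>q z. jump D e q (plane_chart e z))"
    if "e \<in> faces_p D" for e
    using that faces_subset linear_face_jump[OF _ linear_broken_Q_h] by blast
  note * = flux[THEN linear_familyD(1)[OF _ p]] jump[THEN linear_familyD(1)[OF _ p]]
  have F: "e \<in> faces_p D \<Longrightarrow> e \<in> int_faces D \<union> bd_faces D" for e
    using faces_subset by blast
  show "linear_functional_on (Q_h D) (\<lambda>q. a_form D k p q)"
    unfolding a_form_def
    by (intro linear_functional_on_intros ip_Om_right ip_face_right ip_face_left subspace_Q_h)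
      (simp_all add: lin bdd * flux jump F del: Un_iff)
  show "linear_functional_on (Q_h D) (\<lambda>q. a_form D k q p)"
    unfolding a_form_def
    by (intro linear_functional_on_intros ip_Om_left ip_face_right ip_face_left subspace_Q_h)
      (simp_all add: lin bdd * flux jump F del: Un_iff)
qed

lemma c_form_linear:
  assumes u: "u \<in> V_h D"
  shows "linear_functional_on (V_h D) (\<lambda>v. c_form D u v)"
    and "linear_functional_on (V_h D) (\<lambda>v. c_form D v u)"
proof -
  note lin = linear_broken_bjac linear_broken_bdiv linear_broken_V_h
    linear_broken_bounded_linear[OF bounded_linear_inner_left linear_broken_V_h]
  note bdd = lin[THEN linear_brokenD, OF u]
  have F: "e \<in> faces_u D \<Longrightarrow> e \<in> int_faces D \<union> bd_faces D" for e
    using faces_subset by blast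
  have fam: "linear_family (V_h D) (face_space e) (\<lambda>v z. avg D e (bjac v) (plane_chart e z) *v n)"
    "linear_family (V_h D) (face_space e) (\<lambda>v z. avg D e (bdiv v) (plane_chart e z))"
    "linear_family (V_h D) (face_space e) (\<lambda>v z. jump D e v (plane_chart e z))"
    "linear_family (V_h D) (face_space e) (\<lambda>v z. jump D e (\<lambda>E x. v E x \<bullet> n) (plane_chart e z))"
    if "e \<in> faces_u D" for e n
    using linear_face_traction[OF F[OF that]] lin(2,3,4) linear_face_avg[OF F[OF that]]
      linear_face_jump[OF F[OF that]] by blast+
  note * = fam[THEN linear_familyD(1)[OF _ u]]
  show "linear_functional_on (V_h D) (\<lambda>v. c_form D u v)"
    unfolding c_form_def
    by (intro linear_functional_on_intros ip_Om_right ip_face_right ip_face_left subspace_V_h)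
      (simp_all add: lin bdd * fam F del: Un_iff)
  show "linear_functional_on (V_h D) (\<lambda>v. c_form D v u)"
    unfolding c_form_def
    by (intro linear_functional_on_intros ip_Om_left ip_face_right ip_face_left subspace_V_h)
      (simp_all add: lin bdd * fam F del: Un_iff)
qed

lemma integrable_face_data:
  "e \<in> F \<Longrightarrow> F \<subseteq> int_faces D \<union> bd_faces D \<Longrightarrow> L2_faces F g \<Longrightarrow>
    integrable (face_space e) (\<lambda>z. g (plane_chart e z))"
  using face_geometry(3)[OF mesh] by (intro sq_integrable_integrable) auto

text \<open>The data are square integrable, hence integrable on elements and faces; all dependence
  on \<open>q\<close> goes through bounded linear families.\<close>

lemma ell_p_linear:
  assumes k: "ess_bounded_broken D k" and f: "L2_vol (Om D) f"
    and pD: "L2_faces (part_faces D (Gam_pD D)) pD" and g: "L2_faces (part_faces D (Gam_pN D)) g"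
  shows "linear_functional_on (Q_h D) (\<lambda>q. ell_p D k f pD g q)"
proof -
  have F: "e \<in> part_faces D G \<Longrightarrow> e \<in> int_faces D \<union> bd_faces D" for e G
    using faces_subset by blast
  have vol: "linear_family (Q_h D) (lebesgue_on E) (\<lambda>q. q E)" if "E \<in> mesh D" for E
    using linear_broken_Q_h that by (simp add: linear_broken_def)
  show ?thesis
    unfolding ell_p_def
    by (intro linear_functional_on_intros ip_Om_right_data ip_face_right_data ip_face_left_data
        subspace_Q_h linear_face_flux[OF F k] linear_face_avg[OF F linear_broken_Q_h] vol
        integrable_elem_data[OF mesh _ f] integrable_face_data[OF _ faces_subset(3) pD]
        integrable_face_data[OF _ faces_subset(3) g])
qed

lemma ell_u_linear:
  assumes f: "L2_vol (Om D) (f_u D t)"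
    and uD: "L2_faces (part_faces D (Gam_uD D)) (u_D D t)"
    and g: "L2_faces (part_faces D (Gam_uN D)) (g_u D t)"
  shows "linear_functional_on (V_h D) (\<lambda>v. ell_u D t v)"
proof -
  have F: "e \<in> part_faces D G \<Longrightarrow> e \<in> int_faces D \<union> bd_faces D" for e G
    using faces_subset by blast
  have vol: "linear_family (V_h D) (lebesgue_on E) (\<lambda>v. v E)" if "E \<in> mesh D" for E
    using linear_broken_V_h that by (simp add: linear_broken_def)
  show ?thesis
    unfolding ell_u_def
    by (intro linear_functional_on_intros ip_Om_right_data ip_face_right_data ip_face_left_data
        subspace_V_h linear_face_traction[OF F] linear_face_avg[OF F linear_broken_V_h] vol
        integrable_elem_data[OF mesh _ f] integrable_face_data[OF _ faces_subset(3) uD]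
        integrable_face_data[OF _ faces_subset(3) g])
qed

end

text \<open>For the summand of the product rule in which the scalar test function multiplies the
  gradient of the saturation.\<close>

lemma linear_family_scaleR_left:
  fixes T :: "'v::real_vector \<Rightarrow> 'a \<Rightarrow> real"
  assumes G: "ess_bounded M G" and T: "linear_family V M T"
  shows "linear_family V M (\<lambda>u x. T u x *\<^sub>R G x)"
  unfolding linear_family_def
proof (intro conjI ballI allI)
  fix u assume u: "u \<in> V"
  show "ess_bounded M (\<lambda>x. T u x *\<^sub>R G x)"
    by (rule ess_bounded_scaleR[OF linear_familyD(1)[OF T u] G])
  show "AE x in M. T (c *\<^sub>R u) x *\<^sub>R G x = c *\<^sub>R T u x *\<^sub>R G x" for c
    using linear_familyD(3)[OF T u, of c] by eventually_elim simp
  show "AE x in M. T (u + v) x *\<^sub>R G x = T u x *\<^sub>R G x + T v x *\<^sub>R G x" if "v \<in> V" for v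
    using linear_familyD(2)[OF T u that] by eventually_elim (simp add: scaleR_add_left)
qed

text \<open>Replaces the actual gradient of a product, partly unspecified, by the formula of the
  product rule.\<close>

lemma (in complete_measure) linear_family_AE_cong:
  assumes V: "subspace V" and T: "linear_family V M T"
    and ae: "\<And>v. v \<in> V \<Longrightarrow> AE x in M. T v x = T' v x"
  shows "linear_family V M T'"
  unfolding linear_family_def
proof (intro conjI ballI allI)
  fix u assume u: "u \<in> V"
  show "ess_bounded M (T' u)"
    by (rule ess_bounded_AE_cong[OF linear_familyD(1)[OF T u] ae[OF u]])
  show "AE x in M. T' (c *\<^sub>R u) x = c *\<^sub>R T' u x" for c
    using linear_familyD(3)[OF T u, of c] ae[OF u] ae[OF subspace_scale[OF V u, of c]]
    by eventually_elim simp
  show "AE x in M. T' (u + v) x = T' u x + T' v x" if v: "v \<in> V" for v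
    using linear_familyD(2)[OF T u v] ae[OF u] ae[OF v] ae[OF subspace_add[OF V u v]]
    by eventually_elim simp
qed

section \<open>Forms and coefficients that depend on the truncated saturation\<close>

context
  fixes D :: biot and Po Pw :: "real broken"
  assumes D: "valid_mesh D" "valid_data D" and P: "Po \<in> Q_h D" "Pw \<in> Q_h D"
begin

lemma ess_bounded_broken_S_w: "ess_bounded_broken D (S_w D Po Pw)"
  unfolding ess_bounded_broken_def
  using ess_bounded_S_w[OF D(2) P _ measurable_id_lebesgue_on]
    ess_bounded_S_w[OF D(2) P _ measurable_plane_chart] face_geometry(1)[OF D(1)] by auto

lemma ess_bounded_broken_chi:
  assumes "\<exists>c>0. \<forall>s\<in>{eps D..1 - eps D}. c \<le> mob_w D s"
    and "\<exists>c>0. \<forall>s\<in>{eps D..1 - eps D}. c \<le> mob_o D s"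
  shows "ess_bounded_broken D (chi_w D (S_w D Po Pw))" "ess_bounded_broken D (chi_o D (S_w D Po Pw))"
proof -
  have *: "ess_bounded_broken D (\<lambda>E x. k (S_w D Po Pw E x) * perm D E x)"
    if "k \<in> {mob_w D, mob_o D}" "\<exists>c>0. \<forall>s\<in>{eps D..1 - eps D}. c \<le> k s" for k
    unfolding ess_bounded_broken_def
    using ess_bounded_mobility[OF D(2) P _ measurable_id_lebesgue_on that]
      ess_bounded_mobility[OF D(2) P _ measurable_plane_chart that] face_geometry(1)[OF D(1)] by auto
  show "ess_bounded_broken D (chi_w D (S_w D Po Pw))" "ess_bounded_broken D (chi_o D (S_w D Po Pw))"
    unfolding chi_w_def[abs_def] chi_o_def[abs_def] by (rule *; use assms in simp)+
qed

text \<open>Only the volume term differentiates \<open>k E x * q E x\<close>; almost everywhere its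
  gradient is \<open>k\<close> times the gradient of \<open>q\<close> plus \<open>q\<close> times
  \<open>G\<close>. The face terms involve values of the product only.\<close>

lemma b_u_linear_gradient:
  assumes k: "ess_bounded_broken D k" and u: "u \<in> V_h D"
    and G: "\<And>E. E \<in> mesh D \<Longrightarrow> ess_bounded (lebesgue_on E) (G E)"
      "\<And>E. E \<in> mesh D \<Longrightarrow> AE x in lebesgue_on E. GDERIV (k E) x :> G E x"
  shows "linear_functional_on (Q_h D) (\<lambda>q. b_u D k u q)"
proof -
  have fam: "linear_family (Q_h D) (lebesgue_on E) (\<lambda>q. bgrad (\<lambda>E x. k E x * q E x) E)"
    if E: "E \<in> mesh D" for E
  proof -
    interpret complete_measure "lebesgue_on E" by (rule valid_mesh_elem(6)[OF D(1) E])
    show ?thesis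
    proof (rule linear_family_AE_cong[OF subspace_Q_h])
      show "linear_family (Q_h D) (lebesgue_on E) (\<lambda>q x. k E x *\<^sub>R bgrad q E x + q E x *\<^sub>R G E x)"
        using k E linear_broken_bgrad[OF D(1)] linear_broken_Q_h[OF D(1)]
        by (intro linear_family_add linear_family_scaleR linear_family_scaleR_left G)
          (auto simp: linear_broken_def ess_bounded_broken_def)
      fix q assume "q \<in> Q_h D"
      then obtain a b where q: "q E = (\<lambda>x. a + b \<bullet> x)"
        using E by (metis Q_h_affine)
      show "AE x in lebesgue_on E. k E x *\<^sub>R bgrad q E x + q E x *\<^sub>R G E x = bgrad (\<lambda>E x. k E x * q E x) E x"
        using G(2)[OF E]
      proof eventually_elim
        case (elim x)
        from GDERIV_mult[OF elim GDERIV_affine[of a b]] show ?case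
          unfolding bgrad_affine[of q, OF q] bgrad_def[of "\<lambda>E x. k E x * q E x"] q
          by (simp add: GDERIV_imp_grad)
      qed
    qed
  qed
  have u': "ess_bounded_broken D (\<lambda>E x. u E x)" "ess_bounded_broken D (\<lambda>E x. u E x \<bullet> n)" for n
    using linear_brokenD[OF linear_broken_V_h[OF D(1)] u]
      linear_brokenD[OF linear_broken_bounded_linear[OF bounded_linear_inner_left linear_broken_V_h[OF D(1)]] u]
    by auto
  have "integrable (lebesgue_on E) (u E)" if "E \<in> mesh D" for E
    using u'(1) that valid_mesh_elem(5)[OF D(1)]
    by (auto simp: ess_bounded_broken_def intro: ess_bounded_integrable)
  moreover have "linear_broken D (Q_h D) (\<lambda>q E x. k E x * q E x)"
    using linear_broken_scaleR[OF k linear_broken_Q_h[OF D(1)]] by simp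
  ultimately show ?thesis
    unfolding b_u_def
    by (intro linear_functional_on_intros ip_Om_right_data[OF D(1)] ip_face_right[OF D(1)]
        subspace_Q_h fam ess_bounded_face_avg[OF D(1)] linear_face_jump[OF D(1)] u')
qed

lemma b_u_linear:
  assumes "u \<in> V_h D"
  shows "linear_functional_on (Q_h D) (\<lambda>q. b_u D (S_w D Po Pw) u q)"
    and "linear_functional_on (Q_h D) (\<lambda>q. b_u D (\<lambda>E x. 1 - S_w D Po Pw E x) u q)"
proof -
  have "\<exists>G. ess_bounded (lebesgue_on E) G \<and> (AE x in lebesgue_on E. GDERIV (S_w D Po Pw E) x :> G x)"
    if "E \<in> mesh D" for E
    using S_w_gradient[OF D that P] by metis
  then obtain G where G: "\<And>E. E \<in> mesh D \<Longrightarrow> ess_bounded (lebesgue_on E) (G E)"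
      "\<And>E. E \<in> mesh D \<Longrightarrow> AE x in lebesgue_on E. GDERIV (S_w D Po Pw E) x :> G E x"
    by metis
  show "linear_functional_on (Q_h D) (\<lambda>q. b_u D (S_w D Po Pw) u q)"
    by (rule b_u_linear_gradient[OF ess_bounded_broken_S_w assms G])
  show "linear_functional_on (Q_h D) (\<lambda>q. b_u D (\<lambda>E x. 1 - S_w D Po Pw E x) u q)"
  proof (rule b_u_linear_gradient[OF _ assms])
    show "ess_bounded_broken D (\<lambda>E x. 1 - S_w D Po Pw E x)"
      by (intro ess_bounded_broken_diff ess_bounded_broken_const ess_bounded_broken_S_w)
    show "ess_bounded (lebesgue_on E) (\<lambda>x. 0 - G E x)" if "E \<in> mesh D" for E
      using that by (intro ess_bounded_diff ess_bounded_const G)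
    show "AE x in lebesgue_on E. GDERIV (\<lambda>x. 1 - S_w D Po Pw E x) x :> 0 - G E x" if "E \<in> mesh D" for E
      using G(2)[OF that] by eventually_elim (rule GDERIV_diff[OF GDERIV_const])
  qed
qed

text \<open>The pressures are arbitrary discrete functions: at this substep they are not yet part of
  a solution, so no sign condition is at hand. The bounded gradient of the truncated saturation
  suffices.\<close>

lemma b_p_linear: "linear_functional_on (V_h D) (\<lambda>v. b_p D (p_tot D Po Pw) v)"
proof -
  have grad: "integrable (lebesgue_on E) (bgrad (p_tot D Po Pw) E)" if E: "E \<in> mesh D" for E
  proof -
    interpret complete_measure "lebesgue_on E" by (rule valid_mesh_elem(6)[OF D(1) E])
    obtain G where G: "ess_bounded (lebesgue_on E) G"
        "AE x in lebesgue_on E. GDERIV (S_w D Po Pw E) x :> G x"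
      using S_w_gradient[OF D E P] .
    obtain a b where o: "Po E = (\<lambda>x. a + b \<bullet> x)"
      using Q_h_affine[OF P(1) E] .
    obtain c d where w: "Pw E = (\<lambda>x. c + d \<bullet> x)"
      using Q_h_affine[OF P(2) E] .
    let ?S = "S_w D Po Pw E"
    let ?g = "\<lambda>x. (?S x *\<^sub>R d + Pw E x *\<^sub>R G x) + ((1 - ?S x) *\<^sub>R b + Po E x *\<^sub>R (0 - G x))"
    have "ess_bounded (lebesgue_on E) ?g"
      using linear_brokenD[OF linear_broken_Q_h[OF D(1)] P(1)] E ess_bounded_broken_S_w
        linear_brokenD[OF linear_broken_Q_h[OF D(1)] P(2)]
      by (intro ess_bounded_add ess_bounded_scaleR ess_bounded_diff G(1) ess_bounded_const)
        (auto simp: ess_bounded_broken_def)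
    moreover have "AE x in lebesgue_on E. ?g x = bgrad (p_tot D Po Pw) E x"
      using G(2)
    proof eventually_elim
      case (elim x)
      have "GDERIV (\<lambda>x. ?S x * (c + d \<bullet> x) + (1 - ?S x) * (a + b \<bullet> x)) x :>
          (?S x *\<^sub>R d + (c + d \<bullet> x) *\<^sub>R G x) + ((1 - ?S x) *\<^sub>R b + (a + b \<bullet> x) *\<^sub>R (0 - G x))"
        by (intro GDERIV_add GDERIV_mult GDERIV_diff GDERIV_const GDERIV_affine elim)
      then show ?case
        unfolding bgrad_def p_tot_def o w by (simp only: GDERIV_imp_grad)
    qed
    ultimately have "ess_bounded (lebesgue_on E) (bgrad (p_tot D Po Pw) E)"
      by (rule ess_bounded_AE_cong)
    then show ?thesis
      using valid_mesh_elem(5)[OF D(1) E] by (rule ess_bounded_integrable[rotated])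
  qed
  have p: "ess_bounded_broken D (p_tot D Po Pw)"
    unfolding p_tot_def[abs_def]
    by (intro ess_bounded_broken_add ess_bounded_broken_mult ess_bounded_broken_diff
        ess_bounded_broken_const ess_bounded_broken_S_w
        linear_brokenD[OF linear_broken_Q_h[OF D(1)]] P)
  have vol: "linear_family (V_h D) (lebesgue_on E) (\<lambda>v. v E)" if "E \<in> mesh D" for E
    using linear_broken_V_h[OF D(1)] that by (simp add: linear_broken_def)
  show ?thesis
    unfolding b_p_def
    by (intro linear_functional_on_intros ip_Om_right_data[OF D(1)] ip_face_right[OF D(1)]
        subspace_V_h grad vol linear_face_avg[OF D(1)] ess_bounded_face_jump[OF D(1)] p UnI1
        linear_broken_bounded_linear[OF bounded_linear_inner_left linear_broken_V_h[OF D(1)]])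
qed

end

section \<open>Solvability of one time level\<close>

lemma ip_Om_commute: "ip_Om D f g = ip_Om D g f"
  by (simp add: ip_Om_def ip_elem_def inner_commute)

lemma ip_face_nonneg: "0 \<le> ip_face e f f"
  by (simp add: ip_face_def)

lemma ip_Om_nonneg: "0 \<le> ip_Om D f f"
  by (simp add: ip_Om_def ip_elem_def sum_nonneg)

lemma ip_Om_weighted_nonneg:
  fixes q :: "real broken"
  assumes "valid_mesh D" "\<And>E x. E \<in> mesh D \<Longrightarrow> x \<in> E \<inter> Om D \<Longrightarrow> 0 \<le> C E x"
  shows "0 \<le> ip_Om D (\<lambda>E x. C E x * q E x) q"
  unfolding ip_Om_def ip_elem_def
proof (intro sum_nonneg integral_nonneg_AE)
  fix E assume E: "E \<in> mesh D"
  show "AE x in lebesgue_on E. 0 \<le> (C E x * q E x) \<bullet> q E x"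
    using AE_elem_in_Om[OF assms(1) E] AE_space
    by eventually_elim (use assms(2)[OF E] in \<open>auto simp: mult.assoc\<close>)
qed

text \<open>A vanishing sum of nonnegative terms vanishes termwise. Integrability excludes that an
  integral is 0 merely by default.\<close>

lemma ip_Om_zero_AE:
  assumes "valid_mesh D" "ess_bounded_broken D f" "ip_Om D f f = 0" "E \<in> mesh D"
  shows "AE x in lebesgue_on E. f E x = 0"
proof -
  have f: "ess_bounded (lebesgue_on E) (f E)"
    using assms(2,4) by (simp add: ess_bounded_broken_def)
  have "ip_elem E (f E) (f E) = 0"
    using assms(3,4) finite_mesh[OF assms(1)] unfolding ip_Om_def
    by (subst (asm) sum_nonneg_eq_0_iff) (auto simp: ip_elem_def)
  moreover have "integrable (lebesgue_on E) (\<lambda>x. f E x \<bullet> f E x)"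
    using f valid_mesh_elem(5)[OF assms(1,4)]
    by (intro integrable_inner_ess_bounded ess_bounded_integrable)
  ultimately have "AE x in lebesgue_on E. f E x \<bullet> f E x = 0"
    unfolding ip_elem_def by (subst (asm) integral_nonneg_eq_0_iff_AE) auto
  then show ?thesis by simp
qed

text \<open>A nontrivial affine function vanishes at most on a plane, which is negligible, whereas
  the element is not.\<close>

lemma affine_AE_zero:
  assumes "valid_mesh D" "E \<in> mesh D" "AE x in lebesgue_on E. a + b \<bullet> x = 0"
  shows "a = 0 \<and> b = 0"
proof (rule ccontr)
  assume "\<not> (a = 0 \<and> b = 0)"
  then have "negligible {x. b \<bullet> x = - a}"
    by (intro negligible_hyperplane) auto
  then have "AE x in lebesgue_on E. b \<bullet> x \<noteq> - a"
    by (rule AE_lebesgue_on_negligible[OF valid_mesh_elem(3)[OF assms(1,2)]]) auto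
  with assms(3) have "AE x in lebesgue_on E. False"
    by eventually_elim auto
  then show False
    using AE_elem_ex[OF assms(1,2)] by blast
qed

lemma Q_h_AE_zero:
  assumes "valid_mesh D" "q \<in> Q_h D" "\<And>E. E \<in> mesh D \<Longrightarrow> AE x in lebesgue_on E. q E x = 0"
  shows "q = 0"
proof (intro ext)
  fix E x
  show "q E x = 0 E x"
  proof (cases "E \<in> mesh D")
    case True
    then obtain a b where "q E = (\<lambda>x. a + b \<bullet> x)"
      using Q_h_affine[OF assms(2)] by metis
    with affine_AE_zero[OF assms(1) True, of a b] assms(3)[OF True] show ?thesis
      by simp
  qed (use assms(2) in \<open>simp add: Q_h_def\<close>)
qed

lemma ip_Om_definite_Q_h:
  assumes "valid_mesh D" "q \<in> Q_h D" "ip_Om D q q = 0"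
  shows "q = 0"
  using Q_h_AE_zero[OF assms(1,2)]
    ip_Om_zero_AE[OF assms(1) linear_brokenD[OF linear_broken_Q_h[OF assms(1)] assms(2)] assms(3)]
  by blast

lemma ip_Om_definite_V_h:
  assumes "valid_mesh D" "v \<in> V_h D" "ip_Om D v v = 0"
  shows "v = 0"
proof -
  have ae: "AE x in lebesgue_on E. v E x = 0" if "E \<in> mesh D" for E
    by (rule ip_Om_zero_AE[OF assms(1) linear_brokenD[OF linear_broken_V_h[OF assms(1)] assms(2)] assms(3) that])
  have "(\<lambda>E x. v E x $ i) = 0" for i
  proof (rule Q_h_AE_zero[OF assms(1) V_hD[OF assms(2)]])
    show "AE x in lebesgue_on E. v E x $ i = 0" if "E \<in> mesh D" for E
      using ae[OF that] by eventually_elim simp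
  qed
  then show ?thesis
    by (simp add: fun_eq_iff vec_eq_iff)
qed

lemma coercive_definite:
  assumes "coercive V N B" "v \<in> V"
  shows "0 \<le> B v v" "B v v = 0 \<Longrightarrow> N v = 0"
proof -
  obtain \<kappa> where k: "\<kappa> > 0" "\<kappa> * (N v)\<^sup>2 \<le> B v v"
    using assms by (auto simp: coercive_def)
  have "0 \<le> \<kappa> * (N v)\<^sup>2" using k(1) by simp
  with k show "0 \<le> B v v" by linarith
  assume "B v v = 0"
  with k show "N v = 0"
    by (simp add: mult_le_0_iff)
qed

text \<open>
  In the nonsymmetric case the two consistency terms cancel on the diagonal, so no lower bound on the
  penalty parameter is needed; pointwise positivity of the coefficient suffices because the gradients
  are constant on each element.
\<close>

lemma a_form_definite_nonsymmetric:
  assumes D: "valid_mesh D" "0 < sigma_p D" "eps_p D = 1"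
    and k: "ess_bounded_broken D k" "\<And>E x. E \<in> mesh D \<Longrightarrow> x \<in> E \<Longrightarrow> 0 < k E x"
    and q: "q \<in> Q_h D"
  shows "0 \<le> a_form D k q q" "a_form D k q q = 0 \<Longrightarrow> dg_norm_p D q = 0"
proof -
  define J where "J = (\<Sum>e\<in>faces_p D. 1 / h_face e * ip_face e (jump D e q) (jump D e q))"
  define V where "V = ip_Om D (\<lambda>E x. k E x *\<^sub>R bgrad q E x) (bgrad q)"
  have a: "a_form D k q q = V + sigma_p D * J"
    by (simp add: a_form_def D(3) V_def J_def sum_distrib_left)
  have "0 \<le> h_face e" if "e \<in> faces_p D" for e
  proof -
    have "compact e"
      using that faces_subset(1)[OF D(1)] by (intro face_geometry(2)[OF D(1)]) blast
    then show ?thesis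
      unfolding h_face_def by (simp add: diameter_ge_0 compact_imp_bounded)
  qed
  then have J: "0 \<le> J"
    unfolding J_def by (intro sum_nonneg mult_nonneg_nonneg ip_face_nonneg) auto
  have nn: "AE x in lebesgue_on E. 0 \<le> k E x *\<^sub>R bgrad q E x \<bullet> bgrad q E x" if "E \<in> mesh D" for E
    using AE_space by eventually_elim (use k(2)[OF that] in \<open>auto simp: less_imp_le\<close>)
  then have ip: "0 \<le> ip_elem E (\<lambda>x. k E x *\<^sub>R bgrad q E x) (bgrad q E)" if "E \<in> mesh D" for E
    unfolding ip_elem_def using that by (intro integral_nonneg_AE)
  then have V: "0 \<le> V"
    unfolding V_def ip_Om_def by (rule sum_nonneg)
  show "0 \<le> a_form D k q q"
    using V J D(2) by (simp add: a)
  assume "a_form D k q q = 0"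
  moreover have "0 \<le> sigma_p D * J"
    using J D(2) by simp
  ultimately have "V = 0" "sigma_p D * J = 0"
    using V a by linarith+
  then have "J = 0" using D(2) by simp
  have "bgrad q E x = 0" if E: "E \<in> mesh D" for E x
  proof -
    obtain a b where "q E = (\<lambda>x. a + b \<bullet> x)"
      using Q_h_affine[OF q E] .
    then have b: "bgrad q E = (\<lambda>x. b)"
      by (simp add: bgrad_affine fun_eq_iff)
    have "ip_elem E (\<lambda>x. k E x *\<^sub>R bgrad q E x) (bgrad q E) = 0"
      using \<open>V = 0\<close> E ip finite_mesh[OF D(1)] unfolding V_def ip_Om_def
      by (subst (asm) sum_nonneg_eq_0_iff) auto
    moreover have "integrable (lebesgue_on E) (\<lambda>x. k E x *\<^sub>R bgrad q E x \<bullet> bgrad q E x)"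
      using k(1) E valid_mesh_elem(5)[OF D(1) E] unfolding b
      by (intro integrable_inner_ess_bounded ess_bounded_integrable ess_bounded_scaleR ess_bounded_const)
        (auto simp: ess_bounded_broken_def)
    ultimately have "AE x in lebesgue_on E. k E x *\<^sub>R bgrad q E x \<bullet> bgrad q E x = 0"
      using nn[OF E] unfolding ip_elem_def by (subst (asm) integral_nonneg_eq_0_iff_AE)
    then obtain y where "y \<in> E" "k E y *\<^sub>R bgrad q E y \<bullet> bgrad q E y = 0"
      using AE_elem_ex[OF D(1) E] by blast
    then show ?thesis
      using k(2)[OF E, of y] b by simp
  qed
  then have "ip_Om D (bgrad q) (bgrad q) = 0"
    by (simp add: ip_Om_def ip_elem_def)
  then show "dg_norm_p D q = 0"
    using \<open>J = 0\<close> by (simp add: dg_norm_p_def J_def)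
qed

text \<open>Either sign of \<open>eps_p\<close> gives that a zero diagonal value forces a zero DG
  norm: through cancellation for 1, through coercivity for -1. Definiteness of the DG norm
  concludes.\<close>

lemma a_form_definite:
  assumes D: "valid_mesh D" "valid_data D" "dg_norms_definite D"
    and k: "ess_bounded_broken D k" "\<And>E x. E \<in> mesh D \<Longrightarrow> x \<in> E \<Longrightarrow> 0 < k E x"
    and c: "eps_p D = -1 \<Longrightarrow> coercive (Q_h D) (dg_norm_p D) (a_form D k)"
    and q: "q \<in> Q_h D"
  shows "0 \<le> a_form D k q q" "a_form D k q q = 0 \<Longrightarrow> q = 0"
proof -
  have "0 \<le> a_form D k q q \<and> (a_form D k q q = 0 \<longrightarrow> dg_norm_p D q = 0)"
  proof (cases "eps_p D = 1")
    case True
    from a_form_definite_nonsymmetric[OF D(1) valid_dataD(8)[OF D(2)] True k q] show ?thesis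
      by blast
  next
    case False
    then have "eps_p D = -1"
      using valid_dataD(7)[OF D(2)] by auto
    from coercive_definite[OF c[OF this] q] show ?thesis by blast
  qed
  then show "0 \<le> a_form D k q q" "a_form D k q q = 0 \<Longrightarrow> q = 0"
    using D(3) q by (auto simp: dg_norms_definite_def zero_fun_def)
qed

lemma diffq_eq: "diffq dt f g = (1 / dt) *\<^sub>R (f - g)"
  by (simp add: fun_eq_iff diffq_def)

lemma diffq_subspace: "subspace V \<Longrightarrow> f \<in> V \<Longrightarrow> g \<in> V \<Longrightarrow> diffq dt f g \<in> V"
  by (simp add: diffq_eq subspace_scale subspace_diff)

lemma linear_functional_on_diffq:
  "subspace V \<Longrightarrow> linear_functional_on V L \<Longrightarrow> f \<in> V \<Longrightarrow> g \<in> V \<Longrightarrow>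
    L (diffq dt f g) = 1 / dt * L f - 1 / dt * L g"
  by (simp add: diffq_eq linear_functional_onD(2) subspace_diff linear_functional_on_diff right_diff_distrib)

text \<open>The later pressure equations put two rate terms into one inner product; separating known
  from unknown ones needs both integrable.\<close>

lemma ip_Om_add_left:
  fixes q :: "real broken"
  assumes "valid_mesh D" "q \<in> Q_h D"
    and "\<And>E. E \<in> mesh D \<Longrightarrow> ess_bounded (lebesgue_on E) (f E)"
    and "\<And>E. E \<in> mesh D \<Longrightarrow> ess_bounded (lebesgue_on E) (g E)"
  shows "ip_Om D (\<lambda>E x. f E x + g E x) q = ip_Om D f q + ip_Om D g q"
proof -
  have "ip_elem E (\<lambda>x. f E x + g E x) (q E) = ip_elem E (f E) (q E) + ip_elem E (g E) (q E)"
    if E: "E \<in> mesh D" for E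
  proof -
    have "ess_bounded (lebesgue_on E) (q E)"
      using linear_brokenD[OF linear_broken_Q_h[OF assms(1)] assms(2)] E
      by (simp add: ess_bounded_broken_def)
    then have "integrable (lebesgue_on E) (\<lambda>x. f E x \<bullet> q E x)"
        "integrable (lebesgue_on E) (\<lambda>x. g E x \<bullet> q E x)"
      using assms(3,4)[OF E] valid_mesh_elem(5)[OF assms(1) E]
      by (blast intro: integrable_inner_ess_bounded ess_bounded_integrable)+
    then show ?thesis
      unfolding ip_elem_def inner_add_left by (rule Bochner_Integration.integral_add)
  qed
  then show ?thesis
    by (simp add: ip_Om_def sum.distrib)
qed

context
  fixes D :: biot
  assumes mesh: "valid_mesh D"
begin

lemma ess_bounded_Q_h: "q \<in> Q_h D \<Longrightarrow> E \<in> mesh D \<Longrightarrow> ess_bounded (lebesgue_on E) (q E)"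
  using linear_brokenD[OF linear_broken_Q_h[OF mesh]] by (auto simp: ess_bounded_broken_def)

lemma linear_family_Q_h_vol: "E \<in> mesh D \<Longrightarrow> linear_family (Q_h D) (lebesgue_on E) (\<lambda>q. q E)"
  using linear_broken_Q_h[OF mesh] by (simp add: linear_broken_def)

lemma ip_Om_weighted_linear:
  assumes C: "\<And>E. E \<in> mesh D \<Longrightarrow> ess_bounded (lebesgue_on E) (C E)" and p: "p \<in> Q_h D"
  shows "linear_functional_on (Q_h D) (\<lambda>q. ip_Om D (\<lambda>E x. C E x * p E x) q)"
    and "linear_functional_on (Q_h D) (\<lambda>q. ip_Om D (\<lambda>E x. C E x * q E x) p)"
proof -
  show "linear_functional_on (Q_h D) (\<lambda>q. ip_Om D (\<lambda>E x. C E x * p E x) q)"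
    by (intro ip_Om_right_data[OF mesh] subspace_Q_h linear_family_Q_h_vol ess_bounded_integrable
        valid_mesh_elem(5)[OF mesh] ess_bounded_mult C ess_bounded_Q_h p)
  have "linear_functional_on (Q_h D) (\<lambda>q. ip_Om D p (\<lambda>E x. C E x * q E x))"
    by (intro ip_Om_right_data[OF mesh] subspace_Q_h linear_family_mult linear_family_Q_h_vol
        ess_bounded_integrable valid_mesh_elem(5)[OF mesh] C ess_bounded_Q_h p)
  then show "linear_functional_on (Q_h D) (\<lambda>q. ip_Om D (\<lambda>E x. C E x * q E x) p)"
    by (simp add: ip_Om_commute[of D p])
qed

lemma projection_Q_h_ex1:
  assumes "L2_vol (Om D) f"
  shows "\<exists>!p. p \<in> Q_h D \<and> (\<forall>q\<in>Q_h D. ip_Om D p q = ip_Om D (\<lambda>E. f) q)"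
proof -
  obtain S where S: "finite S" "Q_h D \<subseteq> span S"
    using Q_h_finite_span[OF finite_mesh[OF mesh]] .
  show ?thesis
  proof (rule linear_problem_ex1[OF subspace_Q_h S])
    fix p assume p: "p \<in> Q_h D"
    note b = linear_brokenD[OF linear_broken_Q_h[OF mesh] p]
    show "linear_functional_on (Q_h D) (\<lambda>u. ip_Om D u p)" "linear_functional_on (Q_h D) (ip_Om D p)"
      using ip_Om_left[OF mesh subspace_Q_h b linear_broken_Q_h[OF mesh]]
        ip_Om_right[OF mesh subspace_Q_h b linear_broken_Q_h[OF mesh]] by simp_all
    show "ip_Om D p p = 0 \<Longrightarrow> p = 0"
      by (rule ip_Om_definite_Q_h[OF mesh p])
  next
    show "linear_functional_on (Q_h D) (ip_Om D (\<lambda>E. f))"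
      by (intro ip_Om_right_data[OF mesh] subspace_Q_h linear_family_Q_h_vol
          integrable_elem_data[OF mesh _ assms])
  qed
qed

lemma projection_V_h_ex1:
  assumes "L2_vol (Om D) f"
  shows "\<exists>!u. u \<in> V_h D \<and> (\<forall>v\<in>V_h D. ip_Om D u v = ip_Om D (\<lambda>E. f) v)"
proof -
  obtain S where S: "finite S" "V_h D \<subseteq> span S"
    using V_h_finite_span[OF finite_mesh[OF mesh]] .
  show ?thesis
  proof (rule linear_problem_ex1[OF subspace_V_h S])
    fix u assume u: "u \<in> V_h D"
    note b = linear_brokenD[OF linear_broken_V_h[OF mesh] u]
    show "linear_functional_on (V_h D) (\<lambda>v. ip_Om D v u)" "linear_functional_on (V_h D) (ip_Om D u)"
      using ip_Om_left[OF mesh subspace_V_h b linear_broken_V_h[OF mesh]]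
        ip_Om_right[OF mesh subspace_V_h b linear_broken_V_h[OF mesh]] by simp_all
    show "ip_Om D u u = 0 \<Longrightarrow> u = 0"
      by (rule ip_Om_definite_V_h[OF mesh u])
  next
    have "linear_family (V_h D) (lebesgue_on E) (\<lambda>v. v E)" if "E \<in> mesh D" for E
      using linear_broken_V_h[OF mesh] that by (simp add: linear_broken_def)
    then show "linear_functional_on (V_h D) (ip_Om D (\<lambda>E. f))"
      by (intro ip_Om_right_data[OF mesh] subspace_V_h integrable_elem_data[OF mesh _ assms])
  qed
qed

text \<open>Serves both phases at every level: \<open>C\<close> is \<open>C1\<close> or
  \<open>C3\<close>, and \<open>L\<close> collects all terms known by then. The mass term and
  \<open>a_form\<close> are both nonnegative on the diagonal, so if their sum is 0 then so is
  \<open>a_form\<close>.\<close>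

lemma pressure_ex1:
  assumes C: "\<And>E. E \<in> mesh D \<Longrightarrow> ess_bounded (lebesgue_on E) (C E)"
      "\<And>E x. E \<in> mesh D \<Longrightarrow> x \<in> E \<inter> Om D \<Longrightarrow> 0 \<le> C E x"
    and k: "ess_bounded_broken D k"
    and a: "\<And>q. q \<in> Q_h D \<Longrightarrow> 0 \<le> a_form D k q q"
      "\<And>q. q \<in> Q_h D \<Longrightarrow> a_form D k q q = 0 \<Longrightarrow> q = 0"
    and dt: "0 < dt" and p0: "p0 \<in> Q_h D" and L: "linear_functional_on (Q_h D) L"
  shows "\<exists>!p. p \<in> Q_h D \<and>
    (\<forall>q\<in>Q_h D. ip_Om D (\<lambda>E x. C E x * diffq dt p p0 E x) q + a_form D k p q = L q)"
proof -
  obtain S where S: "finite S" "Q_h D \<subseteq> span S"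
    using Q_h_finite_span[OF finite_mesh[OF mesh]] .
  define B where "B p q = 1 / dt * ip_Om D (\<lambda>E x. C E x * p E x) q + a_form D k p q" for p q
  \<comment> \<open>The contribution of the previous level to the difference quotient moves to the
    right-hand side.\<close>
  define R where "R q = L q + 1 / dt * ip_Om D (\<lambda>E x. C E x * p0 E x) q" for q
  have "\<exists>!p. p \<in> Q_h D \<and> (\<forall>q\<in>Q_h D. B p q = R q)"
  proof (rule linear_problem_ex1[OF subspace_Q_h S])
    fix p assume p: "p \<in> Q_h D"
    show "linear_functional_on (Q_h D) (\<lambda>u. B u p)" "linear_functional_on (Q_h D) (B p)"
      unfolding B_def[abs_def]
      by (rule linear_functional_on_add[OF linear_functional_on_cmult[OF ip_Om_weighted_linear(2)[OF C(1) p]]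
            a_form_linear(2)[OF mesh k p]],
          assumption?)
        (rule linear_functional_on_add[OF linear_functional_on_cmult[OF ip_Om_weighted_linear(1)[OF C(1) p]]
            a_form_linear(1)[OF mesh k p]],
          assumption?)
    assume "B p p = 0"
    moreover have "0 \<le> 1 / dt * ip_Om D (\<lambda>E x. C E x * p E x) p"
      using dt by (intro mult_nonneg_nonneg ip_Om_weighted_nonneg[OF mesh C(2)]) auto
    ultimately have "a_form D k p p = 0"
      using a(1)[OF p] unfolding B_def by linarith
    then show "p = 0" by (rule a(2)[OF p])
  next
    show "linear_functional_on (Q_h D) R"
      unfolding R_def[abs_def]
      by (intro linear_functional_on_intros L ip_Om_weighted_linear C(1) p0)
  qed
  moreover have "(ip_Om D (\<lambda>E x. C E x * diffq dt p p0 E x) q + a_form D k p q = L q) \<longleftrightarrow> B p q = R q"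
    if "p \<in> Q_h D" "q \<in> Q_h D" for p q
  proof -
    have "ip_Om D (\<lambda>E x. C E x * diffq dt p p0 E x) q
        = 1 / dt * ip_Om D (\<lambda>E x. C E x * p E x) q - 1 / dt * ip_Om D (\<lambda>E x. C E x * p0 E x) q"
      by (rule linear_functional_on_diffq[OF subspace_Q_h ip_Om_weighted_linear(2)[OF C(1) that(2)] that(1) p0])
    then show ?thesis
      unfolding B_def R_def by linarith
  qed
  ultimately show ?thesis by (simp cong: conj_cong)
qed

text \<open>The stabilization adds a nonnegative multiple of the squared norm to a coercive form.
  The value \<open>g = 0\<close> covers the first level, \<open>g = gam D\<close> the later
  ones.\<close>

lemma displacement_ex1:
  assumes c: "coercive (V_h D) (dg_norm_u D) (c_form D)" and def: "dg_norms_definite D"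
    and g: "0 \<le> g" and dt: "0 < dt" and u0: "u0 \<in> V_h D" and L: "linear_functional_on (V_h D) L"
  shows "\<exists>!u. u \<in> V_h D \<and> (\<forall>v\<in>V_h D. c_form D u v + g * ip_Om D (diffq dt u u0) v = L v)"
proof -
  obtain S where S: "finite S" "V_h D \<subseteq> span S"
    using V_h_finite_span[OF finite_mesh[OF mesh]] .
  have ip: "linear_functional_on (V_h D) (\<lambda>v. ip_Om D u v)" "linear_functional_on (V_h D) (\<lambda>v. ip_Om D v u)"
    if "u \<in> V_h D" for u
    using ip_Om_left[OF mesh subspace_V_h linear_brokenD[OF linear_broken_V_h[OF mesh] that] linear_broken_V_h[OF mesh]]
      ip_Om_right[OF mesh subspace_V_h linear_brokenD[OF linear_broken_V_h[OF mesh] that] linear_broken_V_h[OF mesh]]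
    by simp_all
  define B where "B u v = c_form D u v + g * (1 / dt * ip_Om D u v)" for u v
  define R where "R v = L v + g * (1 / dt * ip_Om D u0 v)" for v
  have "\<exists>!u. u \<in> V_h D \<and> (\<forall>v\<in>V_h D. B u v = R v)"
  proof (rule linear_problem_ex1[OF subspace_V_h S])
    fix u assume u: "u \<in> V_h D"
    show "linear_functional_on (V_h D) (\<lambda>v. B v u)" "linear_functional_on (V_h D) (B u)"
      unfolding B_def[abs_def]
      by (intro linear_functional_on_intros ip c_form_linear[OF mesh] u)+
    assume "B u u = 0"
    moreover have "0 \<le> g * (1 / dt * ip_Om D u u)"
      using dt g by (intro mult_nonneg_nonneg ip_Om_nonneg) auto
    ultimately have "c_form D u u = 0"
      using coercive_definite(1)[OF c u] unfolding B_def by linarith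
    then have "dg_norm_u D u = 0"
      by (rule coercive_definite(2)[OF c u])
    then show "u = 0"
      using def u by (simp add: dg_norms_definite_def zero_fun_def)
  next
    show "linear_functional_on (V_h D) R"
      unfolding R_def[abs_def] by (intro linear_functional_on_intros L ip u0)
  qed
  moreover have "(c_form D u v + g * ip_Om D (diffq dt u u0) v = L v) \<longleftrightarrow> B u v = R v"
    if "u \<in> V_h D" "v \<in> V_h D" for u v
  proof -
    have "ip_Om D (diffq dt u u0) v = 1 / dt * ip_Om D u v - 1 / dt * ip_Om D u0 v"
      by (rule linear_functional_on_diffq[OF subspace_V_h ip(2)[OF that(2)] that(1) u0])
    then have "g * ip_Om D (diffq dt u u0) v = g * (1 / dt * ip_Om D u v) - g * (1 / dt * ip_Om D u0 v)"
      by (simp only: right_diff_distrib)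
    then show ?thesis
      unfolding B_def R_def by linarith
  qed
  ultimately show ?thesis by (simp cong: conj_cong)
qed

end

text \<open>The logic of a sequential scheme: each unknown is determined uniquely once the preceding
  ones are fixed.\<close>

lemma ex1_triple:
  assumes "\<exists>!x. P x" "\<And>x. P x \<Longrightarrow> \<exists>!y. Q x y" "\<And>x y. P x \<Longrightarrow> Q x y \<Longrightarrow> \<exists>!z. R x y z"
  shows "\<exists>!(x, y, z). P x \<and> Q x y \<and> R x y z"
proof -
  obtain x where x: "P x" "\<And>x'. P x' \<Longrightarrow> x' = x" using assms(1) by blast
  obtain y where y: "Q x y" "\<And>y'. Q x y' \<Longrightarrow> y' = y" using assms(2)[OF x(1)] by blast
  obtain z where z: "R x y z" "\<And>z'. R x y z' \<Longrightarrow> z' = z" using assms(3)[OF x(1) y(1)] by blast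
  show ?thesis
  proof (rule ex1I[of _ "(x, y, z)"])
    show "case (x, y, z) of (x, y, z) \<Rightarrow> P x \<and> Q x y \<and> R x y z"
      using x(1) y(1) z(1) by simp
    fix t assume t: "case t of (x, y, z) \<Rightarrow> P x \<and> Q x y \<and> R x y z"
    obtain a b c where abc: "t = (a, b, c)" by (cases t)
    have "a = x" using t by (intro x(2)) (simp add: abc)
    moreover from this have "b = y" using t by (intro y(2)) (simp add: abc)
    ultimately have "c = z" using t by (intro z(2)) (simp add: abc)
    with \<open>a = x\<close> \<open>b = y\<close> show "t = (x, y, z)" by (simp add: abc)
  qed
qed

section \<open>The recursion over the time levels\<close>

context
  fixes D :: biot
  assumes mesh: "valid_mesh D" and data: "valid_data D" and si: "standing_i D"
    and sii: "standing_ii D" and dgn: "dg_norms_definite D"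
    and mw: "\<exists>c>0. \<forall>s\<in>{eps D..1 - eps D}. c \<le> mob_w D s"
    and mo: "\<exists>c>0. \<forall>s\<in>{eps D..1 - eps D}. c \<le> mob_o D s"
begin

lemma data_time:
  fixes m :: nat
  defines "t \<equiv> time D (m + 1)"
  shows "L2_vol (Om D) (f_w D t)" "L2_vol (Om D) (f_o D t)" "L2_vol (Om D) (f_u D t)"
    "L2_faces (part_faces D (Gam_pD D)) (p_wD D t)" "L2_faces (part_faces D (Gam_pD D)) (p_oD D t)"
    "L2_faces (part_faces D (Gam_pN D)) (g_w D t)" "L2_faces (part_faces D (Gam_pN D)) (g_o D t)"
    "L2_faces (part_faces D (Gam_uD D)) (u_D D t)" "L2_faces (part_faces D (Gam_uN D)) (g_u D t)"
  using data unfolding valid_data_def Let_def t_def by - (elim conjE allE[where x = m], assumption)+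

lemma rhs_linear:
  assumes "Pw \<in> Q_h D" "Po \<in> Q_h D"
  shows "linear_functional_on (Q_h D) (ell_w D (time D (m + 1)) (S_w D Po Pw))"
    and "linear_functional_on (Q_h D) (ell_o D (time D (m + 1)) (S_w D Po Pw))"
    and "linear_functional_on (V_h D) (ell_u D (time D (m + 1)))"
  unfolding ell_w_def[abs_def] ell_o_def[abs_def]
  by (intro ell_p_linear[OF mesh] ell_u_linear[OF mesh] data_time
      ess_bounded_broken_chi[OF mesh data assms(2,1) mw mo])+

text \<open>Collects what the standing assumptions yield at one level. They are stated for states
  reached by the scheme, whence the premise \<open>dg_solution\<close>.\<close>

lemma coefficients:
  assumes sol: "dg_solution D n (Pw, Po, U)" and P: "Pw \<in> Q_h D" "Po \<in> Q_h D"
  shows "E \<in> mesh D \<Longrightarrow> x \<in> E \<inter> Om D \<Longrightarrow> 0 \<le> C1 D Po Pw E x"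
    and "E \<in> mesh D \<Longrightarrow> x \<in> E \<inter> Om D \<Longrightarrow> 0 \<le> C3 D Po Pw E x"
    and "E \<in> mesh D \<Longrightarrow> ess_bounded (lebesgue_on E) (C1 D Po Pw E)"
    and "E \<in> mesh D \<Longrightarrow> ess_bounded (lebesgue_on E) (C2 D Po Pw E)"
    and "E \<in> mesh D \<Longrightarrow> ess_bounded (lebesgue_on E) (C3 D Po Pw E)"
    and "E \<in> mesh D \<Longrightarrow> ess_bounded (lebesgue_on E) (C4 D Po Pw E)"
    and "q \<in> Q_h D \<Longrightarrow> 0 \<le> a_form D (chi_w D (S_w D Po Pw)) q q"
    and "q \<in> Q_h D \<Longrightarrow> a_form D (chi_w D (S_w D Po Pw)) q q = 0 \<Longrightarrow> q = 0"
    and "q \<in> Q_h D \<Longrightarrow> 0 \<le> a_form D (chi_o D (S_w D Po Pw)) q q"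
    and "q \<in> Q_h D \<Longrightarrow> a_form D (chi_o D (S_w D Po Pw)) q q = 0 \<Longrightarrow> q = 0"
proof -
  have al: "\<forall>x\<in>Om D. 0 \<le> alpha D - poro D x" and sc: "sign_conditions D Po Pw"
    using si sol unfolding standing_i_def by blast+
  show "0 \<le> C1 D Po Pw E x" if "E \<in> mesh D" "x \<in> E \<inter> Om D"
    using sc al that unfolding sign_conditions_def by (intro C1_nonneg[OF data]) auto
  show "0 \<le> C3 D Po Pw E x" if "E \<in> mesh D" "x \<in> E \<inter> Om D"
    using sc that unfolding sign_conditions_def by blast
  note C = ess_bounded_C[OF mesh data _ P(2,1) al sc]
  show "E \<in> mesh D \<Longrightarrow> ess_bounded (lebesgue_on E) (C1 D Po Pw E)"
    "E \<in> mesh D \<Longrightarrow> ess_bounded (lebesgue_on E) (C2 D Po Pw E)"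
    "E \<in> mesh D \<Longrightarrow> ess_bounded (lebesgue_on E) (C3 D Po Pw E)"
    "E \<in> mesh D \<Longrightarrow> ess_bounded (lebesgue_on E) (C4 D Po Pw E)"
    by (fact C)+
  have pos: "0 < k (S_w D Po Pw E x) * perm D E x"
    if lower: "\<exists>c>0. \<forall>s\<in>{eps D..1 - eps D}. c \<le> k s" and E: "E \<in> mesh D" "x \<in> E" for k E x
  proof -
    obtain c where "0 < c" "\<forall>s\<in>{eps D..1 - eps D}. c \<le> k s"
      using lower by blast
    then have "0 < k (S_w D Po Pw E x)"
      using S_w_bounds[OF valid_dataD(3)[OF data], of Po Pw E x] by force
    moreover have "0 < perm D E x"
      using data E by (auto simp: valid_data_def)
    ultimately show ?thesis by simp
  qed
  have "coercive (Q_h D) (dg_norm_p D) (a_form D (chi_w D (S_w D Po Pw)))"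
      "coercive (Q_h D) (dg_norm_p D) (a_form D (chi_o D (S_w D Po Pw)))" if "eps_p D = -1"
    using sii sol that by (auto simp: standing_ii_def)
  note a = a_form_definite[OF mesh data dgn, OF ess_bounded_broken_chi(1)[OF mesh data P(2,1) mw mo] _ this(1)]
    a_form_definite[OF mesh data dgn, OF ess_bounded_broken_chi(2)[OF mesh data P(2,1) mw mo] _ this(2)]
  show "q \<in> Q_h D \<Longrightarrow> 0 \<le> a_form D (chi_w D (S_w D Po Pw)) q q"
    "q \<in> Q_h D \<Longrightarrow> a_form D (chi_w D (S_w D Po Pw)) q q = 0 \<Longrightarrow> q = 0"
    by (rule a(1,2); simp add: chi_w_def pos[OF mw])+
  show "q \<in> Q_h D \<Longrightarrow> 0 \<le> a_form D (chi_o D (S_w D Po Pw)) q q"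
    "q \<in> Q_h D \<Longrightarrow> a_form D (chi_o D (S_w D Po Pw)) q q = 0 \<Longrightarrow> q = 0"
    by (rule a(3,4); simp add: chi_o_def pos[OF mo])+
qed

lemma level0_ex1: "\<exists>!z. z \<in> states D \<and> level0 D z"
proof -
  have "L2_vol (Om D) (p_w0 D)" "L2_vol (Om D) (p_o0 D)" "L2_vol (Om D) (u_0 D)"
    using data by (auto simp: valid_data_def)
  then have "\<exists>!(Pw, Po, U). (Pw \<in> Q_h D \<and> (\<forall>q\<in>Q_h D. ip_Om D Pw q = ip_Om D (\<lambda>E. p_w0 D) q)) \<and>
      (Po \<in> Q_h D \<and> (\<forall>q\<in>Q_h D. ip_Om D Po q = ip_Om D (\<lambda>E. p_o0 D) q)) \<and>
      (U \<in> V_h D \<and> (\<forall>v\<in>V_h D. ip_Om D U v = ip_Om D (\<lambda>E. u_0 D) v))"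
    by (intro ex1_triple projection_Q_h_ex1[OF mesh] projection_V_h_ex1[OF mesh])
  then show ?thesis
    \<comment> \<open>Unique existence is transported along extensional equality of the two
      predicates.\<close>
    by (rule back_subst[of Ex1]) (auto simp: fun_eq_iff states_def)
qed

lemma level1_ex1:
  assumes Z: "Z \<in> states D" "dg_solution D 0 Z"
  shows "\<exists>!z. z \<in> states D \<and> level1 D Z z"
proof -
  obtain Pw0 Po0 U0 where Z0: "Z = (Pw0, Po0, U0)" by (cases Z)
  have st: "Pw0 \<in> Q_h D" "Po0 \<in> Q_h D" "U0 \<in> V_h D"
    using Z(1) by (auto simp: Z0 states_def)
  note co = coefficients[OF Z(2)[unfolded Z0] st(1,2)]
  note chi = ess_bounded_broken_chi[OF mesh data st(2,1) mw mo]
  note dt = valid_dataD(4)[OF data]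
  let ?S = "S_w D Po0 Pw0" and ?t = "time D 1"
  have rhs: "linear_functional_on (Q_h D) (ell_w D ?t ?S)" "linear_functional_on (Q_h D) (ell_o D ?t ?S)"
      "linear_functional_on (V_h D) (ell_u D ?t)"
    using rhs_linear[OF st(1,2), of 0] by simp_all
  \<comment> \<open>The summand with factor 0 in the displacement equation brings it into the shape
    of \<open>displacement_ex1\<close> with \<open>g = 0\<close>.\<close>
  have "\<exists>!(Pw, Po, U). (Pw \<in> Q_h D \<and> (\<forall>q\<in>Q_h D.
        ip_Om D (\<lambda>E x. C1 D Po0 Pw0 E x * diffq (tau0 D) Pw Pw0 E x) q
        + a_form D (chi_w D ?S) Pw q = ell_w D ?t ?S q)) \<and>
      (Po \<in> Q_h D \<and> (\<forall>q\<in>Q_h D.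
        ip_Om D (\<lambda>E x. C3 D Po0 Pw0 E x * diffq (tau0 D) Po Po0 E x) q
        + a_form D (chi_o D ?S) Po q = ell_o D ?t ?S q
          - ip_Om D (\<lambda>E x. C4 D Po0 Pw0 E x * diffq (tau0 D) Pw Pw0 E x) q)) \<and>
      (U \<in> V_h D \<and> (\<forall>v\<in>V_h D. c_form D U v + 0 * ip_Om D (diffq (tau0 D) U U0) v
        = ell_u D ?t v - b_p D (p_tot D Po Pw) v))"
  proof (rule ex1_triple)
    show "\<exists>!Pw. Pw \<in> Q_h D \<and> (\<forall>q\<in>Q_h D.
        ip_Om D (\<lambda>E x. C1 D Po0 Pw0 E x * diffq (tau0 D) Pw Pw0 E x) q
        + a_form D (chi_w D ?S) Pw q = ell_w D ?t ?S q)"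
      by (rule pressure_ex1[OF mesh co(3,1) chi(1) co(7,8) dt st(1) rhs(1)])
  next
    fix Pw assume "Pw \<in> Q_h D \<and> (\<forall>q\<in>Q_h D.
        ip_Om D (\<lambda>E x. C1 D Po0 Pw0 E x * diffq (tau0 D) Pw Pw0 E x) q
        + a_form D (chi_w D ?S) Pw q = ell_w D ?t ?S q)"
    then have "diffq (tau0 D) Pw Pw0 \<in> Q_h D"
      using st by (intro diffq_subspace subspace_Q_h) auto
    then have lin: "linear_functional_on (Q_h D) (\<lambda>q. ell_o D ?t ?S q
        - ip_Om D (\<lambda>E x. C4 D Po0 Pw0 E x * diffq (tau0 D) Pw Pw0 E x) q)"
      by (intro linear_functional_on_minus rhs(2) ip_Om_weighted_linear(1)[OF mesh] co(6))
    show "\<exists>!Po. Po \<in> Q_h D \<and> (\<forall>q\<in>Q_h D.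
        ip_Om D (\<lambda>E x. C3 D Po0 Pw0 E x * diffq (tau0 D) Po Po0 E x) q
        + a_form D (chi_o D ?S) Po q = ell_o D ?t ?S q
          - ip_Om D (\<lambda>E x. C4 D Po0 Pw0 E x * diffq (tau0 D) Pw Pw0 E x) q)"
      by (rule pressure_ex1[OF mesh co(5,2) chi(2) co(9,10) dt st(2) lin])
  next
    fix Pw Po assume "Pw \<in> Q_h D \<and> (\<forall>q\<in>Q_h D.
        ip_Om D (\<lambda>E x. C1 D Po0 Pw0 E x * diffq (tau0 D) Pw Pw0 E x) q
        + a_form D (chi_w D ?S) Pw q = ell_w D ?t ?S q)"
      and "Po \<in> Q_h D \<and> (\<forall>q\<in>Q_h D.
        ip_Om D (\<lambda>E x. C3 D Po0 Pw0 E x * diffq (tau0 D) Po Po0 E x) q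
        + a_form D (chi_o D ?S) Po q = ell_o D ?t ?S q
          - ip_Om D (\<lambda>E x. C4 D Po0 Pw0 E x * diffq (tau0 D) Pw Pw0 E x) q)"
    then have "linear_functional_on (V_h D) (\<lambda>v. ell_u D ?t v - b_p D (p_tot D Po Pw) v)"
      by (intro linear_functional_on_minus rhs(3) b_p_linear[OF mesh data]) auto
    then show "\<exists>!U. U \<in> V_h D \<and> (\<forall>v\<in>V_h D. c_form D U v + 0 * ip_Om D (diffq (tau0 D) U U0) v
        = ell_u D ?t v - b_p D (p_tot D Po Pw) v)"
      using sii by (intro displacement_ex1[OF mesh _ dgn _ dt st(3)]) (auto simp: standing_ii_def)
  qed
  then show ?thesis
    by (rule back_subst[of Ex1]) (auto simp: fun_eq_iff states_def Z0 Let_def)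
qed

text \<open>The coefficients are all evaluated at \<open>Y\<close>, so \<open>Y\<close> has to be
  certified as a solution; \<open>X\<close> enters only through difference quotients on the
  right-hand sides.\<close>

lemma level_step_ex1:
  assumes X: "X \<in> states D" and Y: "Y \<in> states D" "dg_solution D n Y"
  shows "\<exists>!z. z \<in> states D \<and> level_step D n X Y z"
proof -
  obtain Pw0 Po0 U0 where X0: "X = (Pw0, Po0, U0)" by (cases X)
  obtain Pw1 Po1 U1 where Y0: "Y = (Pw1, Po1, U1)" by (cases Y)
  have st0: "Pw0 \<in> Q_h D" "Po0 \<in> Q_h D" "U0 \<in> V_h D"
    using X by (auto simp: X0 states_def)
  have st: "Pw1 \<in> Q_h D" "Po1 \<in> Q_h D" "U1 \<in> V_h D"
    using Y(1) by (auto simp: Y0 states_def)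
  note co = coefficients[OF Y(2)[unfolded Y0] st(1,2)]
  note chi = ess_bounded_broken_chi[OF mesh data st(2,1) mw mo]
  note dt = valid_dataD(5)[OF data]
  let ?S = "S_w D Po1 Pw1" and ?t = "time D (n + 1)"
  note rhs = rhs_linear[OF st(1,2), of n]
  have dU: "diffq (tau D) U1 U0 \<in> V_h D" and dPo: "diffq (tau D) Po1 Po0 \<in> Q_h D"
    using st st0 by (auto intro: diffq_subspace subspace_V_h subspace_Q_h)
  note bu = b_u_linear[OF mesh data st(2,1) dU]
  \<comment> \<open>The three equations of the step with the current unknown kept on the left and
    everything already computed moved to the right.\<close>
  define eqw where "eqw Pw \<longleftrightarrow> Pw \<in> Q_h D \<and> (\<forall>q\<in>Q_h D.
      ip_Om D (\<lambda>E x. C1 D Po1 Pw1 E x * diffq (tau D) Pw Pw1 E x) q + a_form D (chi_w D ?S) Pw q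
      = ell_w D ?t ?S q - ip_Om D (\<lambda>E x. C2 D Po1 Pw1 E x * diffq (tau D) Po1 Po0 E x) q
        - alpha D * b_u D ?S (diffq (tau D) U1 U0) q)" for Pw
  define eqo where "eqo Pw Po \<longleftrightarrow> Po \<in> Q_h D \<and> (\<forall>q\<in>Q_h D.
      ip_Om D (\<lambda>E x. C3 D Po1 Pw1 E x * diffq (tau D) Po Po1 E x) q + a_form D (chi_o D ?S) Po q
      = ell_o D ?t ?S q - ip_Om D (\<lambda>E x. C4 D Po1 Pw1 E x * diffq (tau D) Pw Pw1 E x) q
        - alpha D * b_u D (\<lambda>E x. 1 - ?S E x) (diffq (tau D) U1 U0) q)" for Pw Po
  define equ where "equ Pw Po U \<longleftrightarrow> U \<in> V_h D \<and> (\<forall>v\<in>V_h D.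
      c_form D U v + gam D * ip_Om D (diffq (tau D) U U1) v
      = ell_u D ?t v - b_p D (p_tot D Po Pw) v + gam D * ip_Om D (diffq (tau D) U1 U0) v)" for Pw Po U
  have "\<exists>!(Pw, Po, U). eqw Pw \<and> eqo Pw Po \<and> equ Pw Po U"
  proof (rule ex1_triple)
    have lin: "linear_functional_on (Q_h D) (\<lambda>q. ell_w D ?t ?S q
        - ip_Om D (\<lambda>E x. C2 D Po1 Pw1 E x * diffq (tau D) Po1 Po0 E x) q
        - alpha D * b_u D ?S (diffq (tau D) U1 U0) q)"
      by (intro linear_functional_on_minus linear_functional_on_cmult rhs(1) bu(1)
          ip_Om_weighted_linear(1)[OF mesh] co(4) dPo)
    show "\<exists>!Pw. eqw Pw"
      unfolding eqw_def by (rule pressure_ex1[OF mesh co(3,1) chi(1) co(7,8) dt st(1) lin])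
  next
    fix Pw assume "eqw Pw"
    then have "diffq (tau D) Pw Pw1 \<in> Q_h D"
      using st by (intro diffq_subspace subspace_Q_h) (auto simp: eqw_def)
    then have lin: "linear_functional_on (Q_h D) (\<lambda>q. ell_o D ?t ?S q
        - ip_Om D (\<lambda>E x. C4 D Po1 Pw1 E x * diffq (tau D) Pw Pw1 E x) q
        - alpha D * b_u D (\<lambda>E x. 1 - ?S E x) (diffq (tau D) U1 U0) q)"
      by (intro linear_functional_on_minus linear_functional_on_cmult rhs(2) bu(2)
          ip_Om_weighted_linear(1)[OF mesh] co(6))
    show "\<exists>!Po. eqo Pw Po"
      unfolding eqo_def by (rule pressure_ex1[OF mesh co(5,2) chi(2) co(9,10) dt st(2) lin])
  next
    fix Pw Po assume "eqw Pw" "eqo Pw Po"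
    then have P: "Po \<in> Q_h D" "Pw \<in> Q_h D"
      by (auto simp: eqw_def eqo_def)
    have "linear_functional_on (V_h D) (\<lambda>v. ip_Om D (diffq (tau D) U1 U0) v)"
      by (rule ip_Om_right[OF mesh subspace_V_h linear_brokenD[OF linear_broken_V_h[OF mesh] dU]
            linear_broken_V_h[OF mesh]])
    then have "linear_functional_on (V_h D) (\<lambda>v. ell_u D ?t v - b_p D (p_tot D Po Pw) v
        + gam D * ip_Om D (diffq (tau D) U1 U0) v)"
      by (intro linear_functional_on_add linear_functional_on_minus linear_functional_on_cmult rhs(3)
          b_p_linear[OF mesh data P])
    then show "\<exists>!U. equ Pw Po U"
      unfolding equ_def using sii valid_dataD(6)[OF data]
      by (intro displacement_ex1[OF mesh _ dgn _ dt st(3)]) (auto simp: standing_ii_def)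
  qed
  \<comment> \<open>Rearranging the equations splits inner products of sums, which is legitimate
    because all coefficients and rates are essentially bounded.\<close>
  moreover have "(case z of (Pw, Po, U) \<Rightarrow> eqw Pw \<and> eqo Pw Po \<and> equ Pw Po U) \<longleftrightarrow>
      z \<in> states D \<and> level_step D n X Y z" for z
  proof -
    obtain Pw Po U where z: "z = (Pw, Po, U)" by (cases z)
    have bdd: "ess_bounded (lebesgue_on E) (\<lambda>x. C E x * diffq (tau D) p p' E x)"
      if "p \<in> Q_h D" "p' \<in> Q_h D" "E \<in> mesh D" "ess_bounded (lebesgue_on E) (C E)" for C p p' E
      by (rule ess_bounded_mult[OF that(4)
            ess_bounded_Q_h[OF mesh diffq_subspace[OF subspace_Q_h that(1,2)] that(3)]])
    have w: "ip_Om D (\<lambda>E x. C1 D Po1 Pw1 E x * diffq (tau D) Pw Pw1 E x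
          + C2 D Po1 Pw1 E x * diffq (tau D) Po1 Po0 E x) q
        = ip_Om D (\<lambda>E x. C1 D Po1 Pw1 E x * diffq (tau D) Pw Pw1 E x) q
          + ip_Om D (\<lambda>E x. C2 D Po1 Pw1 E x * diffq (tau D) Po1 Po0 E x) q"
      if "Pw \<in> Q_h D" "q \<in> Q_h D" for q
      by (intro ip_Om_add_left[OF mesh] bdd co st st0 that)
    have o: "ip_Om D (\<lambda>E x. C3 D Po1 Pw1 E x * diffq (tau D) Po Po1 E x
          + C4 D Po1 Pw1 E x * diffq (tau D) Pw Pw1 E x) q
        = ip_Om D (\<lambda>E x. C3 D Po1 Pw1 E x * diffq (tau D) Po Po1 E x) q
          + ip_Om D (\<lambda>E x. C4 D Po1 Pw1 E x * diffq (tau D) Pw Pw1 E x) q"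
      if "Pw \<in> Q_h D" "Po \<in> Q_h D" "q \<in> Q_h D" for q
      by (intro ip_Om_add_left[OF mesh] bdd co st st0 that)
    show ?thesis
      unfolding z X0 Y0 prod.case level_step.simps Let_def states_def mem_Times_iff fst_conv snd_conv
        eqw_def eqo_def equ_def
      by (auto simp: w o algebra_simps)
  qed
  ultimately show ?thesis
    by (rule back_subst[of Ex1, OF _ ext])
qed

lemma solves_upto_Suc:
  "solves_upto D (Suc n) Z \<longleftrightarrow> solves_upto D n Z \<and> Z (Suc n) \<in> states D \<and>
    (if n = 0 then level1 D (Z 0) (Z 1) else level_step D n (Z (n - 1)) (Z n) (Z (n + 1)))"
  unfolding solves_upto_def by (cases "n = 0") (auto simp: le_Suc_eq less_Suc_eq)

lemma solves_upto_cong: "(\<And>m. m \<le> n \<Longrightarrow> Z m = Z' m) \<Longrightarrow> solves_upto D n Z \<longleftrightarrow> solves_upto D n Z'"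
  unfolding solves_upto_def by (auto simp: Suc_le_eq)

lemma next_level_ex1:
  assumes "solves_upto D n Z"
  shows "\<exists>!z. z \<in> states D \<and>
    (if n = 0 then level1 D (Z 0) z else level_step D n (Z (n - 1)) (Z n) z)"
proof -
  \<comment> \<open>\<open>Z\<close> itself is the history certifying \<open>Z n\<close>. For
    \<open>n = 0\<close> the truncated subtraction makes \<open>Z (n - 1)\<close> the same
    state.\<close>
  have sol: "dg_solution D n (Z n)" "Z n \<in> states D" "Z (n - 1) \<in> states D"
    using assms unfolding dg_solution_def by (auto simp: solves_upto_def)
  show ?thesis
  proof (cases "n = 0")
    case True
    with sol level1_ex1[of "Z 0"] show ?thesis by simp
  next
    case False
    with sol level_step_ex1[of "Z (n - 1)" "Z n" n] show ?thesis by simp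
  qed
qed

lemma solves_upto_exists: "\<exists>Z. solves_upto D n Z"
proof (induction n)
  case 0
  obtain z where "z \<in> states D" "level0 D z"
    using level0_ex1 by blast
  then have "solves_upto D 0 (\<lambda>_. z)"
    by (simp add: solves_upto_def)
  then show ?case by blast
next
  case (Suc n)
  then obtain Z where Z: "solves_upto D n Z" ..
  obtain z where z: "z \<in> states D"
      "if n = 0 then level1 D (Z 0) z else level_step D n (Z (n - 1)) (Z n) z"
    using next_level_ex1[OF Z] by blast
  \<comment> \<open>The equations up to level \<open>n\<close> do not see the value stored at
    \<open>Suc n\<close>.\<close>
  have "solves_upto D n (Z(Suc n := z))"
    using Z by (subst solves_upto_cong[of n _ Z]) auto
  with z have "solves_upto D (Suc n) (Z(Suc n := z))"
    by (auto simp: solves_upto_Suc)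
  then show ?case by blast
qed

text \<open>Two solutions of a level may come with different histories, so the whole histories are
  compared; the step is a two-level recursion and uses agreement at \<open>n\<close> and
  \<open>n - 1\<close>.\<close>

lemma solves_upto_unique:
  "solves_upto D n Z \<Longrightarrow> solves_upto D n Z' \<Longrightarrow> m \<le> n \<Longrightarrow> Z m = Z' m"
proof (induction n arbitrary: m)
  case 0
  then show ?case
    using level0_ex1 by (auto simp: solves_upto_def)
next
  case (Suc n)
  then have n: "solves_upto D n Z" "solves_upto D n Z'"
    by (simp_all add: solves_upto_Suc)
  note eq = Suc.IH[OF n]
  have "Z (Suc n) = Z' (Suc n)"
    using next_level_ex1[OF n(1)] Suc.prems(1,2) eq[of n] eq[of "n - 1"]
    by (auto simp: solves_upto_Suc split: if_splits)
  with eq Suc.prems(3) show ?case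
    by (auto simp: le_Suc_eq)
qed

end

theorem proposition1:
  fixes D :: biot and n :: nat
  assumes "valid_mesh D"
    and "valid_data D"
    and "standing_i D"
    and "standing_ii D"
    and "dg_norms_definite D"
    and "\<exists>c>0. \<forall>s\<in>{eps D..1 - eps D}. c \<le> mob_w D s"
    and "\<exists>c>0. \<forall>s\<in>{eps D..1 - eps D}. c \<le> mob_o D s"
  shows "\<exists>!z. z \<in> Q_h D \<times> Q_h D \<times> V_h D \<and> dg_solution D n z"
proof -
  obtain Z where Z: "solves_upto D n Z"
    using solves_upto_exists[OF assms] by blast
  show ?thesis
  proof (rule ex1I[of _ "Z n"])
    show "Z n \<in> Q_h D \<times> Q_h D \<times> V_h D \<and> dg_solution D n (Z n)"
      using Z by (auto simp: dg_solution_def solves_upto_def states_def)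
    show "z = Z n" if "z \<in> Q_h D \<times> Q_h D \<times> V_h D \<and> dg_solution D n z" for z
      using that solves_upto_unique[OF assms _ Z] by (auto simp: dg_solution_def)
  qed
qed

end
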